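(* Let $\Phi$ be an algebraically closed field of characteristic $0$, let $n\ge 1$ and $r\ge 3$ be integers. There is no simple finite-dimensional $r$-ary Filippov superalgebra $\mathcal F$ over $\Phi$ of type $A(0,n)$ such that $\mathcal F$ is a highest weight module over $A(0,n)$.
   Context: For an integer $r\ge 2$, an $r$-ary Filippov superalgebra over a field $k$ is a $\mathbb{Z}_2$-graded vector space $\mathcal F=\mathcal F_{\bar 0}\oplus\mathcal F_{\bar 1}$ over $k$ with an $r$-linear operation $[\cdot,\ldots,\cdot]$ that respects the grading (if $x_i\in\mathcal F_{\alpha_i}$ then $[x_1,\ldots,x_r]\in\mathcal F_{\alpha_1+\cdots+\alpha_r}$) and satisfies, for homogeneous elements with parities $p(\cdot)$: (1) $[x_1,\ldots,x_{i-1},x_i,\ldots,x_r]=-(-1)^{p(x_{i-1})p(x_i)}[x_1,\ldots,x_i,x_{i-1},\ldots,x_r]$; (2) $[y_2,\ldots,y_r,[x_1,\ldots,x_r]]=\sum_{i=1}^r(-1)^{p q_i}[x_1,\ldots,[y_2,\ldots,y_r,x_i],\ldots,x_r]$, where $p=\sum_{j=2}^r p(y_j)$ and $q_i=\sum_{j=1}^{i-1}p(x_j)$. An ideal of $\mathcal F$ is a $\mathbb Z_2$-graded subspace $I$ with $[I,\mathcal F,\ldots,\mathcal F]\subseteq I$. $\mathcal F$ is simple if $[\mathcal F,\ldots,\mathcal F]\ne 0$ and its only ideals are $0$ and $\mathcal F$. $Inder(\mathcal F)$ is the linear span in $End(\mathcal F)$ of the left multiplications $L(x_1,\ldots,x_{r-1}):y\mapsto[x_1,\ldots,x_{r-1},y]$;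 it is a Lie superalgebra under the supercommutator $[a,b]=ab-(-1)^{p(a)p(b)}ba$. For a Lie superalgebra $G$, $\mathcal F$ has type $G$ if $Inder(\mathcal F)\cong G$ as Lie superalgebras; $\mathcal F$ is then regarded as a $G$-module through this isomorphism. $A(0,n):=sl(1,n+1)$ is the Lie superalgebra (under the supercommutator) of block matrices $\begin{pmatrix}A&B\\C&D\end{pmatrix}$ over $\Phi$ with $A$ of size $1\times1$, $D$ of size $(n+1)\times(n+1)$ and $\mathrm{tr}(A)=\mathrm{tr}(D)$; the even part is given by $B=0,C=0$ and the odd part by $A=0,D=0$. Let $e_{kl}$ be the matrix units, $H=\langle h_1,\ldots,h_{n+1}\rangle$ with $h_1=e_{11}+e_{22}$ and $h_i=e_{ii}-e_{i+1,i+1}$ for $2\le i\le n+1$, and $N^+=\langle e_{kl}: k<l\rangle$. A highest weight module is a module generated by a nonzero homogeneous vector $v$ with $N^+v=0$ and $h_iv=a_iv$ for some $a_i\in\Phi$. *)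

theory Defs
  imports
    "HOL-Computational_Algebra.Polynomial"
    "HOL-Library.Z2"
    "HOL-Library.Function_Algebras"
    "Jordan_Normal_Form.Matrix"
begin

section \<open>Graded vector spaces\<close>

text \<open>The field \<open>bit\<close> with two elements is used for the parities.\<close>

definition koszul_sign :: "bit \<Rightarrow> 'k::comm_ring_1" where
  "koszul_sign p = (if p = 1 then - 1 else 1)"

locale super_vector_space = vector_space scale
  for scale :: "'k::field \<Rightarrow> 'v::ab_group_add \<Rightarrow> 'v" +
  fixes V :: "bit \<Rightarrow> 'v set"
  assumes subspace_part: "subspace (V p)"
    and parts_disjoint: "V 0 \<inter> V 1 = {0}"
    and parts_sum: "\<exists>a\<in>V 0. \<exists>b\<in>V 1. x = a + b"

definition finite_dim :: "('k::field \<Rightarrow> 'v::ab_group_add \<Rightarrow> 'v) \<Rightarrow> bool" where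
  "finite_dim scale \<longleftrightarrow> (\<exists>B. finite B \<and> module.span scale B = UNIV)"

definition graded_subspace ::
  "('k::field \<Rightarrow> 'v::ab_group_add \<Rightarrow> 'v) \<Rightarrow> (bit \<Rightarrow> 'v set) \<Rightarrow> 'v set \<Rightarrow> bool" where
  "graded_subspace scale V I \<longleftrightarrow> module.subspace scale I \<and>
     (\<forall>x\<in>I. \<exists>a\<in>I \<inter> V 0. \<exists>b\<in>I \<inter> V 1. x = a + b)"

text \<open>The entries of \<open>xs\<close> are homogeneous with parities listed by \<open>ps\<close>.
  (The zero vector is homogeneous of both parities.)\<close>

definition has_parities :: "(bit \<Rightarrow> 'v set) \<Rightarrow> 'v list \<Rightarrow> bit list \<Rightarrow> bool" where
  "has_parities V xs ps \<longleftrightarrow> list_all2 (\<lambda>x p. x \<in> V p) xs ps"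


section \<open>Filippov superalgebras\<close>

text \<open>The \<open>r\<close>-ary operation takes its arguments as a list; only its values on lists
  of length \<open>r\<close> are meaningful.\<close>

locale filippov_superalgebra = super_vector_space scale V
  for scale :: "'k::field \<Rightarrow> 'v::ab_group_add \<Rightarrow> 'v" and V :: "bit \<Rightarrow> 'v set" +
  fixes r :: nat and br :: "'v list \<Rightarrow> 'v"
  assumes arity: "r \<ge> 2"
    and multilinear: "length xs + length ys + 1 = r \<Longrightarrow>
      Vector_Spaces.linear scale scale (\<lambda>x. br (xs @ x # ys))"
    and br_graded: "length xs = r \<Longrightarrow> has_parities V xs ps \<Longrightarrow> br xs \<in> V (sum_list ps)"
    and br_antisym: "length xs + length ys + 2 = r \<Longrightarrow>
      has_parities V (xs @ x # y # ys) (ps @ p # q # qs) \<Longrightarrow> length ps = length xs \<Longrightarrow>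
      br (xs @ x # y # ys) = - scale (koszul_sign (p * q)) (br (xs @ y # x # ys))"
    and br_filippov: "length ys = r - 1 \<Longrightarrow> length xs = r \<Longrightarrow>
      has_parities V ys ps \<Longrightarrow> has_parities V xs qs \<Longrightarrow>
      br (ys @ [br xs]) =
        (\<Sum>i<r. scale (koszul_sign (sum_list ps * sum_list (take i qs)))
                  (br (xs[i := br (ys @ [xs ! i])])))"

definition filippov_ideal ::
  "('k::field \<Rightarrow> 'v::ab_group_add \<Rightarrow> 'v) \<Rightarrow> (bit \<Rightarrow> 'v set) \<Rightarrow> nat \<Rightarrow> ('v list \<Rightarrow> 'v)
    \<Rightarrow> 'v set \<Rightarrow> bool" where
  "filippov_ideal scale V r br I \<longleftrightarrow> graded_subspace scale V I \<and>
     (\<forall>x\<in>I. \<forall>ys. length ys = r - 1 \<longrightarrow> br (x # ys) \<in> I)"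

definition simple_filippov ::
  "('k::field \<Rightarrow> 'v::ab_group_add \<Rightarrow> 'v) \<Rightarrow> (bit \<Rightarrow> 'v set) \<Rightarrow> nat \<Rightarrow> ('v list \<Rightarrow> 'v)
    \<Rightarrow> bool" where
  "simple_filippov scale V r br \<longleftrightarrow>
     (\<exists>xs. length xs = r \<and> br xs \<noteq> 0) \<and>
     (\<forall>I. filippov_ideal scale V r br I \<longrightarrow> I = {0} \<or> I = UNIV)"


section \<open>Lie superalgebras and their isomorphisms\<close>

text \<open>The bracket field gives the bracket \<open>bracket p q a b\<close> of homogeneous elements
  \<open>a\<close>, \<open>b\<close> of parities \<open>p\<close>, \<open>q\<close>; by bilinearity this determines the whole bracket.\<close>

record ('k, 'g) lie_super =
  elems :: "'g set"
  part :: "bit \<Rightarrow> 'g set"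
  smul :: "'k \<Rightarrow> 'g \<Rightarrow> 'g"
  bracket :: "bit \<Rightarrow> bit \<Rightarrow> 'g \<Rightarrow> 'g \<Rightarrow> 'g"

definition supercommutator ::
  "('k::comm_ring_1 \<Rightarrow> 'g \<Rightarrow> 'g) \<Rightarrow> ('g \<Rightarrow> 'g \<Rightarrow> 'g) \<Rightarrow> bit \<Rightarrow> bit \<Rightarrow> 'g \<Rightarrow> 'g \<Rightarrow> 'g::minus" where
  "supercommutator scl prd p q a b = prd a b - scl (koszul_sign (p * q)) (prd b a)"

definition lie_super_iso ::
  "('k, 'g::plus) lie_super \<Rightarrow> ('k, 'h::plus) lie_super \<Rightarrow> ('g \<Rightarrow> 'h) \<Rightarrow> bool" where
  "lie_super_iso G K \<phi> \<longleftrightarrow>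
     bij_betw \<phi> (elems G) (elems K) \<and>
     (\<forall>a\<in>elems G. \<forall>b\<in>elems G. \<phi> (a + b) = \<phi> a + \<phi> b) \<and>
     (\<forall>c. \<forall>a\<in>elems G. \<phi> (smul G c a) = smul K c (\<phi> a)) \<and>
     (\<forall>p. \<phi> ` part G p = part K p) \<and>
     (\<forall>p q. \<forall>a\<in>part G p. \<forall>b\<in>part G q. \<phi> (bracket G p q a b) = bracket K p q (\<phi> a) (\<phi> b))"


section \<open>Inner derivations\<close>

definition fun_scale :: "('k \<Rightarrow> 'v \<Rightarrow> 'v) \<Rightarrow> 'k \<Rightarrow> ('v \<Rightarrow> 'v) \<Rightarrow> 'v \<Rightarrow> 'v" where
  "fun_scale scale c f = (\<lambda>x. scale c (f x))"

definition left_mult :: "('v list \<Rightarrow> 'v) \<Rightarrow> 'v list \<Rightarrow> 'v \<Rightarrow> 'v" where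
  "left_mult br xs = (\<lambda>y. br (xs @ [y]))"

definition inder_space ::
  "('k::field \<Rightarrow> 'v::ab_group_add \<Rightarrow> 'v) \<Rightarrow> nat \<Rightarrow> ('v list \<Rightarrow> 'v) \<Rightarrow> ('v \<Rightarrow> 'v) set" where
  "inder_space scale r br =
     module.span (fun_scale scale) {left_mult br xs | xs. length xs = r - 1}"

text \<open>The grading is the one inherited from the endomorphisms: parity \<open>p\<close> means shifting
  the parity of vectors by \<open>p\<close>.\<close>

definition Inder ::
  "('k::field \<Rightarrow> 'v::ab_group_add \<Rightarrow> 'v) \<Rightarrow> (bit \<Rightarrow> 'v set) \<Rightarrow> nat \<Rightarrow> ('v list \<Rightarrow> 'v)
    \<Rightarrow> ('k, 'v \<Rightarrow> 'v) lie_super" where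
  "Inder scale V r br =
     \<lparr> elems = inder_space scale r br,
       part = (\<lambda>p. {f \<in> inder_space scale r br. \<forall>q. f ` V q \<subseteq> V (p + q)}),
       smul = fun_scale scale,
       bracket = supercommutator (fun_scale scale) (\<circ>) \<rparr>"


section \<open>The Lie superalgebra \<open>A(0,n)\<close>\<close>

definition mat_trace :: "'k::comm_monoid_add mat \<Rightarrow> 'k" where
  "mat_trace A = (\<Sum>i<dim_row A. A $$ (i, i))"

definition sl_super_carrier :: "nat \<Rightarrow> nat \<Rightarrow> 'k::comm_ring_1 mat set" where
  "sl_super_carrier m l = {four_block_mat A B C D | A B C D.
     A \<in> carrier_mat m m \<and> B \<in> carrier_mat m l \<and> C \<in> carrier_mat l m \<and> D \<in> carrier_mat l l \<and>
     mat_trace A = mat_trace D}"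

definition sl_super_part :: "nat \<Rightarrow> nat \<Rightarrow> bit \<Rightarrow> 'k::comm_ring_1 mat set" where
  "sl_super_part m l p =
     (if p = 0
      then {four_block_mat A (0\<^sub>m m l) (0\<^sub>m l m) D | A D.
              A \<in> carrier_mat m m \<and> D \<in> carrier_mat l l \<and> mat_trace A = mat_trace D}
      else {four_block_mat (0\<^sub>m m m) B C (0\<^sub>m l l) | B C.
              B \<in> carrier_mat m l \<and> C \<in> carrier_mat l m})"

definition sl_super :: "nat \<Rightarrow> nat \<Rightarrow> ('k::comm_ring_1, 'k mat) lie_super" where
  "sl_super m l =
     \<lparr> elems = sl_super_carrier m l,
       part = sl_super_part m l,
       smul = (\<cdot>\<^sub>m),
       bracket = supercommutator (\<cdot>\<^sub>m) (*) \<rparr>"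

definition A0 :: "nat \<Rightarrow> ('k::comm_ring_1, 'k mat) lie_super" where
  "A0 n = sl_super 1 (n + 1)"

text \<open>Matrix units of size \<open>N\<close>, with rows and columns numbered from 1 as in the usual
  notation (the library numbers matrix entries from 0).\<close>

definition e_unit :: "nat \<Rightarrow> nat \<Rightarrow> nat \<Rightarrow> 'k::zero_neq_one mat" where
  "e_unit N k l = mat N N (\<lambda>(i, j). if Suc i = k \<and> Suc j = l then 1 else 0)"

definition h_elt :: "nat \<Rightarrow> nat \<Rightarrow> 'k::comm_ring_1 mat" where
  "h_elt n i =
     (if i = 1 then e_unit (n + 2) 1 1 + e_unit (n + 2) 2 2
      else e_unit (n + 2) i i - e_unit (n + 2) (i + 1) (i + 1))"

definition mat_subspace :: "nat \<Rightarrow> 'k::comm_ring_1 mat set \<Rightarrow> bool" where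
  "mat_subspace N S \<longleftrightarrow> S \<subseteq> carrier_mat N N \<and> 0\<^sub>m N N \<in> S \<and>
     (\<forall>A\<in>S. \<forall>B\<in>S. A + B \<in> S) \<and> (\<forall>c. \<forall>A\<in>S. c \<cdot>\<^sub>m A \<in> S)"

text \<open>The library has no linear span of matrices of a given size, so the span is taken as a hull.\<close>

definition N_plus :: "nat \<Rightarrow> 'k::comm_ring_1 mat set" where
  "N_plus n = mat_subspace (n + 2) hull {e_unit (n + 2) k l | k l. 1 \<le> k \<and> k < l \<and> l \<le> n + 2}"


section \<open>Highest weight modules over \<open>A(0,n)\<close>\<close>

text \<open>The action of \<open>A(0,n)\<close> on the space is given by \<open>\<rho>\<close>.\<close>

definition A0_submodule ::
  "('k::field \<Rightarrow> 'v::ab_group_add \<Rightarrow> 'v) \<Rightarrow> nat \<Rightarrow> ('k mat \<Rightarrow> 'v \<Rightarrow> 'v) \<Rightarrow> 'v set \<Rightarrow> bool" where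
  "A0_submodule scale n \<rho> W \<longleftrightarrow> module.subspace scale W \<and>
     (\<forall>g\<in>elems (A0 n). \<forall>w\<in>W. \<rho> g w \<in> W)"

definition highest_weight_module ::
  "('k::field \<Rightarrow> 'v::ab_group_add \<Rightarrow> 'v) \<Rightarrow> (bit \<Rightarrow> 'v set) \<Rightarrow> nat \<Rightarrow> ('k mat \<Rightarrow> 'v \<Rightarrow> 'v) \<Rightarrow> bool" where
  "highest_weight_module scale V n \<rho> \<longleftrightarrow>
     (\<exists>v p a. v \<noteq> 0 \<and> v \<in> V p \<and>
        (\<forall>x\<in>N_plus n. \<rho> x v = 0) \<and>
        (\<forall>i\<in>{1..n + 1}. \<rho> (h_elt n i) v = scale (a i) v) \<and>
        A0_submodule scale n \<rho> hull {v} = UNIV)"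

end

(*
Inder(F) being sl(1,n+1), F is an irreducible module, graded by weights, and the operation gives an
equivariant map from (r-1)-tuples of vectors onto sl(1,n+1). If weight vectors u_1, ..., u_{r-1} give
a root vector e and e y is nonzero, skew-symmetry allows y to be exchanged with any u_t, so the
weight of e minus the weight of u_t plus the weight of y is again a root or 0. Applied to the
grading of sl(1,n+1) with the odd part in degrees 1 and -1, this bounds the number of degrees
occurring in F by three and determines how the tuples of odd root vectors are distributed among
them. Computations with the odd lowering operators on a highest weight vector then leave two
highest weights: that of the adjoint representation, where an exchange produces an element of the
Cartan subalgebra that does not annihilate the zero weight space, and, for n = 1, that of the
natural representation of osp(2,2), which has dimension 4.
*)
theory Submission
  imports Defs
begin

section \<open>Matrices of the Lie superalgebra\<close>

text \<open>Weights take values in the field, but vectors reached from one weight vector differ from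
  it by integral offsets, and coordinate 0 of the offset is the degree: the sum of all
  \<open>H j\<close> acts by a constant plus n times it. The arity enters through
  \<open>kappa\<close>, the offset equal to r-1 times the highest weight: the offsets of a tuple
  plus \<open>kappa\<close> sum to a root or 0, and every exchange is arithmetic in this equation.
  Irreducibility is used in the form that nonzero weight vectors whose span is stable under the root
  vectors span everything, since such a span is an ideal. (r-1) times the sum of the
  \<open>b j\<close> equals n times \<open>kappa 0\<close>, so the count of degrees restricts the
  highest weight; with three degrees the sum is n. Further constraints come from products of odd
  lowering operators that fall below the lowest degree and hence vanish: raising such a product with
  \<open>E 0 j\<close> returns a shorter product times an explicit scalar, \<open>1 - b j\<close> or
  \<open>b j - 2\<close>. Dominance under the even part and the bound
  \<open>b 1 - b (n + 1) \<le> 1\<close> then leave two weights.\<close>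

lemma bit_eq_0_or_1: "(q::bit) = 0 \<or> q = 1"
  by (cases q) auto

text \<open>Block form traded for entries: the 1x1 block sits at index 0, so its trace is the entry
  there. All matrix identities below are checked entrywise.\<close>

lemma sl_super_carrier_iff:
  fixes A :: "'k::comm_ring_1 mat"
  shows "A \<in> elems (A0 n) \<longleftrightarrow>
    A \<in> carrier_mat (n + 2) (n + 2) \<and> A $$ (0, 0) = (\<Sum>j\<in>{1..n + 1}. A $$ (j, j))"
    (is "?l \<longleftrightarrow> ?r")
proof
  assume ?l
  then obtain P B C D where A: "A = four_block_mat P B C D"
    and c: "P \<in> carrier_mat 1 1" "B \<in> carrier_mat 1 (n + 1)" "C \<in> carrier_mat (n + 1) 1"
      "D \<in> carrier_mat (n + 1) (n + 1)" and t: "mat_trace P = mat_trace D"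
    by (auto simp: A0_def sl_super_def sl_super_carrier_def)
  have "(\<Sum>j\<in>{1..n + 1}. A $$ (j, j)) = (\<Sum>j\<in>{1..n + 1}. D $$ (j - 1, j - 1))"
    using c by (intro sum.cong) (auto simp: A)
  also have "\<dots> = (\<Sum>j<n + 1. D $$ (j, j))"
    by (rule sum.reindex_bij_witness[of _ Suc "\<lambda>j. j - 1"]) auto
  finally show ?r
    using c t by (auto simp: A mat_trace_def)
next
  assume r: ?r
  define P where "P = mat 1 1 (\<lambda>(i, j). A $$ (i, j))"
  define B where "B = mat 1 (n + 1) (\<lambda>(i, j). A $$ (i, j + 1))"
  define C where "C = mat (n + 1) 1 (\<lambda>(i, j). A $$ (i + 1, j))"
  define D where "D = mat (n + 1) (n + 1) (\<lambda>(i, j). A $$ (i + 1, j + 1))"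
  have "(\<Sum>j\<in>{1..n + 1}. A $$ (j, j)) = (\<Sum>j<n + 1. A $$ (j + 1, j + 1))"
    by (rule sum.reindex_bij_witness[of _ Suc "\<lambda>j. j - 1"]) auto
  then have "mat_trace P = mat_trace D"
    using r by (auto simp: mat_trace_def P_def D_def)
  moreover have "A = four_block_mat P B C D"
    using r by (intro eq_matI) (auto simp: P_def B_def C_def D_def less_Suc_eq_0_disj)
  moreover have "P \<in> carrier_mat 1 1" "B \<in> carrier_mat 1 (n + 1)" "C \<in> carrier_mat (n + 1) 1"
      "D \<in> carrier_mat (n + 1) (n + 1)"
    by (auto simp: P_def B_def C_def D_def)
  ultimately show ?l
    unfolding A0_def sl_super_def sl_super_carrier_def by auto
qed

lemma sl_super_part_iff:
  fixes A :: "'k::comm_ring_1 mat"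
  shows "A \<in> part (A0 n) q \<longleftrightarrow> A \<in> elems (A0 n) \<and>
    (\<forall>i<n + 2. \<forall>j<n + 2. A $$ (i, j) \<noteq> 0 \<longrightarrow> (q = 1 \<longleftrightarrow> (i = 0) \<noteq> (j = 0)))"
    (is "?l \<longleftrightarrow> ?r")
proof (cases "q = 0")
  case q: True
  show ?thesis
  proof
    assume ?l
    then obtain P D where A: "A = four_block_mat P (0\<^sub>m 1 (n + 1)) (0\<^sub>m (n + 1) 1) D"
      and c: "P \<in> carrier_mat 1 1" "D \<in> carrier_mat (n + 1) (n + 1)"
      and t: "mat_trace P = mat_trace D"
      by (auto simp: A0_def sl_super_def sl_super_part_def q)
    have "A \<in> elems (A0 n)"
      unfolding A0_def sl_super_def sl_super_carrier_def A lie_super.simps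
      using c t zero_carrier_mat by blast
    then show ?r
      using c q by (auto simp: A)
  next
    assume r: ?r
    then have "A \<in> elems (A0 n)" by simp
    then obtain P B C D where A: "A = four_block_mat P B C D"
      and c: "P \<in> carrier_mat 1 1" "B \<in> carrier_mat 1 (n + 1)" "C \<in> carrier_mat (n + 1) 1"
        "D \<in> carrier_mat (n + 1) (n + 1)" and t: "mat_trace P = mat_trace D"
      by (auto simp: A0_def sl_super_def sl_super_carrier_def)
    have z: "A $$ (0, j + 1) = 0" "A $$ (j + 1, 0) = 0" if "j < n + 1" for j
      using r q that by auto
    have "B = 0\<^sub>m 1 (n + 1)"
      using c z(1) by (intro eq_matI) (auto simp: A)
    moreover have "C = 0\<^sub>m (n + 1) 1"
      using c z(2) by (intro eq_matI) (auto simp: A)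
    ultimately show ?l
      using c t A by (auto simp: A0_def sl_super_def sl_super_part_def q)
  qed
next
  case False
  then have q: "q = 1" using bit_eq_0_or_1 by blast
  show ?thesis
  proof
    assume ?l
    then obtain B C where A: "A = four_block_mat (0\<^sub>m 1 1) B C (0\<^sub>m (n + 1) (n + 1))"
      and c: "B \<in> carrier_mat 1 (n + 1)" "C \<in> carrier_mat (n + 1) 1"
      by (auto simp: A0_def sl_super_def sl_super_part_def q)
    have "A \<in> elems (A0 n)"
      unfolding sl_super_carrier_iff using c by (auto simp: A intro!: sum.neutral)
    then show ?r
      using c q by (auto simp: A)
  next
    assume r: ?r
    then have "A \<in> elems (A0 n)" by simp
    then obtain P B C D where A: "A = four_block_mat P B C D"
      and c: "P \<in> carrier_mat 1 1" "B \<in> carrier_mat 1 (n + 1)" "C \<in> carrier_mat (n + 1) 1"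
        "D \<in> carrier_mat (n + 1) (n + 1)" and t: "mat_trace P = mat_trace D"
      by (auto simp: A0_def sl_super_def sl_super_carrier_def)
    have z: "A $$ (0, 0) = 0" "\<And>i j. i < n + 1 \<Longrightarrow> j < n + 1 \<Longrightarrow> A $$ (i + 1, j + 1) = 0"
      using r q by auto
    have "P = 0\<^sub>m 1 1"
      using c z(1) by (intro eq_matI) (auto simp: A)
    moreover have "D = 0\<^sub>m (n + 1) (n + 1)"
      using c z(2) by (intro eq_matI) (auto simp: A)
    ultimately show ?l
      using c A by (auto simp: A0_def sl_super_def sl_super_part_def q)
  qed
qed

section \<open>Matrix units and a symmetric basis of the Cartan subalgebra\<close>

definition e0 :: "nat \<Rightarrow> nat \<Rightarrow> nat \<Rightarrow> 'k::zero_neq_one mat" where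
  "e0 n k l = mat (n + 2) (n + 2) (\<lambda>(i, j). if i = k \<and> j = l then 1 else 0)"

text \<open>The supercommutator of \<open>e0 n 0 j\<close> and \<open>e0 n j 0\<close>. These
  elements form a basis of the Cartan subalgebra that treats the indices 1 to n+1 alike; the
  \<open>h_elt\<close> are \<open>h0 n 1\<close> and the differences of neighbours.\<close>

definition h0 :: "nat \<Rightarrow> nat \<Rightarrow> 'k::comm_ring_1 mat" where
  "h0 n j = e0 n 0 0 + e0 n j j"

text \<open>Diagonal entries of \<open>h0 n j\<close>; hence \<open>dchar j k - dchar j l\<close> is
  the eigenvalue of the adjoint action of \<open>h0 n j\<close> on \<open>e0 n k l\<close>.\<close>

definition dchar :: "nat \<Rightarrow> nat \<Rightarrow> 'k::comm_ring_1" where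
  "dchar j k = (if k = 0 \<or> k = j then 1 else 0)"

definition rpar :: "nat \<Rightarrow> nat \<Rightarrow> bit" where
  "rpar k l = (if (k = 0) \<noteq> (l = 0) then 1 else 0)"

lemma e0_index [simp]:
  "i < n + 2 \<Longrightarrow> j < n + 2 \<Longrightarrow> e0 n k l $$ (i, j) = (if i = k \<and> j = l then 1 else 0)"
  by (simp add: e0_def)

lemma e0_carrier [simp]: "e0 n k l \<in> carrier_mat (n + 2) (n + 2)"
  by (simp add: e0_def)

lemma e0_dim [simp]: "dim_row (e0 n k l) = n + 2" "dim_col (e0 n k l) = n + 2"
  by (simp_all add: e0_def)

lemma h0_carrier [simp]: "h0 n j \<in> carrier_mat (n + 2) (n + 2)"
  unfolding h0_def by (intro add_carrier_mat e0_carrier)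

lemma h0_dim [simp]: "dim_row (h0 n j) = n + 2" "dim_col (h0 n j) = n + 2"
  by (simp_all add: h0_def)

lemma h0_index [simp]:
  "j \<ge> 1 \<Longrightarrow> i < n + 2 \<Longrightarrow> l < n + 2 \<Longrightarrow> h0 n j $$ (i, l) = (if i = l then dchar j i else 0)"
  by (auto simp: h0_def dchar_def)

lemma e0_part: "k \<noteq> l \<Longrightarrow> k \<le> n + 1 \<Longrightarrow> l \<le> n + 1 \<Longrightarrow> e0 n k l \<in> part (A0 n) (rpar k l)"
  unfolding sl_super_part_iff sl_super_carrier_iff
  by (auto simp: rpar_def intro!: sum.neutral[symmetric] sum.neutral)

lemma h0_part: "j \<in> {1..n + 1} \<Longrightarrow> h0 n j \<in> part (A0 n) 0"
proof -
  assume j: "j \<in> {1..n + 1}"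
  have "(\<Sum>i\<in>{1..n + 1}. h0 n j $$ (i, i)) = (\<Sum>i\<in>{1..n + 1}. if i = j then 1 else (0::'a))"
    using j by (intro sum.cong) (auto simp: dchar_def)
  also have "\<dots> = 1" using j by simp
  finally show ?thesis
    unfolding sl_super_part_iff sl_super_carrier_iff using j by (auto simp: dchar_def)
qed

lemma part_elems: "A \<in> part (A0 n) q \<Longrightarrow> A \<in> elems (A0 n)"
  by (simp add: sl_super_part_iff)

lemma e0_mult: "l \<le> n + 1 \<Longrightarrow> k' \<le> n + 1 \<Longrightarrow>
  e0 n k l * e0 n k' l' = (if l = k' then e0 n k l' else 0\<^sub>m (n + 2) (n + 2) :: 'k::comm_ring_1 mat)"
proof (rule eq_matI)
  assume kl: "l \<le> n + 1" "k' \<le> n + 1"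
  let ?R = "if l = k' then e0 n k l' else 0\<^sub>m (n + 2) (n + 2) :: 'k mat"
  fix i j assume "i < dim_row ?R" "j < dim_col ?R"
  then have ij: "i < n + 2" "j < n + 2" by (auto split: if_splits)
  have "(e0 n k l * e0 n k' l' :: 'k mat) $$ (i, j)
      = (\<Sum>m = 0..<n + 2. e0 n k l $$ (i, m) * e0 n k' l' $$ (m, j))"
    using ij by (simp add: scalar_prod_def)
  also have "\<dots> = (\<Sum>m = 0..<n + 2. if m = l then if i = k \<and> l = k' \<and> j = l' then 1 else 0 else 0)"
    using ij by (intro sum.cong) auto
  also have "\<dots> = (if i = k \<and> l = k' \<and> j = l' then 1 else 0)"
    using kl by (subst sum.delta) auto
  finally show "(e0 n k l * e0 n k' l') $$ (i, j) = ?R $$ (i, j)"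
    using ij by simp
qed auto

lemma h0_mult:
  assumes "A \<in> carrier_mat (n + 2) (n + 2)" "j \<ge> 1"
  shows "h0 n j * A = mat (n + 2) (n + 2) (\<lambda>(i, l). dchar j i * A $$ (i, l) :: 'k::comm_ring_1)"
    and "A * h0 n j = mat (n + 2) (n + 2) (\<lambda>(i, l). A $$ (i, l) * dchar j l :: 'k::comm_ring_1)"
proof -
  show "h0 n j * A = mat (n + 2) (n + 2) (\<lambda>(i, l). dchar j i * A $$ (i, l))"
  proof (rule eq_matI)
    fix i l assume il: "i < dim_row (mat (n + 2) (n + 2) (\<lambda>(i, l). dchar j i * A $$ (i, l)))"
      "l < dim_col (mat (n + 2) (n + 2) (\<lambda>(i, l). dchar j i * A $$ (i, l)))"
    have "(h0 n j * A) $$ (i, l) = (\<Sum>m = 0..<n + 2. h0 n j $$ (i, m) * A $$ (m, l))"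
      using assms il by (simp add: scalar_prod_def)
    also have "\<dots> = (\<Sum>m = 0..<n + 2. if m = i then dchar j i * A $$ (i, l) else 0)"
      using assms il by (intro sum.cong) auto
    finally show "(h0 n j * A) $$ (i, l) = mat (n + 2) (n + 2) (\<lambda>(i, l). dchar j i * A $$ (i, l)) $$ (i, l)"
      using il by simp
  qed (use assms in auto)
  show "A * h0 n j = mat (n + 2) (n + 2) (\<lambda>(i, l). A $$ (i, l) * dchar j l)"
  proof (rule eq_matI)
    fix i l assume il: "i < dim_row (mat (n + 2) (n + 2) (\<lambda>(i, l). A $$ (i, l) * dchar j l))"
      "l < dim_col (mat (n + 2) (n + 2) (\<lambda>(i, l). A $$ (i, l) * dchar j l))"
    have "(A * h0 n j) $$ (i, l) = (\<Sum>m = 0..<n + 2. A $$ (i, m) * h0 n j $$ (m, l))"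
      using assms il by (simp add: scalar_prod_def)
    also have "\<dots> = (\<Sum>m = 0..<n + 2. if m = l then A $$ (i, l) * dchar j l else 0)"
      using assms il by (intro sum.cong) auto
    finally show "(A * h0 n j) $$ (i, l) = mat (n + 2) (n + 2) (\<lambda>(i, l). A $$ (i, l) * dchar j l) $$ (i, l)"
      using il by simp
  qed (use assms in auto)
qed

text \<open>A basis indexed by matrix positions: (j, j) stands for \<open>h0 n j\<close>, and (0, 0)
  is left out because the trace condition determines that entry. The coefficient of a basis matrix
  is then the entry at its position.\<close>

definition elementary :: "nat \<Rightarrow> nat \<times> nat \<Rightarrow> 'k::comm_ring_1 mat" where
  "elementary n q = (if fst q = snd q then h0 n (fst q) else e0 n (fst q) (snd q))"

definition positions :: "nat \<Rightarrow> (nat \<times> nat) set" where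
  "positions n = {..n + 1} \<times> {..n + 1} - {(0, 0)}"

lemma elementary_elems: "q \<in> positions n \<Longrightarrow> elementary n q \<in> elems (A0 n)"
  by (cases q) (auto simp: elementary_def positions_def
      intro!: part_elems[OF h0_part] part_elems[OF e0_part])

lemma elementary_decomposition:
  fixes A :: "'k::comm_ring_1 mat"
  assumes "A \<in> elems (A0 n)"
  shows "A = mat (n + 2) (n + 2) (\<lambda>a. \<Sum>q\<in>positions n. A $$ q * elementary n q $$ a)"
proof (rule eq_matI)
  note A = assms[unfolded sl_super_carrier_iff]
  have fin: "finite (positions n)" by (simp add: positions_def)
  fix i j assume "i < dim_row (mat (n + 2) (n + 2) (\<lambda>a. \<Sum>q\<in>positions n. A $$ q * elementary n q $$ a))"
    "j < dim_col (mat (n + 2) (n + 2) (\<lambda>a. \<Sum>q\<in>positions n. A $$ q * elementary n q $$ a))"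
  then have ij: "i < n + 2" "j < n + 2" by auto
  have pos: "elementary n q $$ (i, j) = (if q = (i, j) then 1 else if i = 0 \<and> j = 0 \<and> fst q = snd q then 1 else (0::'k))"
    if "q \<in> positions n" for q
    using that ij by (cases q) (auto simp: elementary_def positions_def dchar_def)
  have "(\<Sum>q\<in>positions n. A $$ q * elementary n q $$ (i, j)) = A $$ (i, j)"
  \<comment> \<open>Entry (0, 0) collects a contribution from every \<open>h0 n j\<close>; the trace
    condition says that their sum is right.\<close>
  proof (cases "i = 0 \<and> j = 0")
    case True
    have "(\<Sum>q\<in>positions n. A $$ q * elementary n q $$ (i, j))
        = (\<Sum>q\<in>positions n. if fst q = snd q then A $$ q else 0)"
      using True pos by (intro sum.cong) (auto simp: positions_def)
    also have "\<dots> = (\<Sum>q\<in>(\<lambda>j. (j, j)) ` {1..n + 1}. A $$ q)"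
      by (rule sum.mono_neutral_cong_right) (use fin in \<open>auto simp: positions_def image_iff\<close>)
    also have "\<dots> = (\<Sum>j\<in>{1..n + 1}. A $$ (j, j))"
      by (subst sum.reindex) (auto simp: inj_on_def)
    finally show ?thesis using A True by simp
  next
    case False
    have "(\<Sum>q\<in>positions n. A $$ q * elementary n q $$ (i, j))
        = (\<Sum>q\<in>positions n. if q = (i, j) then A $$ q else 0)"
      using False pos by (intro sum.cong) auto
    also have "\<dots> = A $$ (i, j)"
      using fin False ij by (auto simp: sum.delta positions_def)
    finally show ?thesis .
  qed
  then show "A $$ (i, j) = mat (n + 2) (n + 2) (\<lambda>a. \<Sum>q\<in>positions n. A $$ q * elementary n q $$ a) $$ (i, j)"
    using ij by simp
qed (use assms in \<open>auto simp: sl_super_carrier_iff\<close>)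

lemma elems_add: "A \<in> elems (A0 n) \<Longrightarrow> B \<in> elems (A0 n) \<Longrightarrow> A + B \<in> elems (A0 n :: ('k::comm_ring_1, _) lie_super)"
  by (auto simp: sl_super_carrier_iff sum.distrib)

lemma elems_smult: "A \<in> elems (A0 n) \<Longrightarrow> c \<cdot>\<^sub>m A \<in> elems (A0 n :: ('k::comm_ring_1, _) lie_super)"
  by (auto simp: sl_super_carrier_iff sum_distrib_left distrib_left)

lemma elems_zero: "0\<^sub>m (n + 2) (n + 2) \<in> elems (A0 n :: ('k::comm_ring_1, _) lie_super)"
  by (auto simp: sl_super_carrier_iff intro!: sum.neutral)

section \<open>Lists up to permutation, eigenvalues, graded spans\<close>

text \<open>Adjacent transpositions generate all permutations, and the skew-symmetry axiom only
  exchanges neighbours. The set \<open>A\<close> and the length \<open>m\<close> let the swap step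
  assume homogeneous arguments in the right number.\<close>

lemma mset_eq_adjacent_induct:
  assumes refl: "\<And>zs. R zs zs" and trans: "\<And>as bs cs. R as bs \<Longrightarrow> R bs cs \<Longrightarrow> R as cs"
    and swap: "\<And>as a b bs. set (as @ a # b # bs) \<subseteq> A \<Longrightarrow> length (as @ a # b # bs) = m \<Longrightarrow>
      R (as @ a # b # bs) (as @ b # a # bs)"
    and "mset xs = mset ys" "set xs \<subseteq> A" "length xs = m"
  shows "R xs ys"
proof -
  have move: "R (pre @ a # zs @ post) (pre @ zs @ a # post)"
    if "set (pre @ a # zs @ post) \<subseteq> A" "length (pre @ a # zs @ post) = m" for pre zs a post
    using that
  proof (induction zs arbitrary: pre)
    case Nil
    then show ?case by (simp add: refl)
  next
    case (Cons z zs)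
    have 1: "R ((pre @ [z]) @ a # zs @ post) ((pre @ [z]) @ zs @ a # post)"
      by (rule Cons.IH) (use Cons.prems in auto)
    have 2: "R (pre @ a # z # zs @ post) (pre @ z # a # zs @ post)"
      by (rule swap) (use Cons.prems in auto)
    show ?case using trans[OF 2] 1 by simp
  qed
  have "R (pre @ xs) (pre @ ys)" if "mset xs = mset ys" "set (pre @ xs) \<subseteq> A" "length (pre @ xs) = m"
    for pre xs ys
    using that
  proof (induction xs arbitrary: pre ys)
    case Nil
    then show ?case by (simp add: refl)
  next
    case (Cons a xs)
    then have "a \<in> set ys" by (metis list.set_intros(1) mset_eq_setD)
    then obtain ys1 ys2 where ys: "ys = ys1 @ a # ys2" by (meson split_list)
    have m: "mset xs = mset (ys1 @ ys2)" using Cons.prems(1) ys by simp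
    have s: "set xs = set (ys1 @ ys2)" "length xs = length (ys1 @ ys2)"
      using m by (metis mset_eq_setD, metis mset_eq_length)
    have 1: "R ((pre @ [a]) @ xs) ((pre @ [a]) @ ys1 @ ys2)"
      by (rule Cons.IH) (use Cons.prems m in auto)
    have 2: "R (pre @ a # ys1 @ ys2) (pre @ ys1 @ a # ys2)"
      by (rule move) (use Cons.prems s in auto)
    show ?case using trans[OF _ 2] 1 ys by simp
  qed
  from this[of xs ys "[]"] show ?thesis using assms by simp
qed

text \<open>A prefix of arbitrary entries grows by one slot at a time, each slot being extended from
  \<open>S\<close> to its span. Only linearity of \<open>P\<close> in each slot is used, so
  \<open>P\<close> may also be membership of an operator in a subspace.\<close>

lemma (in vector_space) multilinear_extension:
  assumes sub: "\<And>xs ys. length xs + length ys + 1 = m \<Longrightarrow> subspace {x. P (xs @ x # ys)}"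
    and gen: "\<And>xs. length xs = m \<Longrightarrow> set xs \<subseteq> S \<Longrightarrow> P xs"
    and "span S = UNIV" "length xs = m"
  shows "P xs"
proof -
  have "P (xs @ ys)" if "length xs + length ys = m" "set ys \<subseteq> S" for xs ys
    using that
  proof (induction xs arbitrary: ys rule: rev_induct)
    case Nil
    then show ?case using gen by simp
  next
    case (snoc x xs)
    have "S \<subseteq> {x. P (xs @ x # ys)}"
      using snoc.IH[of "_ # ys"] snoc.prems by auto
    moreover have "subspace {x. P (xs @ x # ys)}"
      by (rule sub) (use snoc.prems in auto)
    ultimately have "span S \<subseteq> {x. P (xs @ x # ys)}" by (rule span_minimal)
    then show ?case using assms(3) by auto
  qed
  from this[of xs "[]"] show ?thesis using assms by simp
qed

context vector_space begin

lemma span_eigen_decomposition: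
  assumes "x \<in> span {y. \<exists>a\<in>A. T y = scale a y}"
    and add: "\<And>x y. T (x + y) = T x + T y" and sc: "\<And>c x. T (scale c x) = scale c (T x)"
  shows "\<exists>F u. finite F \<and> F \<subseteq> A \<and> (\<forall>a. T (u a) = scale a (u a)) \<and> x = (\<Sum>a\<in>F. u a)"
proof -
  have T0: "T 0 = 0" using sc[of 0 0] by simp
  show ?thesis
    using assms(1)
  proof (induction rule: span_induct_alt)
    case base
    show ?case by (rule exI[of _ "{}"], rule exI[of _ "\<lambda>_. 0"]) (simp add: T0)
  next
    case (step c y z)
    then obtain F u where F: "finite F" "F \<subseteq> A" "\<And>a. T (u a) = scale a (u a)" "z = (\<Sum>a\<in>F. u a)"
      by blast
    from step obtain b where b: "b \<in> A" "T y = scale b y" by blast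
    define w where "w = (\<lambda>a. (if a \<in> F then u a else 0) + (if a = b then scale c y else 0))"
    have "(\<Sum>a\<in>insert b F. w a) = (\<Sum>a\<in>insert b F. if a \<in> F then u a else 0)
        + (\<Sum>a\<in>insert b F. if a = b then scale c y else 0)"
      unfolding w_def by (rule sum.distrib)
    also have "(\<Sum>a\<in>insert b F. if a = b then scale c y else 0) = scale c y"
      using F(1) by (simp add: sum.delta)
    also have "(\<Sum>a\<in>insert b F. if a \<in> F then u a else 0) = z"
      unfolding F(4) using F(1) by (intro sum.mono_neutral_cong_right) auto
    finally have "scale c y + z = (\<Sum>a\<in>insert b F. w a)" by (simp add: add.commute)
    moreover have "T (w a) = scale a (w a)" for a
      using F(3) b(2) by (auto simp: w_def add sc T0 scale_right_distrib scale_left_commute)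
    ultimately show ?case
      using F b by (intro exI[of _ "insert b F"] exI[of _ w]) auto
  qed
qed

text \<open>Applying \<open>T - a\<close> removes the component for \<open>a\<close>, keeps the
  other eigenvectors, and multiplies \<open>x\<close> by \<open>c - a\<close>, which is not
  0.\<close>

lemma sum_eigenvectors_eq_0:
  assumes "finite F" "\<And>a. T (u a) = scale a (u a)" "x = (\<Sum>a\<in>F. u a)" "T x = scale c x" "c \<notin> F"
    and add: "\<And>x y. T (x + y) = T x + T y" and sc: "\<And>c x. T (scale c x) = scale c (T x)"
  shows "x = 0"
  using assms(1-5)
proof (induction F arbitrary: u x)
  case empty
  then show ?case by simp
next
  case (insert a F)
  have T0: "T 0 = 0" using sc[of 0 0] by simp
  have T_sum: "T (\<Sum>a\<in>G. u a) = (\<Sum>a\<in>G. T (u a))" if "finite G" for G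
    using that by (induction G) (auto simp: add T0)
  have "scale (c - a) x = T x - scale a x"
    by (simp add: insert.prems(3) scale_left_diff_distrib)
  also have "T x = (\<Sum>b\<in>insert a F. scale b (u b))"
    unfolding insert.prems(2) using T_sum[of "insert a F"] insert.hyps insert.prems(1) by simp
  also have "scale a x = (\<Sum>b\<in>insert a F. scale a (u b))"
    unfolding insert.prems(2) by (rule scale_sum_right)
  also have "(\<Sum>b\<in>insert a F. scale b (u b)) - (\<Sum>b\<in>insert a F. scale a (u b))
      = (\<Sum>b\<in>insert a F. scale (b - a) (u b))"
    by (subst sum_subtractf[symmetric]) (simp only: scale_left_diff_distrib)
  also have "\<dots> = (\<Sum>b\<in>F. scale (b - a) (u b))"
    using insert.hyps by simp
  finally have *: "scale (c - a) x = (\<Sum>b\<in>F. scale (b - a) (u b))" .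
  have "scale (c - a) x = 0"
  proof (rule insert.IH[where u = "\<lambda>b. scale (b - a) (u b)"])
    show "scale (c - a) x = (\<Sum>b\<in>F. scale (b - a) (u b))" by (rule *)
    show "T (scale (b - a) (u b)) = scale b (scale (b - a) (u b))" for b
      using insert.prems(1) sc by (simp add: scale_left_commute)
    show "T (scale (c - a) x) = scale c (scale (c - a) x)"
      using insert.prems(3) sc by (simp add: scale_left_commute)
    show "c \<notin> F" using insert.prems(4) by simp
  qed
  then show ?case using insert.prems(4) by simp
qed

lemma eigenvector_span_eq_0:
  assumes "x \<in> span {y. \<exists>a\<in>A. T y = scale a y}" "T x = scale c x" "c \<notin> A"
    and add: "\<And>x y. T (x + y) = T x + T y" and sc: "\<And>c x. T (scale c x) = scale c (T x)"
  shows "x = 0"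
proof -
  obtain F u where "finite F" "F \<subseteq> A" "\<And>a. T (u a) = scale a (u a)" "x = (\<Sum>a\<in>F. u a)"
    using span_eigen_decomposition[OF assms(1) add sc] by blast
  then show ?thesis
    using sum_eigenvectors_eq_0[of F T u x c] assms by blast
qed

text \<open>One eigenvector per eigenvalue gives an independent family, no larger than a finite
  spanning set.\<close>

lemma finite_eigenvalues:
  assumes "finite B" "span B = UNIV"
    and add: "\<And>x y. T (x + y) = T x + T y" and sc: "\<And>c x. T (scale c x) = scale c (T x)"
  shows "finite {a. \<exists>x. x \<noteq> 0 \<and> T x = scale a x}"
proof -
  define A where "A = {a. \<exists>x. x \<noteq> 0 \<and> T x = scale a x}"
  define u where "u = (\<lambda>a. SOME x. x \<noteq> 0 \<and> T x = scale a x)"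
  have u: "u a \<noteq> 0" "T (u a) = scale a (u a)" if "a \<in> A" for a
  proof -
    have "\<exists>x. x \<noteq> 0 \<and> T x = scale a x" using that by (simp add: A_def)
    from someI_ex[OF this] show "u a \<noteq> 0" "T (u a) = scale a (u a)" by (auto simp: u_def)
  qed
  have inj: "inj_on u A"
  proof (rule inj_onI)
    fix a b assume "a \<in> A" "b \<in> A" "u a = u b"
    have "scale a (u a) = scale b (u a)"
      using u(2)[OF \<open>a \<in> A\<close>] u(2)[OF \<open>b \<in> A\<close>] \<open>u a = u b\<close> by metis
    then show "a = b" using u(1)[OF \<open>a \<in> A\<close>] by (metis scale_right_imp_eq)
  qed
  have "independent (u ` A)"
    unfolding dependent_def
  proof (rule notI, elim bexE)
    fix x assume "x \<in> u ` A" and x: "x \<in> span (u ` A - {x})"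
    then obtain a where a: "a \<in> A" "x = u a" by blast
    have "u ` A - {x} \<subseteq> {y. \<exists>b\<in>A - {a}. T y = scale b y}"
      using u a by auto
    then have "x \<in> span {y. \<exists>b\<in>A - {a}. T y = scale b y}"
      using x span_mono by blast
    from eigenvector_span_eq_0[OF this _ _ add sc, of a] have "x = 0"
      using u(2)[OF a(1)] a by simp
    then show False using u(1)[OF a(1)] a by simp
  qed
  then have "finite (u ` A)"
    using independent_span_bound[OF assms(1)] assms(2) by blast
  then show ?thesis
    using inj finite_imageD unfolding A_def by fastforce
qed

end

context super_vector_space begin

lemma graded_subspace_span:
  assumes "\<And>x. x \<in> S \<Longrightarrow> x \<in> V 0 \<or> x \<in> V 1"
  shows "graded_subspace scale V (span S)"
  unfolding graded_subspace_def
proof (intro conjI ballI)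
  fix x assume "x \<in> span S"
  then show "\<exists>a\<in>span S \<inter> V 0. \<exists>b\<in>span S \<inter> V 1. x = a + b"
  proof (induction rule: span_induct_alt)
    case base
    show ?case using subspace_0[OF subspace_part] by (intro bexI[of _ 0]) (auto simp: span_zero)
  next
    case (step c y z)
    then obtain a b where ab: "a \<in> span S \<inter> V 0" "b \<in> span S \<inter> V 1" "z = a + b" by blast
    have y: "scale c y \<in> span S" by (intro span_scale span_base step)
    show ?case
    proof (cases "y \<in> V 0")
      case True
      then have "scale c y + a \<in> span S \<inter> V 0"
        using ab by (auto intro: span_add[OF y] subspace_add[OF subspace_part] subspace_scale[OF subspace_part])
      then show ?thesis using ab by (intro bexI[of _ "scale c y + a"] bexI[of _ b]) (auto simp: add.assoc)
    next
      case False
      then have "y \<in> V 1" using assms step by blast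
      then have "scale c y + b \<in> span S \<inter> V 1"
        using ab by (auto intro: span_add[OF y] subspace_add[OF subspace_part] subspace_scale[OF subspace_part])
      then show ?thesis using ab
        by (intro bexI[of _ a] bexI[of _ "scale c y + b"]) (auto simp: add.left_commute)
    qed
  qed
qed (rule subspace_span)

lemma span_homogeneous: "span (V 0 \<union> V 1) = UNIV"
proof -
  have "x \<in> span (V 0 \<union> V 1)" for x
  proof -
    obtain a b where "a \<in> V 0" "b \<in> V 1" "x = a + b" using parts_sum by blast
    then show ?thesis by (auto intro: span_add span_base)
  qed
  then show ?thesis by blast
qed

lemma homogeneous_both_eq_0: "x \<in> V q \<Longrightarrow> x \<in> V (q + 1) \<Longrightarrow> x = 0"
proof -
  assume x: "x \<in> V q" "x \<in> V (q + 1)"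
  have "x \<in> V 0 \<inter> V 1"
    using bit_eq_0_or_1[of q] x by (elim disjE) simp_all
  then show "x = 0" unfolding parts_disjoint by simp
qed

end

section \<open>Consequences of the axioms of a Filippov superalgebra\<close>

lemma vector_space_fun_scale: "vector_space scale \<Longrightarrow> vector_space (fun_scale scale)"
  unfolding vector_space_def fun_scale_def by (auto simp: fun_eq_iff)

context filippov_superalgebra begin

sublocale fun_space: vector_space "fun_scale scale :: 'k \<Rightarrow> ('v \<Rightarrow> 'v) \<Rightarrow> _"
  by (rule vector_space_fun_scale) unfold_locales

lemma br_add: "length xs + length ys + 1 = r \<Longrightarrow> br (xs @ (x + y) # ys) = br (xs @ x # ys) + br (xs @ y # ys)"
  using multilinear[of xs ys] by (simp add: Vector_Spaces.linear_iff)

lemma br_scale: "length xs + length ys + 1 = r \<Longrightarrow> br (xs @ scale c x # ys) = scale c (br (xs @ x # ys))"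
  using multilinear[of xs ys] by (simp add: Vector_Spaces.linear_iff)

lemma br_zero: "length xs + length ys + 1 = r \<Longrightarrow> br (xs @ 0 # ys) = 0"
  using br_scale[of xs ys 0 0] by simp

lemma has_parities_exists:
  assumes "set xs \<subseteq> V 0 \<union> V 1"
  shows "\<exists>ps. has_parities V xs ps"
  using assms
proof (induction xs)
  case Nil
  then show ?case by (auto simp: has_parities_def)
next
  case (Cons x xs)
  then obtain ps where "has_parities V xs ps" by auto
  moreover obtain p where "x \<in> V p" using Cons by auto
  ultimately have "has_parities V (x # xs) (p # ps)" by (simp add: has_parities_def)
  then show ?case ..
qed

lemma br_swap:
  assumes "length xs + length ys + 2 = r" "set xs \<subseteq> V 0 \<union> V 1" "set ys \<subseteq> V 0 \<union> V 1" "x \<in> V p" "y \<in> V q"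
  shows "br (xs @ x # y # ys) = - scale (koszul_sign (p * q)) (br (xs @ y # x # ys))"
proof -
  obtain ps qs where "has_parities V xs ps" "has_parities V ys qs"
    using has_parities_exists assms(2,3) by blast
  then show ?thesis
    using assms by (intro br_antisym[of xs ys x y ps p q qs])
      (auto simp: has_parities_def list_all2_append list_all2_lengthD)
qed

text \<open>An exchange changes the bracket by a sign only, so membership in a subspace survives
  every permutation and no signs have to be tracked.\<close>

lemma br_permute_in_subspace:
  assumes "subspace I" "mset xs = mset ys" "set xs \<subseteq> V 0 \<union> V 1" "length xs = r" "br xs \<in> I"
  shows "br ys \<in> I"
proof -
  have "br xs \<in> I \<longrightarrow> br ys \<in> I"
  proof (rule mset_eq_adjacent_induct[where R = "\<lambda>xs ys. br xs \<in> I \<longrightarrow> br ys \<in> I", OF _ _ _ assms(2-4)])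
    fix as a b bs assume s: "set (as @ a # b # bs) \<subseteq> V 0 \<union> V 1" "length (as @ a # b # bs) = r"
    then obtain p q where "a \<in> V p" "b \<in> V q" by auto
    then have "br (as @ b # a # bs) = - scale (koszul_sign (q * p)) (br (as @ a # b # bs))"
      using s by (intro br_swap) auto
    then show "br (as @ a # b # bs) \<in> I \<longrightarrow> br (as @ b # a # bs) \<in> I"
      using assms(1) by (simp add: subspace_neg subspace_scale)
  qed auto
  then show ?thesis using assms by blast
qed

lemma br_permute_eq_0:
  assumes "mset xs = mset ys" "set xs \<subseteq> V 0 \<union> V 1" "length xs = r" "br xs = 0"
  shows "br ys = 0"
  using br_permute_in_subspace[OF subspace_single_0 assms(1-3)] assms(4) by simp

text \<open>For two odd neighbours the sign of skew-symmetry and the Koszul sign cancel.\<close>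

lemma br_permute_odd:
  assumes "mset xs = mset ys" "set xs \<subseteq> V 1" "set pre \<subseteq> V 0 \<union> V 1" "length pre + length xs = r"
  shows "br (pre @ xs) = br (pre @ ys)"
proof (rule mset_eq_adjacent_induct[where R = "\<lambda>xs ys. br (pre @ xs) = br (pre @ ys)" and m = "r - length pre", OF _ _ _ assms(1,2)])
  fix as a b bs assume s: "set (as @ a # b # bs) \<subseteq> V 1" "length (as @ a # b # bs) = r - length pre"
  have "br ((pre @ as) @ a # b # bs) = - scale (koszul_sign (1 * 1)) (br ((pre @ as) @ b # a # bs))"
    using s assms by (intro br_swap) auto
  then show "br (pre @ as @ a # b # bs) = br (pre @ as @ b # a # bs)"
    by (simp add: koszul_sign_def)
qed (use assms in auto)

lemma br_repeated_even:
  assumes "x \<in> V 0" "set xs \<subseteq> V 0 \<union> V 1" "length xs = r" "mset xs = add_mset x (add_mset x M)"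
    and char: "(2::'k) \<noteq> 0"
  shows "br xs = 0"
proof -
  obtain zs where zs: "mset zs = M" by (metis ex_mset)
  have m: "mset (x # x # zs) = mset xs" using zs assms(4) by simp
  then have s: "set (x # x # zs) = set xs" "length (x # x # zs) = length xs"
    by (metis mset_eq_setD, metis mset_eq_length)
  have "br ([] @ x # x # zs) = - scale (koszul_sign (0 * 0)) (br ([] @ x # x # zs))"
    using assms s by (intro br_swap) auto
  then have "br (x # x # zs) + br (x # x # zs) = 0"
    by (simp add: koszul_sign_def eq_neg_iff_add_eq_0)
  then have "scale 2 (br (x # x # zs)) = 0"
    using scale_left_distrib[of 1 1 "br (x # x # zs)"] by simp
  then have "br (x # x # zs) = 0" using char by simp
  then show ?thesis
    by (rule br_permute_eq_0[rotated -1]) (use m s assms in auto)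
qed

lemma left_mult_add: "length us = r - 1 \<Longrightarrow> left_mult br us (x + y) = left_mult br us x + left_mult br us y"
  using br_add[of us "[]"] arity by (simp add: left_mult_def)

lemma left_mult_scale: "length us = r - 1 \<Longrightarrow> left_mult br us (scale c x) = scale c (left_mult br us x)"
  using br_scale[of us "[]"] arity by (simp add: left_mult_def)

section \<open>Inner derivations and their parity\<close>

definition lin :: "('v \<Rightarrow> 'v) \<Rightarrow> bool" where
  "lin D \<longleftrightarrow> (\<forall>x y. D (x + y) = D x + D y) \<and> (\<forall>c x. D (scale c x) = scale c (D x))"

lemma lin_add: "lin D \<Longrightarrow> D (x + y) = D x + D y"
  and lin_scale: "lin D \<Longrightarrow> D (scale c x) = scale c (D x)"
  by (simp_all add: lin_def)

lemma lin_0: "lin D \<Longrightarrow> D 0 = 0"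
  using lin_scale[of D 0 0] by simp

lemma subspace_lin: "fun_space.subspace {D. lin D}"
  unfolding fun_space.subspace_def lin_def fun_scale_def
  by (auto simp: scale_right_distrib scale_left_commute)

definition shifts :: "bit \<Rightarrow> ('v \<Rightarrow> 'v) \<Rightarrow> bool" where
  "shifts p D \<longleftrightarrow> lin D \<and> (\<forall>q. \<forall>x\<in>V q. D x \<in> V (p + q))"

lemma subspace_shifts: "fun_space.subspace {D. shifts p D}"
  unfolding fun_space.subspace_def shifts_def
  using subspace_lin[unfolded fun_space.subspace_def]
  by (auto simp: fun_scale_def subspace_0[OF subspace_part] subspace_add[OF subspace_part]
      subspace_scale[OF subspace_part])

lemma lin_eqI:
  assumes "lin D" "lin D'" "span S = UNIV" "\<And>x. x \<in> S \<Longrightarrow> D x = D' x"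
  shows "D = D'"
proof
  fix x
  have "subspace {x. D x = D' x}"
    unfolding subspace_def using assms by (auto simp: lin_add lin_scale lin_0)
  then have "span S \<subseteq> {x. D x = D' x}"
    by (intro span_minimal) (use assms in auto)
  then show "D x = D' x" using assms(3) by auto
qed

lemma shifts_both_eq_0:
  assumes "shifts 0 D" "shifts 1 D"
  shows "D = 0"
proof (rule lin_eqI[OF _ _ span_homogeneous])
  show "lin D" using assms by (simp add: shifts_def)
  show "lin 0" by (simp add: lin_def)
  fix x assume "x \<in> V 0 \<union> V 1"
  then obtain q where "x \<in> V q" by blast
  then have "D x \<in> V (0 + q)" "D x \<in> V (1 + q)"
    using assms by (simp_all only: shifts_def)
  then have "D x \<in> V q" "D x \<in> V (q + 1)"
    by (simp_all only: add_0_left add.commute[of 1])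
  then show "D x = 0 x" using homogeneous_both_eq_0 by simp
qed

text \<open>The Filippov identity for an even operator, where all Koszul signs are 1; restricted to
  homogeneous arguments as in the axiom.\<close>

definition even_der :: "('v \<Rightarrow> 'v) \<Rightarrow> bool" where
  "even_der D \<longleftrightarrow> (\<forall>xs. length xs = r \<longrightarrow> set xs \<subseteq> V 0 \<union> V 1 \<longrightarrow>
     D (br xs) = (\<Sum>i<r. br (xs[i := D (xs ! i)])))"

lemma br_update_add:
  "i < r \<Longrightarrow> length xs = r \<Longrightarrow> br (xs[i := x + y]) = br (xs[i := x]) + br (xs[i := y])"
  using br_add[of "take i xs" "drop (Suc i) xs"] by (simp add: upd_conv_take_nth_drop)

lemma br_update_scale:
  "i < r \<Longrightarrow> length xs = r \<Longrightarrow> br (xs[i := scale c x]) = scale c (br (xs[i := x]))"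
  using br_scale[of "take i xs" "drop (Suc i) xs"] by (simp add: upd_conv_take_nth_drop)

lemma subspace_even_der: "fun_space.subspace {D. even_der D \<and> shifts 0 D}"
proof -
  have z: "br (xs[i := 0]) = 0" if "i < r" "length xs = r" for xs i
    using br_update_scale[OF that, of 0 0] by simp
  have "fun_space.subspace {D. even_der D}"
    unfolding fun_space.subspace_def even_der_def fun_scale_def
    by (auto simp: br_update_add br_update_scale z sum.distrib scale_sum_right intro!: sum.cong)
  then show ?thesis
    using fun_space.subspace_inter[OF _ subspace_shifts, of "{D. even_der D}" 0]
    by (simp add: Int_def)
qed

lemma left_mult_shifts:
  assumes "length us = r - 1" "has_parities V us ps"
  shows "shifts (sum_list ps) (left_mult br us)"
  unfolding shifts_def
proof (intro conjI allI ballI)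
  show "lin (left_mult br us)"
    using assms by (simp add: lin_def left_mult_add left_mult_scale)
  fix q x assume "x \<in> V q"
  then have "br (us @ [x]) \<in> V (sum_list (ps @ [q]))"
    using assms arity by (intro br_graded) (auto simp: has_parities_def list_all2_appendI)
  then show "left_mult br us x \<in> V (sum_list ps + q)" by (simp add: left_mult_def)
qed

lemma left_mult_even_der:
  assumes "length us = r - 1" "has_parities V us ps" "sum_list ps = 0"
  shows "even_der (left_mult br us)"
  unfolding even_der_def
proof (intro allI impI)
  fix xs assume xs: "length xs = r" "set xs \<subseteq> V 0 \<union> V 1"
  then obtain qs where "has_parities V xs qs" using has_parities_exists by blast
  from br_filippov[OF assms(1) xs(1) assms(2) this]
  show "left_mult br us (br xs) = (\<Sum>i<r. br (xs[i := left_mult br us (xs ! i)]))"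
    by (simp add: left_mult_def assms(3) koszul_sign_def)
qed

text \<open>Only even inner derivations are needed. An element of \<open>Inder\<close> is a priori a combination of
  left multiplications by inhomogeneous vectors, so its even part has to be split off first.\<close>

lemma inder_decomposition:
  assumes "D \<in> inder_space scale r br"
  shows "\<exists>D0 D1. even_der D0 \<and> shifts 0 D0 \<and> shifts 1 D1 \<and> D = D0 + D1"
proof -
  let ?W = "{D0 + D1 | D0 D1. D0 \<in> {D. even_der D \<and> shifts 0 D} \<and> D1 \<in> {D. shifts 1 D}}"
  have W: "fun_space.subspace ?W"
    by (rule fun_space.subspace_sums[OF subspace_even_der subspace_shifts])
  have gen: "left_mult br us \<in> ?W" if "length us = r - 1" "set us \<subseteq> V 0 \<union> V 1" for us
  proof -
    obtain ps where ps: "has_parities V us ps" using has_parities_exists \<open>set us \<subseteq> _\<close> by blast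
    have z: "even_der 0 \<and> shifts 0 0" "shifts 1 0"
      using fun_space.subspace_0[OF subspace_even_der] fun_space.subspace_0[OF subspace_shifts] by auto
    consider "sum_list ps = 0" | "sum_list ps = 1" using bit_eq_0_or_1 by blast
    then show ?thesis
    proof cases
      case 1
      then have "left_mult br us = left_mult br us + 0" "even_der (left_mult br us)" "shifts 0 (left_mult br us)"
        using left_mult_even_der left_mult_shifts ps that by (auto simp del: add_0_right) fastforce
      then show ?thesis using z by blast
    next
      case 2
      then have "left_mult br us = 0 + left_mult br us" "shifts 1 (left_mult br us)"
        using left_mult_shifts[OF that(1) ps] by auto
      then show ?thesis using z by blast
    qed
  qed
  have all: "left_mult br us \<in> ?W" if "length us = r - 1" for us
  proof (rule multilinear_extension[OF _ gen span_homogeneous that])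
    fix as bs :: "'v list" assume l: "length as + length bs + 1 = r - 1"
    have a: "left_mult br (as @ (x + y) # bs) = left_mult br (as @ x # bs) + left_mult br (as @ y # bs)" for x y
      using br_add[of as "bs @ [_]"] l by (auto simp: left_mult_def fun_eq_iff)
    have s: "left_mult br (as @ scale c x # bs) = fun_scale scale c (left_mult br (as @ x # bs))" for c x
      using br_scale[of as "bs @ [_]"] l by (auto simp: left_mult_def fun_eq_iff fun_scale_def)
    have z: "left_mult br (as @ 0 # bs) = 0"
      using br_zero[of as "bs @ [_]"] l by (auto simp: left_mult_def fun_eq_iff)
    show "subspace {x. left_mult br (as @ x # bs) \<in> ?W}"
      unfolding subspace_def using W unfolding fun_space.subspace_def
      by (simp only: mem_Collect_eq a s z) blast
  qed auto
  have "inder_space scale r br \<subseteq> ?W"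
    unfolding inder_space_def by (rule fun_space.span_minimal[OF _ W]) (use all in blast)
  then show ?thesis using assms by blast
qed

lemma inder_lin:
  assumes "D \<in> inder_space scale r br"
  shows "lin D"
proof -
  obtain D0 D1 where "shifts 0 D0" "shifts 1 D1" "D = D0 + D1"
    using inder_decomposition[OF assms] by blast
  then show ?thesis
    using fun_space.subspace_add[OF subspace_lin] by (auto simp: shifts_def)
qed

text \<open>The odd summand is a difference of two even operators, hence both even and odd, hence
  0.\<close>

lemma even_inder_even_der:
  assumes "D \<in> inder_space scale r br" "shifts 0 D"
  shows "even_der D"
proof -
  obtain D0 D1 where D: "even_der D0" "shifts 0 D0" "shifts 1 D1" "D = D0 + D1"
    using inder_decomposition[OF assms(1)] by blast
  then have "D1 = D - D0" by simp
  then have "shifts 0 D1"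
    using fun_space.subspace_diff[OF subspace_shifts[of 0]] assms(2) D(2) by simp
  then have "D1 = 0" using D(3) shifts_both_eq_0 by blast
  then show ?thesis using D by simp
qed

lemma left_mult_in_inder: "length us = r - 1 \<Longrightarrow> left_mult br us \<in> inder_space scale r br"
  unfolding inder_space_def by (rule fun_space.span_base) blast

text \<open>Ideals have their element in the first slot, inner derivations in the last.
  Skew-symmetry connects the two for homogeneous vectors; multilinearity and the grading of
  \<open>I\<close> reduce to that case.\<close>

lemma ideal_of_inder_stable:
  assumes "graded_subspace scale V I" "\<And>D x. D \<in> inder_space scale r br \<Longrightarrow> x \<in> I \<Longrightarrow> D x \<in> I"
  shows "filippov_ideal scale V r br I"
  unfolding filippov_ideal_def
proof (intro conjI ballI allI impI assms(1))
  have I: "subspace I" using assms(1) by (simp add: graded_subspace_def)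
  have hom: "br (x # ys) \<in> I" if x: "x \<in> I" "x \<in> V q" and "length ys = r - 1" for x q and ys :: "'v list"
  proof (rule multilinear_extension[OF _ _ span_homogeneous \<open>length ys = r - 1\<close>])
    fix as bs :: "'v list" assume l: "length as + length bs + 1 = r - 1"
    have "length (x # as) + length bs + 1 = r" using l by simp
    from br_add[OF this] br_scale[OF this] br_zero[OF this]
    show "subspace {z. br (x # as @ z # bs) \<in> I}"
      using I by (auto simp: subspace_def)
  next
    fix zs assume zs: "length zs = r - 1" "set zs \<subseteq> V 0 \<union> V 1"
    have "br (zs @ [x]) \<in> I"
      using assms(2)[OF left_mult_in_inder[OF zs(1)] x(1)] by (simp add: left_mult_def)
    then show "br (x # zs) \<in> I"
      by (rule br_permute_in_subspace[OF I, rotated -1])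
        (use zs x arity bit_eq_0_or_1[of q] in auto)
  qed
  fix x and ys :: "'v list" assume x: "x \<in> I" and ys: "length ys = r - 1"
  then obtain a b where ab: "a \<in> I \<inter> V 0" "b \<in> I \<inter> V 1" "x = a + b"
    using assms(1) unfolding graded_subspace_def by blast
  have "br ([] @ x # ys) = br ([] @ a # ys) + br ([] @ b # ys)"
    unfolding ab(3) by (rule br_add) (use ys arity in auto)
  then show "br (x # ys) \<in> I"
    using hom[of a 0 ys] hom[of b 1 ys] ab ys by (auto intro: subspace_add[OF I])
qed

end

section \<open>Superalgebras of type A(0,n)\<close>

lemma e_unit_eq_e0: "e_unit (n + 2) (Suc k) (Suc l) = e0 n k l"
  by (rule eq_matI) (auto simp: e_unit_def)

locale A0_filippov = filippov_superalgebra scale V r br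
  for scale :: "'k::field_char_0 \<Rightarrow> 'v::ab_group_add \<Rightarrow> 'v" and V r br +
  fixes n :: nat and \<phi> :: "'k mat \<Rightarrow> 'v \<Rightarrow> 'v"
  assumes n_ge_1: "n \<ge> 1" and r_ge_3: "r \<ge> 3"
    and fin_dim: "finite_dim scale"
    and simple: "simple_filippov scale V r br"
    and iso: "lie_super_iso (A0 n) (Inder scale V r br) \<phi>"
begin

section \<open>Root vectors and Cartan elements as operators\<close>

definition E :: "nat \<Rightarrow> nat \<Rightarrow> 'v \<Rightarrow> 'v" where "E k l = \<phi> (e0 n k l)"

definition H :: "nat \<Rightarrow> 'v \<Rightarrow> 'v" where "H j = \<phi> (h0 n j)"

lemma phi_add: "A \<in> elems (A0 n) \<Longrightarrow> B \<in> elems (A0 n) \<Longrightarrow> \<phi> (A + B) = \<phi> A + \<phi> B"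
  using iso by (simp add: lie_super_iso_def)

lemma phi_smult: "A \<in> elems (A0 n) \<Longrightarrow> \<phi> (c \<cdot>\<^sub>m A) = fun_scale scale c (\<phi> A)"
  using iso by (simp add: lie_super_iso_def A0_def sl_super_def Inder_def)

lemma phi_bij: "bij_betw \<phi> (elems (A0 n)) (inder_space scale r br)"
  using iso by (simp add: lie_super_iso_def Inder_def)

lemma phi_inder: "A \<in> elems (A0 n) \<Longrightarrow> \<phi> A \<in> inder_space scale r br"
  using phi_bij by (auto simp: bij_betw_def)

lemma phi_inj: "A \<in> elems (A0 n) \<Longrightarrow> B \<in> elems (A0 n) \<Longrightarrow> \<phi> A = \<phi> B \<Longrightarrow> A = B"
  using phi_bij by (auto simp: bij_betw_def inj_on_def)

lemma phi_lin: "A \<in> elems (A0 n) \<Longrightarrow> lin (\<phi> A)"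
  by (rule inder_lin[OF phi_inder])

lemma phi_zero: "\<phi> (0\<^sub>m (n + 2) (n + 2)) = 0"
proof -
  have "0 \<cdot>\<^sub>m (0\<^sub>m (n + 2) (n + 2)) = (0\<^sub>m (n + 2) (n + 2) :: 'k mat)" by (rule eq_matI) auto
  then show ?thesis
    using phi_smult[OF elems_zero, of 0] by (simp add: fun_scale_def fun_eq_iff)
qed

lemma phi_shifts:
  assumes "A \<in> part (A0 n) p"
  shows "shifts p (\<phi> A)"
proof -
  have "\<phi> ` part (A0 n) p = part (Inder scale V r br) p"
    using iso by (simp add: lie_super_iso_def)
  then have "\<phi> A \<in> part (Inder scale V r br) p" using assms by blast
  then have "\<phi> A \<in> {f \<in> inder_space scale r br. \<forall>q. f ` V q \<subseteq> V (p + q)}"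
    unfolding Inder_def by (simp only: lie_super.simps)
  then show ?thesis
    using inder_lin unfolding shifts_def by blast
qed

text \<open>The isomorphism maps each part onto the corresponding part, so by injectivity the parity
  of an operator can be pulled back to its matrix.\<close>

lemma part_of_shifts:
  assumes "A \<in> elems (A0 n)" "shifts p (\<phi> A)"
  shows "A \<in> part (A0 n) p"
proof -
  have im: "\<phi> ` part (A0 n) p = part (Inder scale V r br) p"
    using iso by (simp add: lie_super_iso_def)
  have "\<phi> A \<in> part (Inder scale V r br) p"
    using assms phi_inder unfolding Inder_def shifts_def lie_super.simps by blast
  then obtain B where "B \<in> part (A0 n) p" "\<phi> A = \<phi> B"
    unfolding im[symmetric] by blast
  then show ?thesis using phi_inj assms(1) part_elems by metis
qed

lemma phi_bracket:
  assumes "A \<in> part (A0 n) p" "B \<in> part (A0 n) q"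
  shows "\<phi> (A * B - koszul_sign (p * q) \<cdot>\<^sub>m (B * A)) x = \<phi> A (\<phi> B x) - scale (koszul_sign (p * q)) (\<phi> B (\<phi> A x))"
proof -
  have "\<phi> (bracket (A0 n) p q A B) = bracket (Inder scale V r br) p q (\<phi> A) (\<phi> B)"
    using iso assms by (simp add: lie_super_iso_def)
  then show ?thesis
    by (simp add: A0_def sl_super_def Inder_def supercommutator_def fun_scale_def)
qed

lemma phi_sum:
  assumes "finite P" "\<And>q. q \<in> P \<Longrightarrow> B q \<in> elems (A0 n)"
  shows "mat (n + 2) (n + 2) (\<lambda>a. \<Sum>q\<in>P. c q * B q $$ a) \<in> elems (A0 n) \<and>
    \<phi> (mat (n + 2) (n + 2) (\<lambda>a. \<Sum>q\<in>P. c q * B q $$ a)) x = (\<Sum>q\<in>P. scale (c q) (\<phi> (B q) x))"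
  using assms
proof (induction P)
  case empty
  have "mat (n + 2) (n + 2) (\<lambda>_. 0) = (0\<^sub>m (n + 2) (n + 2) :: 'k mat)" by (rule eq_matI) auto
  then show ?case using elems_zero by (simp add: phi_zero del: add_2_eq_Suc add_2_eq_Suc')
next
  case (insert p P)
  let ?M = "mat (n + 2) (n + 2) (\<lambda>a. \<Sum>q\<in>P. c q * B q $$ a)"
  have M: "?M \<in> elems (A0 n)" "\<phi> ?M x = (\<Sum>q\<in>P. scale (c q) (\<phi> (B q) x))"
    using insert by auto
  have B: "B p \<in> elems (A0 n)" using insert by simp
  have "mat (n + 2) (n + 2) (\<lambda>a. \<Sum>q\<in>insert p P. c q * B q $$ a) = c p \<cdot>\<^sub>m B p + ?M"
    by (rule eq_matI) (use insert.hyps B in \<open>auto simp: sl_super_carrier_iff\<close>)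
  then show ?case
    using insert.hyps M elems_add[OF elems_smult[OF B] M(1)] phi_add[OF elems_smult[OF B] M(1)] phi_smult[OF B]
    by (simp add: fun_scale_def del: add_2_eq_Suc add_2_eq_Suc')
qed

lemma phi_decomposition:
  assumes "A \<in> elems (A0 n)"
  shows "\<phi> A x = (\<Sum>q\<in>positions n. scale (A $$ q) (\<phi> (elementary n q) x))"
proof -
  have "finite (positions n)" by (simp add: positions_def)
  from phi_sum[OF this, where B = "elementary n" and c = "($$) A" and x = x, OF elementary_elems]
  show ?thesis by (subst elementary_decomposition[OF assms]) blast
qed

lemma E_part: "k \<noteq> l \<Longrightarrow> k \<le> n + 1 \<Longrightarrow> l \<le> n + 1 \<Longrightarrow> shifts (rpar k l) (E k l)"
  unfolding E_def by (rule phi_shifts[OF e0_part])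

lemma H_part: "j \<in> {1..n + 1} \<Longrightarrow> shifts 0 (H j)"
  unfolding H_def by (rule phi_shifts[OF h0_part])

lemma E_lin: "k \<noteq> l \<Longrightarrow> k \<le> n + 1 \<Longrightarrow> l \<le> n + 1 \<Longrightarrow> lin (E k l)"
  using E_part by (simp add: shifts_def)

lemma H_lin: "j \<in> {1..n + 1} \<Longrightarrow> lin (H j)"
  using H_part by (simp add: shifts_def)

lemma E_inder: "k \<noteq> l \<Longrightarrow> k \<le> n + 1 \<Longrightarrow> l \<le> n + 1 \<Longrightarrow> E k l \<in> inder_space scale r br"
  unfolding E_def by (rule phi_inder[OF part_elems[OF e0_part]])

lemma H_inder: "j \<in> {1..n + 1} \<Longrightarrow> H j \<in> inder_space scale r br"
  unfolding H_def by (rule phi_inder[OF part_elems[OF h0_part]])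

lemma E_ne_0:
  assumes "k \<noteq> l" "k \<le> n + 1" "l \<le> n + 1"
  shows "E k l \<noteq> 0"
proof
  assume "E k l = 0"
  then have "e0 n k l = (0\<^sub>m (n + 2) (n + 2) :: 'k mat)"
    using assms by (intro phi_inj part_elems[OF e0_part] elems_zero) (auto simp: E_def phi_zero simp del: add_2_eq_Suc')
  then have "e0 n k l $$ (k, l) = (0::'k)" using assms by simp
  then show False using assms by simp
qed

text \<open>The supercommutator relation, written as a rule for moving one root vector past another.
  For opposite roots the bracket lies in the Cartan subalgebra; that case is excluded here and
  treated separately.\<close>

lemma EE_bracket:
  assumes "k \<noteq> l" "k' \<noteq> l'" "k \<le> n + 1" "l \<le> n + 1" "k' \<le> n + 1" "l' \<le> n + 1" "\<not> (l = k' \<and> l' = k)"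
  shows "E k l (E k' l' x) = (if l = k' then E k l' x else 0) +
    scale (koszul_sign (rpar k l * rpar k' l')) (E k' l' (E k l x) - (if l' = k then E k' l x else 0))"
proof -
  let ?s = "koszul_sign (rpar k l * rpar k' l') :: 'k"
  have m: "e0 n k l * e0 n k' l' - ?s \<cdot>\<^sub>m (e0 n k' l' * e0 n k l) =
    (if l = k' then e0 n k l' else if l' = k then - ?s \<cdot>\<^sub>m e0 n k' l else 0\<^sub>m (n + 2) (n + 2))"
    using assms by (auto simp: e0_mult intro!: eq_matI simp del: add_2_eq_Suc')
  have "\<phi> (e0 n k l * e0 n k' l' - ?s \<cdot>\<^sub>m (e0 n k' l' * e0 n k l)) x
      = (if l = k' then E k l' x else if l' = k then scale (- ?s) (E k' l x) else 0)"
    unfolding m using phi_smult[OF part_elems[OF e0_part], of k' l] assms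
    by (simp add: E_def phi_zero fun_scale_def del: add_2_eq_Suc')
  moreover have "\<phi> (e0 n k l * e0 n k' l' - ?s \<cdot>\<^sub>m (e0 n k' l' * e0 n k l)) x
      = E k l (E k' l' x) - scale ?s (E k' l' (E k l x))"
    unfolding E_def by (rule phi_bracket[OF e0_part e0_part]) (use assms in auto)
  ultimately show ?thesis
    using assms by (auto simp: algebra_simps split: if_splits)
qed

lemma HE_bracket:
  assumes "k \<noteq> l" "k \<le> n + 1" "l \<le> n + 1" "j \<in> {1..n + 1}"
  shows "H j (E k l x) = E k l (H j x) + scale (dchar j k - dchar j l) (E k l x)"
proof -
  have "h0 n j * e0 n k l - koszul_sign (0 * rpar k l) \<cdot>\<^sub>m (e0 n k l * h0 n j) = (dchar j k - dchar j l :: 'k) \<cdot>\<^sub>m e0 n k l"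
    using assms by (auto simp: h0_mult koszul_sign_def intro!: eq_matI simp del: add_2_eq_Suc')
  then have "scale (dchar j k - dchar j l) (E k l x) = H j (E k l x) - E k l (H j x)"
    using phi_bracket[OF h0_part[OF assms(4)] e0_part[OF assms(1-3)], of x]
      phi_smult[OF part_elems[OF e0_part[OF assms(1-3)]]]
    by (simp add: E_def H_def fun_scale_def koszul_sign_def)
  then show ?thesis by (simp add: algebra_simps)
qed

lemma EE_odd_opposite:
  assumes "j \<in> {1..n + 1}"
  shows "E 0 j (E j 0 x) = H j x - E j 0 (E 0 j x)"
proof -
  have "e0 n 0 j * e0 n j 0 - koszul_sign (rpar 0 j * rpar j 0) \<cdot>\<^sub>m (e0 n j 0 * e0 n 0 j) = (h0 n j :: 'k mat)"
    using assms by (auto simp: e0_mult koszul_sign_def rpar_def dchar_def intro!: eq_matI simp del: add_2_eq_Suc')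
  then show ?thesis
    using phi_bracket[OF e0_part[of 0 j] e0_part[of j 0], of x] assms
    by (auto simp: E_def H_def koszul_sign_def rpar_def)
qed

lemma EE_even_opposite:
  assumes "j \<in> {1..n + 1}" "k \<in> {1..n + 1}" "j \<noteq> k"
  shows "E j k (E k j x) = E k j (E j k x) + H j x - H k x"
proof -
  have "e0 n j k * e0 n k j - koszul_sign (rpar j k * rpar k j) \<cdot>\<^sub>m (e0 n k j * e0 n j k) = (h0 n j + (- 1) \<cdot>\<^sub>m h0 n k :: 'k mat)"
    using assms by (auto simp: e0_mult koszul_sign_def rpar_def dchar_def intro!: eq_matI simp del: add_2_eq_Suc')
  then have "H j x + scale (- 1) (H k x) = E j k (E k j x) - E k j (E j k x)"
    using phi_bracket[OF e0_part[of j k] e0_part[of k j], of x] assms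
      phi_add[OF part_elems[OF h0_part[OF assms(1)]] elems_smult[OF part_elems[OF h0_part[OF assms(2)]]], of "- 1"]
      phi_smult[OF part_elems[OF h0_part[OF assms(2)]], of "- 1"]
    by (auto simp: E_def H_def koszul_sign_def rpar_def fun_scale_def)
  then show ?thesis by (simp add: algebra_simps)
qed

text \<open>This is where simplicity enters: a span of homogeneous vectors that is stable under a
  basis of \<open>A0 n\<close> is stable under all inner derivations, hence an ideal.\<close>

lemma stable_subspace_trivial:
  assumes "\<And>x. x \<in> S \<Longrightarrow> \<exists>q. x \<in> V q" "x \<in> S" "x \<noteq> 0"
    and H: "\<And>j x. j \<in> {1..n + 1} \<Longrightarrow> x \<in> S \<Longrightarrow> H j x \<in> span S"
    and E: "\<And>k l x. k \<noteq> l \<Longrightarrow> k \<le> n + 1 \<Longrightarrow> l \<le> n + 1 \<Longrightarrow> x \<in> S \<Longrightarrow> E k l x \<in> span S"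
  shows "span S = UNIV"
proof -
  have el: "\<phi> (elementary n q) y \<in> span S" if "q \<in> positions n" "y \<in> S" for q y
    using H[of "fst q" y] E[of "fst q" "snd q" y] that
    by (cases q) (auto simp: elementary_def E_def H_def positions_def)
  have "\<phi> A y \<in> span S" if "A \<in> elems (A0 n)" "y \<in> span S" for A y
  proof -
    note lin = phi_lin[OF that(1)]
    have "subspace {y. \<phi> A y \<in> span S}"
      unfolding subspace_def
      by (auto simp: lin_add[OF lin] lin_scale[OF lin] lin_0[OF lin] span_zero span_add span_scale)
    moreover have "\<phi> A y \<in> span S" if "y \<in> S" for y
      unfolding phi_decomposition[OF \<open>A \<in> elems (A0 n)\<close>] using el that
      by (intro span_sum span_scale) auto
    ultimately have "span S \<subseteq> {y. \<phi> A y \<in> span S}"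
      by (intro span_minimal) auto
    then show ?thesis using that by blast
  qed
  then have "D y \<in> span S" if "D \<in> inder_space scale r br" "y \<in> span S" for D y
    using that phi_bij by (metis bij_betw_imp_surj_on imageE)
  then have "filippov_ideal scale V r br (span S)"
    using assms(1) bit_eq_0_or_1 by (intro ideal_of_inder_stable graded_subspace_span) metis+
  then have "span S = {0} \<or> span S = UNIV"
    using simple by (simp add: simple_filippov_def)
  then show ?thesis using assms(2,3) span_base by blast
qed

lemma E_even_der:
  "k \<in> {1..n + 1} \<Longrightarrow> l \<in> {1..n + 1} \<Longrightarrow> k \<noteq> l \<Longrightarrow> even_der (E k l)"
  using E_part[of k l] by (intro even_inder_even_der E_inder) (auto simp: rpar_def)

lemma H_even_der: "j \<in> {1..n + 1} \<Longrightarrow> even_der (H j)"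
  by (intro even_inder_even_der H_inder H_part)

end

section \<open>Weight vectors\<close>

declare sum.cl_ivl_Suc [simp del]

text \<open>A weight is recorded relative to a reference weight by an integral offset, in the coordinates
  of diagonal matrices. As a functional on the Cartan subalgebra the offset matters only up to
  multiples of the supertrace \<open>(1, -1, \<dots>, -1)\<close>, whose coordinate sum \<open>-n\<close> is not 0; normalising
  the coordinate sum to 0 therefore makes the offset unique.\<close>

definition is_offset :: "nat \<Rightarrow> (nat \<Rightarrow> int) \<Rightarrow> bool" where
  "is_offset n w \<longleftrightarrow> (\<forall>k>n + 1. w k = 0) \<and> (\<Sum>k\<le>n + 1. w k) = 0"

definition rt :: "nat \<Rightarrow> nat \<Rightarrow> nat \<Rightarrow> int" where
  "rt k l = (\<lambda>i. of_bool (i = k) - of_bool (i = l))"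

lemma rt_same [simp]: "rt k k = 0"
  by (simp add: rt_def fun_eq_iff)

lemma rt_inject:
  assumes "rt k l = rt k' l'" "k \<noteq> l"
  shows "k = k' \<and> l = l'"
proof -
  have "rt k l k = rt k' l' k" "rt k l l = rt k' l' l" using assms(1) by auto
  then show ?thesis using assms(2) by (auto simp: rt_def of_bool_def split: if_splits)
qed

lemma is_offset_rt: "k \<le> n + 1 \<Longrightarrow> l \<le> n + 1 \<Longrightarrow> is_offset n (rt k l)"
  by (auto simp: is_offset_def rt_def sum_subtractf of_bool_def sum.delta)

lemma is_offset_0: "is_offset n 0"
  by (simp add: is_offset_def)

lemma is_offset_add: "is_offset n w \<Longrightarrow> is_offset n w' \<Longrightarrow> is_offset n (w + w')"
  by (simp add: is_offset_def sum.distrib)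

lemma is_offset_diff: "is_offset n w \<Longrightarrow> is_offset n w' \<Longrightarrow> is_offset n (w - w')"
  by (simp add: is_offset_def sum_subtractf)

lemma is_offset_sum_list: "(\<And>w. w \<in> set ws \<Longrightarrow> is_offset n w) \<Longrightarrow> is_offset n (sum_list ws)"
  by (induction ws) (auto simp: is_offset_0 is_offset_add)

text \<open>The coordinates from 1 on sum to \<open>- w 0\<close>. Consequently the sum of all
  \<open>H j\<close> detects the degree \<open>w 0\<close>.\<close>

lemma is_offset_sum:
  assumes "is_offset n w"
  shows "(\<Sum>j\<in>{1..n + 1}. w 0 + w j) = int n * w 0"
proof -
  have "{..n + 1} = insert 0 {1..n + 1}" by auto
  then have "w 0 + (\<Sum>j\<in>{1..n + 1}. w j) = 0"
    using assms unfolding is_offset_def by simp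
  then show ?thesis by (simp add: sum.distrib algebra_simps)
qed

text \<open>Summing the hypotheses gives n times coordinate 0, and with it every other
  coordinate.\<close>

lemma offset_eqI:
  assumes "n \<ge> 1" "is_offset n w" "is_offset n w'" "\<And>j. j \<in> {1..n + 1} \<Longrightarrow> w 0 + w j = w' 0 + w' j"
  shows "w = w'"
proof
  fix k
  have "int n * w 0 = int n * w' 0"
    unfolding is_offset_sum[OF assms(2), symmetric] is_offset_sum[OF assms(3), symmetric]
    using assms(4) by (intro sum.cong) auto
  then have 0: "w 0 = w' 0" using assms(1) by simp
  consider "k = 0" | "k \<in> {1..n + 1}" | "k > n + 1" by force
  then show "w k = w' k"
    using 0 assms by cases (auto simp: is_offset_def)
qed

lemma sum_list_fun_apply: "(sum_list ws) i = (\<Sum>w\<leftarrow>ws. w i)" for ws :: "('a \<Rightarrow> int) list"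
  by (induction ws) auto

context A0_filippov begin

definition good :: "bit \<Rightarrow> (nat \<Rightarrow> 'k) \<Rightarrow> (nat \<Rightarrow> int) \<Rightarrow> 'v \<Rightarrow> bool" where
  "good p b w x \<longleftrightarrow> is_offset n w \<and> x \<in> V (p + of_int (w 0)) \<and>
     (\<forall>j\<in>{1..n + 1}. H j x = scale (b j + of_int (w 0 + w j)) x)"

lemma good_H: "good p b w x \<Longrightarrow> j \<in> {1..n + 1} \<Longrightarrow> H j x = scale (b j + of_int (w 0 + w j)) x"
  by (simp add: good_def)

lemma good_offset: "good p b w x \<Longrightarrow> is_offset n w"
  by (simp add: good_def)

lemma good_parity: "good p b w x \<Longrightarrow> x \<in> V (p + of_int (w 0))"
  by (simp add: good_def)

lemma good_homogeneous: "good p b w x \<Longrightarrow> x \<in> V 0 \<union> V 1"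
  using good_parity bit_eq_0_or_1[of "p + of_int (w 0)"] by (metis UnI1 UnI2)

lemma good_E:
  assumes "good p b w x" "k \<noteq> l" "k \<le> n + 1" "l \<le> n + 1"
  shows "good p b (w + rt k l) (E k l x)"
  unfolding good_def
proof (intro conjI ballI)
  show "is_offset n (w + rt k l)"
    using assms good_offset is_offset_rt is_offset_add by blast
  have "(of_int (rt k l 0) :: bit) = rpar k l"
    using assms by (auto simp: rt_def rpar_def)
  then have e: "p + of_int ((w + rt k l) 0) = rpar k l + (p + of_int (w 0))"
    by (simp only: plus_fun_apply of_int_add ac_simps)
  show "E k l x \<in> V (p + of_int ((w + rt k l) 0))"
    unfolding e using E_part[OF assms(2-4)] good_parity[OF assms(1)] by (simp only: shifts_def)
  fix j assume j: "j \<in> {1..n + 1}"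
  have "dchar j k - dchar j l = (of_int (rt k l 0 + rt k l j) :: 'k)"
    using j assms by (auto simp: dchar_def rt_def)
  then have "H j (E k l x) = scale (b j + of_int (w 0 + w j)) (E k l x) + scale (of_int (rt k l 0 + rt k l j)) (E k l x)"
    unfolding HE_bracket[OF assms(2-4) j] good_H[OF assms(1) j] lin_scale[OF E_lin[OF assms(2-4)]] by simp
  then show "H j (E k l x) = scale (b j + of_int ((w + rt k l) 0 + (w + rt k l) j)) (E k l x)"
    by (simp add: scale_left_distrib algebra_simps)
qed

lemma good_subset_span_UNIV:
  assumes "good p b w v" "v \<noteq> 0" "v \<in> S" "\<And>x. x \<in> S \<Longrightarrow> \<exists>w. good p b w x"
    and "\<And>k l x. k \<noteq> l \<Longrightarrow> k \<le> n + 1 \<Longrightarrow> l \<le> n + 1 \<Longrightarrow> x \<in> S \<Longrightarrow> E k l x \<in> span S"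
  shows "span S = UNIV"
proof (rule stable_subspace_trivial[OF _ assms(3,2) _ assms(5)])
  show "\<exists>q. x \<in> V q" if "x \<in> S" for x
    using assms(4)[OF that] good_parity by blast
  fix j x assume "j \<in> {1..n + 1}" "x \<in> S"
  then obtain w where "H j x = scale (b j + of_int (w 0 + w j)) x"
    using assms(4) good_H by blast
  then show "H j x \<in> span S" using \<open>x \<in> S\<close> by (simp add: span_scale span_base)
qed auto

text \<open>Integral combinations turn offsets into eigenvalues of a single operator: constant
  coefficients give the degree, other choices order the weights within a degree or along a
  string.\<close>

definition cartan_comb :: "(nat \<Rightarrow> int) \<Rightarrow> 'v \<Rightarrow> 'v" where
  "cartan_comb c x = (\<Sum>j\<in>{1..n + 1}. scale (of_int (c j)) (H j x))"

lemma cartan_comb_add: "cartan_comb c (x + y) = cartan_comb c x + cartan_comb c y"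
  unfolding cartan_comb_def by (simp add: lin_add[OF H_lin] scale_right_distrib sum.distrib)

lemma cartan_comb_scale: "cartan_comb c (scale a x) = scale a (cartan_comb c x)"
  unfolding cartan_comb_def scale_sum_right
  by (intro sum.cong refl) (simp add: lin_scale[OF H_lin] mult.commute)

lemma cartan_comb_good:
  assumes "good p b w x"
  shows "cartan_comb c x = scale ((\<Sum>j\<in>{1..n + 1}. of_int (c j) * b j) + of_int (\<Sum>j\<in>{1..n + 1}. c j * (w 0 + w j))) x"
proof -
  have "cartan_comb c x = (\<Sum>j\<in>{1..n + 1}. scale (of_int (c j) * (b j + of_int (w 0 + w j))) x)"
    unfolding cartan_comb_def by (intro sum.cong refl) (simp add: good_H[OF assms])
  also have "\<dots> = scale (\<Sum>j\<in>{1..n + 1}. of_int (c j) * (b j + of_int (w 0 + w j))) x"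
    by (simp only: scale_sum_left)
  finally show ?thesis
    by (simp add: sum.distrib distrib_left)
qed

text \<open>Distinct integers give distinct eigenvalues of \<open>cartan_comb c\<close> in
  characteristic 0, and these are finite in number.\<close>

lemma finite_weights:
  "finite {\<Sum>j\<in>{1..n + 1}. c j * (w 0 + w j) | w. \<exists>x. good p b w x \<and> x \<noteq> 0}" (is "finite ?A")
proof -
  obtain B where B: "finite B" "span B = UNIV" using fin_dim by (auto simp: finite_dim_def)
  have fin: "finite {a. \<exists>x. x \<noteq> 0 \<and> cartan_comb c x = scale a x}"
    by (rule finite_eigenvalues[OF B cartan_comb_add cartan_comb_scale])
  let ?f = "\<lambda>a::int. (\<Sum>j\<in>{1..n + 1}. of_int (c j) * b j) + (of_int a :: 'k)"
  have "?f ` ?A \<subseteq> {a. \<exists>x. x \<noteq> 0 \<and> cartan_comb c x = scale a x}"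
    using cartan_comb_good by blast
  then have "finite (?f ` ?A)" using fin finite_subset by blast
  then show ?thesis by (rule finite_imageD) (auto simp: inj_on_def)
qed

text \<open>The sum of all \<open>H j\<close> has eigenvalue constant plus n times the degree, so
  vectors of different degrees are eigenvectors for different eigenvalues.\<close>

lemma degree_separation:
  assumes "good p b w x" "x \<noteq> 0" "x \<in> span {y. \<exists>w. good p b w y \<and> w 0 \<in> J}"
  shows "w 0 \<in> J"
proof (rule ccontr)
  let ?C = "\<Sum>j\<in>{1..n + 1}. b j"
  have T: "cartan_comb (\<lambda>_. 1) y = scale (?C + of_int (int n * w 0)) y" if "good p b w y" for w y
    using cartan_comb_good[OF that, of "\<lambda>_. 1"] by (simp only: mult_1_left of_int_1 is_offset_sum[OF good_offset[OF that]])
  assume J: "w 0 \<notin> J"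
  have "{y. \<exists>w. good p b w y \<and> w 0 \<in> J} \<subseteq> {y. \<exists>a\<in>(\<lambda>i. ?C + of_int (int n * i)) ` J. cartan_comb (\<lambda>_. 1) y = scale a y}"
    using T by blast
  then have "x \<in> span {y. \<exists>a\<in>(\<lambda>i. ?C + of_int (int n * i)) ` J. cartan_comb (\<lambda>_. 1) y = scale a y}"
    using assms(3) span_mono by blast
  moreover have "?C + of_int (int n * w 0) \<notin> (\<lambda>i. ?C + of_int (int n * i)) ` J"
    using J n_ge_1 by auto
  ultimately have "x = 0"
    using eigenvector_span_eq_0[OF _ T[OF assms(1)] _ cartan_comb_add cartan_comb_scale] by blast
  then show False using assms(2) by simp
qed

text \<open>Irreducibility in terms of degrees: if no root vector leaves the set \<open>J\<close>
  and some nonzero vector has its degree in \<open>J\<close>, then every degree that occurs lies in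
  \<open>J\<close>.\<close>

lemma degrees_reach:
  assumes "good p b w x" "x \<noteq> 0" "w 0 \<in> J"
    and step: "\<And>k l w x. k \<noteq> l \<Longrightarrow> k \<le> n + 1 \<Longrightarrow> l \<le> n + 1 \<Longrightarrow> good p b w x \<Longrightarrow> w 0 \<in> J \<Longrightarrow>
      E k l x = 0 \<or> w 0 + rt k l 0 \<in> J"
    and "good p b w' y" "y \<noteq> 0"
  shows "w' 0 \<in> J"
proof -
  let ?S = "{y. \<exists>w. good p b w y \<and> w 0 \<in> J}"
  have "span ?S = UNIV"
  proof (rule good_subset_span_UNIV[OF assms(1,2)])
    fix k l x assume kl: "k \<noteq> l" "k \<le> n + 1" "l \<le> n + 1" and "x \<in> ?S"
    then obtain w where w: "good p b w x" "w 0 \<in> J" by blast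
    from step[OF kl w] show "E k l x \<in> span ?S"
    proof
      assume "w 0 + rt k l 0 \<in> J"
      then have "E k l x \<in> ?S" using good_E[OF w(1) kl] by force
      then show ?thesis by (rule span_base)
    qed (simp add: span_zero)
  qed (use assms in auto)
  then show ?thesis using degree_separation[OF assms(5,6)] by auto
qed

lemma good_rebase:
  assumes "good p b w v"
  shows "good (p + of_int (w 0)) (\<lambda>j. b j + of_int (w 0 + w j)) w' x \<longleftrightarrow> is_offset n w' \<and> good p b (w + w') x"
proof -
  have "p + of_int (w 0) + of_int (w' 0) = p + of_int ((w + w') 0)"
    by (simp only: plus_fun_apply of_int_add ac_simps)
  moreover have "b j + of_int (w 0 + w j) + of_int (w' 0 + w' j) = b j + of_int ((w + w') 0 + (w + w') j)" for j
    by (simp add: ac_simps)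
  moreover have "is_offset n (w + w')" if "is_offset n w'"
    using that good_offset[OF assms] by (rule is_offset_add[rotated])
  ultimately show ?thesis unfolding good_def by auto
qed

text \<open>The new reference vector lies in the maximal degree, so that the raising operators
  \<open>E 0 l\<close> kill it, and is extremal there for the even root vectors. All degrees then
  run from 0 down to \<open>- d\<close>.\<close>

lemma exists_highest:
  assumes "good p b w0 v0" "v0 \<noteq> 0"
  shows "\<exists>p b v d. good p b 0 v \<and> v \<noteq> 0 \<and> (\<forall>k l. k < l \<longrightarrow> l \<le> n + 1 \<longrightarrow> E k l v = 0) \<and>
    (\<forall>w x. good p b w x \<longrightarrow> x \<noteq> 0 \<longrightarrow> - int d \<le> w 0 \<and> w 0 \<le> 0) \<and>
    (\<exists>w x. good p b w x \<and> x \<noteq> 0 \<and> w 0 = - int d)"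
proof -
  define D where "D = {w 0 | w. \<exists>x. good p b w x \<and> x \<noteq> 0}"
  have "{\<Sum>j\<in>{1..n + 1}. 1 * (w 0 + w j) | w. \<exists>x. good p b w x \<and> x \<noteq> 0} = (\<lambda>i. int n * i) ` D"
    unfolding D_def image_def using is_offset_sum[OF good_offset] by (force simp del: One_nat_def)
  then have "finite ((\<lambda>i. int n * i) ` D)"
    using finite_weights[of "\<lambda>_. 1" p b] by simp
  then have D: "finite D" "D \<noteq> {}"
    using n_ge_1 assms by (auto dest!: finite_imageD simp: inj_on_def D_def)
  \<comment> \<open>For 1 \<le> k < l the operator \<open>E k l\<close> changes \<open>f\<close> by
    k - l < 0, so a vector with minimal \<open>f\<close> in the top degree is killed by it.\<close>
  define f where "f = (\<lambda>w::nat \<Rightarrow> int. \<Sum>j\<in>{1..n + 1}. int j * (w 0 + w j))"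
  define F where "F = {f w | w. w 0 = Max D \<and> (\<exists>x. good p b w x \<and> x \<noteq> 0)}"
  have "F \<subseteq> {\<Sum>j\<in>{1..n + 1}. int j * (w 0 + w j) | w. \<exists>x. good p b w x \<and> x \<noteq> 0}"
    unfolding F_def f_def by blast
  then have "finite F" using finite_weights[of int p b] finite_subset by blast
  moreover have "F \<noteq> {}"
  proof -
    have "Max D \<in> {w 0 | w. \<exists>x. good p b w x \<and> x \<noteq> 0}"
      using Max_in[OF D] by (simp only: D_def)
    then obtain w where "w 0 = Max D" "\<exists>x. good p b w x \<and> x \<noteq> 0"
      unfolding mem_Collect_eq by metis
    then show ?thesis unfolding F_def by blast
  qed
  ultimately have "Min F \<in> F" by (rule Min_in)
  then obtain w v where wv: "f w = Min F" "w 0 = Max D" "good p b w v" "v \<noteq> 0"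
    unfolding F_def mem_Collect_eq by metis
  have top: "E k l v = 0" if kl: "k < l" "l \<le> n + 1" for k l
  proof (rule ccontr)
    assume nz: "E k l v \<noteq> 0"
    have g: "good p b (w + rt k l) (E k l v)" using good_E[OF wv(3)] kl by simp
    then have "(w + rt k l) 0 \<in> D" using nz unfolding D_def by blast
    then have "w 0 + rt k l 0 \<le> w 0" using Max_ge[OF D(1), of "(w + rt k l) 0"] wv(2) by simp
    then have k: "k \<noteq> 0" using kl by (intro notI) (simp add: rt_def)
    then have "(w + rt k l) 0 = Max D" using wv(2) kl by (simp add: rt_def)
    then have "f (w + rt k l) \<in> F" using g nz unfolding F_def by blast
    then have "f w \<le> f (w + rt k l)" using Min_le[OF \<open>finite F\<close>] wv(1) by simp
    moreover have "f (w + rt k l) = f w + (\<Sum>j\<in>{1..n + 1}. int j * rt k l j)"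
      using k kl by (simp add: f_def sum.distrib[symmetric] algebra_simps rt_def)
    moreover have "(\<Sum>j\<in>{1..n + 1}. int j * rt k l j) = int k - int l"
    proof -
      have "(\<Sum>j\<in>{1..n + 1}. int j * rt k l j) = (\<Sum>j\<in>{1..n + 1}. if j = k then int k else 0)
          - (\<Sum>j\<in>{1..n + 1}. if j = l then int l else 0)"
        unfolding sum_subtractf[symmetric] by (intro sum.cong) (auto simp: rt_def)
      then show ?thesis using k kl by simp
    qed
    ultimately show False using kl by simp
  qed
  let ?p = "p + of_int (w 0)" and ?b = "\<lambda>j. b j + of_int (w 0 + w j)"
  note re = good_rebase[OF wv(3)]
  obtain w1 x1 where w1: "w1 0 = Min D" "good p b w1 x1" "x1 \<noteq> 0"
  proof -
    have "Min D \<in> {w 0 | w. \<exists>x. good p b w x \<and> x \<noteq> 0}"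
      using Min_in[OF D] by (simp only: D_def)
    then show ?thesis using that unfolding mem_Collect_eq by metis
  qed
  define d where "d = nat (Max D - Min D)"
  have d: "int d = Max D - Min D" using Max_ge[OF D(1) Min_in[OF D]] by (simp add: d_def)
  have "good ?p ?b 0 v" unfolding re using wv(3) by (simp add: is_offset_0)
  moreover have "- int d \<le> w' 0 \<and> w' 0 \<le> 0" if "good ?p ?b w' x" "x \<noteq> 0" for w' x
  proof -
    have "(w + w') 0 \<in> D" using that unfolding re D_def by blast
    then have "Min D \<le> w 0 + w' 0" "w 0 + w' 0 \<le> Max D"
      using Min_le[OF D(1)] Max_ge[OF D(1)] by auto
    then show ?thesis using d wv(2) by linarith
  qed
  moreover have "good ?p ?b (w1 - w) x1 \<and> x1 \<noteq> 0 \<and> (w1 - w) 0 = - int d"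
    unfolding re using w1 wv(2) d is_offset_diff[OF good_offset[OF w1(2)] good_offset[OF wv(3)]]
    by simp
  ultimately show ?thesis using top wv(4) by blast
qed

section \<open>Weights of left multiplications\<close>

text \<open>\<open>H j\<close> is an even derivation, so its commutator with a left multiplication
  adds up the eigenvalues of the r-1 entries; the reference value \<open>b j\<close> occurs once for
  each.\<close>

lemma left_mult_weight:
  assumes "length us = r - 1" "list_all2 (good p b) ws us" "j \<in> {1..n + 1}"
  shows "H j (left_mult br us x) = left_mult br us (H j x)
    + scale (of_nat (r - 1) * b j + of_int (sum_list ws 0 + sum_list ws j)) (left_mult br us x)"
proof -
  let ?c = "of_nat (r - 1) * b j + of_int (sum_list ws 0 + sum_list ws j)"
  note add = left_mult_add[OF assms(1)] and sc = left_mult_scale[OF assms(1)]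
  have "(\<lambda>x. H j (left_mult br us x)) = (\<lambda>x. left_mult br us (H j x) + scale ?c (left_mult br us x))"
  proof (rule lin_eqI[OF _ _ span_homogeneous])
    show "lin (\<lambda>x. H j (left_mult br us x))"
      by (simp add: lin_def add sc lin_add[OF H_lin[OF assms(3)]] lin_scale[OF H_lin[OF assms(3)]])
    show "lin (\<lambda>x. left_mult br us (H j x) + scale ?c (left_mult br us x))"
      by (simp add: lin_def add sc lin_add[OF H_lin[OF assms(3)]] lin_scale[OF H_lin[OF assms(3)]]
          scale_right_distrib ac_simps)
    fix x assume x: "x \<in> V 0 \<union> V 1"
    define xs where "xs = us @ [x]"
    have len: "length xs = r" using assms(1) arity by (simp add: xs_def)
    have lw: "length ws = r - 1" using assms by (simp add: list_all2_lengthD)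
    have g: "good p b (ws ! i) (us ! i)" if "i < r - 1" for i
      using assms(1,2) that by (simp add: list_all2_conv_all_nth)
    have "set us \<subseteq> V 0 \<union> V 1"
      using g assms(1) good_homogeneous by (metis in_set_conv_nth subsetI)
    then have "set xs \<subseteq> V 0 \<union> V 1" using x by (simp add: xs_def)
    then have "H j (br xs) = (\<Sum>i<r. br (xs[i := H j (xs ! i)]))"
      using H_even_der[OF assms(3)] len by (simp add: even_der_def)
    also have "\<dots> = (\<Sum>i<r - 1. br (xs[i := H j (xs ! i)])) + br (xs[r - 1 := H j (xs ! (r - 1))])"
      using arity by (cases r) auto
    also have "br (xs[r - 1 := H j (xs ! (r - 1))]) = left_mult br us (H j x)"
      using assms(1) by (simp add: xs_def left_mult_def nth_append list_update_append)
    also have "(\<Sum>i<r - 1. br (xs[i := H j (xs ! i)])) = (\<Sum>i<r - 1. scale (b j + of_int ((ws ! i) 0 + (ws ! i) j)) (br xs))"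
    proof (intro sum.cong refl)
      fix i assume i: "i \<in> {..<r - 1}"
      then have "xs ! i = us ! i" using assms(1) by (simp add: xs_def nth_append)
      then have "H j (xs ! i) = scale (b j + of_int ((ws ! i) 0 + (ws ! i) j)) (xs ! i)"
        using good_H[OF g assms(3)] i by simp
      then show "br (xs[i := H j (xs ! i)]) = scale (b j + of_int ((ws ! i) 0 + (ws ! i) j)) (br xs)"
        using br_update_scale[of i xs] len i by simp
    qed
    also have "\<dots> = scale (\<Sum>i<r - 1. b j + of_int ((ws ! i) 0 + (ws ! i) j)) (br xs)"
      by (simp add: scale_sum_left)
    also have "(\<Sum>i<r - 1. b j + of_int ((ws ! i) 0 + (ws ! i) j)) = ?c"
    proof -
      have "sum_list ws i = (\<Sum>m<r - 1. (ws ! m) i)" for i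
        unfolding sum_list_fun_apply using lw by (simp add: sum_list_sum_nth atLeast0LessThan)
      then show ?thesis by (simp add: sum.distrib)
    qed
    finally show "H j (left_mult br us x) = left_mult br us (H j x) + scale ?c (left_mult br us x)"
      by (simp add: xs_def left_mult_def add.commute)
  qed
  then show ?thesis by (rule fun_cong)
qed

text \<open>Bracketing with \<open>h0 n j\<close> multiplies the entry (k, l) by the value of its
  root, while by \<open>left_mult_weight\<close> it multiplies the whole matrix by one scalar.
  Injectivity of \<open>\<phi>\<close> allows the entries to be compared.\<close>

lemma left_mult_matrix:
  assumes "length us = r - 1" "list_all2 (good p b) ws us"
  shows "\<exists>A\<in>elems (A0 n). \<phi> A = left_mult br us \<and>
    (\<forall>k\<le>n + 1. \<forall>l\<le>n + 1. A $$ (k, l) \<noteq> 0 \<longrightarrow> (\<forall>j\<in>{1..n + 1}.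
      of_nat (r - 1) * b j + of_int (sum_list ws 0 + sum_list ws j) = of_int (rt k l 0 + rt k l j)))"
proof -
  obtain A where A: "A \<in> elems (A0 n)" "\<phi> A = left_mult br us"
    using left_mult_in_inder[OF assms(1)] phi_bij by (metis bij_betw_imp_surj_on imageE)
  have "has_parities V us (map (\<lambda>w. p + of_int (w 0)) ws)"
    using assms(2) unfolding has_parities_def
    by (auto simp: list_all2_conv_all_nth good_def)
  from left_mult_shifts[OF assms(1) this] obtain s where s: "A \<in> part (A0 n) s"
    using part_of_shifts[OF A(1)] A(2) by metis
  have "of_nat (r - 1) * b j + of_int (sum_list ws 0 + sum_list ws j) = of_int (rt k l 0 + rt k l j)"
    if kl: "k \<le> n + 1" "l \<le> n + 1" "A $$ (k, l) \<noteq> 0" and j: "j \<in> {1..n + 1}" for k l j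
  proof -
    let ?c = "of_nat (r - 1) * b j + of_int (sum_list ws 0 + sum_list ws j)"
    let ?B = "h0 n j * A - koszul_sign (0 * s) \<cdot>\<^sub>m (A * h0 n j)"
    have Ac: "A \<in> carrier_mat (n + 2) (n + 2)" using A(1) by (simp add: sl_super_carrier_iff)
    have B: "?B $$ (i, m) = (dchar j i - dchar j m) * A $$ (i, m)" if "i < n + 2" "m < n + 2" for i m
      using that j by (auto simp: h0_mult[OF Ac] koszul_sign_def algebra_simps simp del: add_2_eq_Suc')
    have "?B \<in> elems (A0 n)"
      unfolding sl_super_carrier_iff using Ac B by (auto simp del: add_2_eq_Suc' intro!: sum.neutral[symmetric])
    moreover have "\<phi> ?B = \<phi> (?c \<cdot>\<^sub>m A)"
    proof
      fix x
      have "\<phi> ?B x = H j (\<phi> A x) - \<phi> A (H j x)"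
        using phi_bracket[OF h0_part[OF j] s] by (simp add: H_def koszul_sign_def)
      also have "\<dots> = scale ?c (\<phi> A x)"
        unfolding A(2) left_mult_weight[OF assms j] by simp
      finally show "\<phi> ?B x = \<phi> (?c \<cdot>\<^sub>m A) x"
        by (simp only: phi_smult[OF A(1)] fun_scale_def)
    qed
    ultimately have "?B = ?c \<cdot>\<^sub>m A" using phi_inj elems_smult[OF A(1)] by blast
    then have "?B $$ (k, l) = (?c \<cdot>\<^sub>m A) $$ (k, l)" by simp
    moreover have "(?c \<cdot>\<^sub>m A) $$ (k, l) = ?c * A $$ (k, l)" using Ac kl by simp
    ultimately have "?c = dchar j k - dchar j l" using B[of k l] kl by simp
    also have "\<dots> = of_int (rt k l 0 + rt k l j)" using j by (auto simp: dchar_def rt_def)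
    finally show ?thesis .
  qed
  then show ?thesis using A by blast
qed

text \<open>Different off-diagonal positions have different roots, and diagonal ones have root 0, so
  one nonzero off-diagonal entry excludes all others.\<close>

lemma left_mult_root:
  assumes "length us = r - 1" "list_all2 (good p b) ws us" "A \<in> elems (A0 n)" "\<phi> A = left_mult br us"
    "k \<noteq> l" "k \<le> n + 1" "l \<le> n + 1" "A $$ (k, l) \<noteq> 0"
  shows "left_mult br us = fun_scale scale (A $$ (k, l)) (E k l) \<and> (\<forall>j\<in>{1..n + 1}.
    of_nat (r - 1) * b j + of_int (sum_list ws 0 + sum_list ws j) = of_int (rt k l 0 + rt k l j))"
proof -
  have ent: "of_nat (r - 1) * b j + of_int (sum_list ws 0 + sum_list ws j) = of_int (rt i m 0 + rt i m j)"
    if "i \<le> n + 1" "m \<le> n + 1" "A $$ (i, m) \<noteq> 0" "j \<in> {1..n + 1}" for i m j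
    using left_mult_matrix[OF assms(1,2)] phi_inj assms(3,4) that by metis
  have z: "A $$ (i, m) = 0" if im: "i \<le> n + 1" "m \<le> n + 1" "(i, m) \<noteq> (k, l)" for i m
  proof (rule ccontr)
    assume nz: "A $$ (i, m) \<noteq> 0"
    have "rt k l = rt i m"
    proof (rule offset_eqI[OF n_ge_1])
      fix j assume "j \<in> {1..n + 1}"
      then have "(of_int (rt k l 0 + rt k l j) :: 'k) = of_int (rt i m 0 + rt i m j)"
        using ent[OF assms(6-8)] ent[OF im(1,2) nz] by metis
      then show "rt k l 0 + rt k l j = rt i m 0 + rt i m j" by (simp only: of_int_eq_iff)
    qed (use assms im is_offset_rt in auto)
    then show False using rt_inject assms(5) im(3) by blast
  qed
  have "A = A $$ (k, l) \<cdot>\<^sub>m e0 n k l"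
    by (rule eq_matI) (use assms(3) z in \<open>auto simp: sl_super_carrier_iff\<close>)
  then have "left_mult br us = fun_scale scale (A $$ (k, l)) (E k l)"
    using phi_smult[OF part_elems[OF e0_part[OF assms(5-7)]]] assms(4) unfolding E_def by metis
  then show ?thesis using ent[OF assms(6-8)] by blast
qed

lemma left_mult_cases:
  assumes "length us = r - 1" "list_all2 (good p b) ws us" "left_mult br us \<noteq> 0"
  obtains k l c cs where "k \<le> n + 1" "l \<le> n + 1"
    "\<And>j. j \<in> {1..n + 1} \<Longrightarrow>
      of_nat (r - 1) * b j + of_int (sum_list ws 0 + sum_list ws j) = of_int (rt k l 0 + rt k l j)"
    "k \<noteq> l \<Longrightarrow> c \<noteq> 0 \<and> left_mult br us = fun_scale scale c (E k l)"
    "k = l \<Longrightarrow> left_mult br us = (\<lambda>x. \<Sum>j\<in>{1..n + 1}. scale (cs j) (H j x))"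
proof -
  obtain A where A: "A \<in> elems (A0 n)" "\<phi> A = left_mult br us"
    and ent: "\<And>k l j. k \<le> n + 1 \<Longrightarrow> l \<le> n + 1 \<Longrightarrow> A $$ (k, l) \<noteq> 0 \<Longrightarrow> j \<in> {1..n + 1} \<Longrightarrow>
      of_nat (r - 1) * b j + of_int (sum_list ws 0 + sum_list ws j) = of_int (rt k l 0 + rt k l j)"
    using left_mult_matrix[OF assms(1,2)] by metis
  show ?thesis
  proof (cases "\<exists>k\<le>n + 1. \<exists>l\<le>n + 1. k \<noteq> l \<and> A $$ (k, l) \<noteq> 0")
    case True
    then obtain k l where kl: "k \<le> n + 1" "l \<le> n + 1" "k \<noteq> l" "A $$ (k, l) \<noteq> 0" by blast
    show ?thesis
      by (rule that[of k l "A $$ (k, l)"]) (use kl ent left_mult_root[OF assms(1,2) A] in auto)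
  next
    case False
    have "finite (positions n)" by (simp add: positions_def)
    have phiA: "\<phi> A x = (\<Sum>j\<in>{1..n + 1}. scale (A $$ (j, j)) (H j x))" for x
    proof -
      have "\<phi> A x = (\<Sum>q\<in>positions n. scale (A $$ q) (\<phi> (elementary n q) x))"
        by (rule phi_decomposition[OF A(1)])
      also have "\<dots> = (\<Sum>q\<in>(\<lambda>j. (j, j)) ` {1..n + 1}. scale (A $$ q) (\<phi> (elementary n q) x))"
      proof (rule sum.mono_neutral_right)
        show "\<forall>q\<in>positions n - (\<lambda>j. (j, j)) ` {1..n + 1}. scale (A $$ q) (\<phi> (elementary n q) x) = 0"
        proof
          fix q assume "q \<in> positions n - (\<lambda>j. (j, j)) ` {1..n + 1}"
          then have "fst q \<le> n + 1" "snd q \<le> n + 1" "fst q \<noteq> snd q"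
            by (auto simp: positions_def image_iff)
          then have "A $$ (fst q, snd q) = 0" using False by blast
          then show "scale (A $$ q) (\<phi> (elementary n q) x) = 0" by simp
        qed
      qed (use \<open>finite (positions n)\<close> in \<open>auto simp: positions_def\<close>)
      also have "\<dots> = (\<Sum>j\<in>{1..n + 1}. scale (A $$ (j, j)) (H j x))"
        by (subst sum.reindex) (auto simp: inj_on_def elementary_def H_def)
      finally show ?thesis .
    qed
    \<comment> \<open>The zero weight is coded as \<open>rt i i\<close>; a nonzero diagonal entry is
      what yields the weight equation.\<close>
    obtain i where i: "i \<in> {1..n + 1}" "A $$ (i, i) \<noteq> 0"
    proof (rule ccontr)
      assume "\<not> thesis"
      then have "\<And>i. i \<in> {1..n + 1} \<Longrightarrow> A $$ (i, i) = 0" using that by blast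
      then have "\<phi> A x = 0" for x unfolding phiA by (intro sum.neutral) auto
      then show False using assms(3) A(2) by (auto simp: fun_eq_iff)
    qed
    show ?thesis
      by (rule that[of i i 0 "\<lambda>j. A $$ (j, j)"]) (use i ent[of i i] A(2) phiA in \<open>auto simp: fun_eq_iff\<close>)
  qed
qed

text \<open>Matrices with entry 0 at (k, l) form a subspace. If no tuple from \<open>S\<close>
  worked, it would contain all left multiplications, hence all inner derivations, but it misses
  \<open>E k l\<close>.\<close>

lemma exists_tuple:
  assumes "k \<noteq> l" "k \<le> n + 1" "l \<le> n + 1" "span S = UNIV" "\<And>x. x \<in> S \<Longrightarrow> \<exists>w. good p b w x"
  obtains us ws c where "length us = r - 1" "set us \<subseteq> S" "list_all2 (good p b) ws us"
    "c \<noteq> 0" "left_mult br us = fun_scale scale c (E k l)"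
    "\<And>j. j \<in> {1..n + 1} \<Longrightarrow>
      of_nat (r - 1) * b j + of_int (sum_list ws 0 + sum_list ws j) = of_int (rt k l 0 + rt k l j)"
proof (rule ccontr)
  assume "\<not> thesis"
  then have no: "\<not> (length us = r - 1 \<and> set us \<subseteq> S \<and> list_all2 (good p b) ws us \<and> c \<noteq> 0 \<and>
    left_mult br us = fun_scale scale c (E k l) \<and> (\<forall>j\<in>{1..n + 1}.
      of_nat (r - 1) * b j + of_int (sum_list ws 0 + sum_list ws j) = of_int (rt k l 0 + rt k l j)))" for us ws c
    using that by blast
  let ?W = "{\<phi> A | A. A \<in> elems (A0 n) \<and> A $$ (k, l) = 0}"
  have kl: "k < n + 2" "l < n + 2" using assms by auto
  have W: "fun_space.subspace ?W"
    unfolding fun_space.subspace_def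
  proof (intro conjI ballI allI)
    show "0 \<in> ?W" using kl elems_zero phi_zero[symmetric] by fastforce
    fix f assume "f \<in> ?W"
    then obtain A where A: "f = \<phi> A" "A \<in> elems (A0 n)" "A $$ (k, l) = 0" by blast
    then have Ac: "A \<in> carrier_mat (n + 2) (n + 2)" by (simp add: sl_super_carrier_iff)
    show "fun_scale scale c f \<in> ?W" for c
      using A Ac kl phi_smult[OF A(2), of c] elems_smult[OF A(2), of c]
      by (intro CollectI exI[of _ "c \<cdot>\<^sub>m A"]) simp
    fix g assume "g \<in> ?W"
    then obtain B where B: "g = \<phi> B" "B \<in> elems (A0 n)" "B $$ (k, l) = 0" by blast
    then have "B \<in> carrier_mat (n + 2) (n + 2)" by (simp add: sl_super_carrier_iff)
    then show "f + g \<in> ?W"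
      using A B Ac kl phi_add[OF A(2) B(2)] elems_add[OF A(2) B(2)]
      by (intro CollectI exI[of _ "A + B"]) simp
  qed
  have gen: "left_mult br us \<in> ?W" if us: "length us = r - 1" "set us \<subseteq> S" for us
  proof -
    have "\<forall>i<r - 1. \<exists>w. good p b w (us ! i)" using us assms(5) by (metis nth_mem subsetD)
    then obtain wf where wf: "\<And>i. i < r - 1 \<Longrightarrow> good p b (wf i) (us ! i)" by metis
    define ws where "ws = map wf [0..<r - 1]"
    have ws: "list_all2 (good p b) ws us"
      using us wf by (auto simp: ws_def list_all2_conv_all_nth)
    obtain A where A: "A \<in> elems (A0 n)" "\<phi> A = left_mult br us"
      using left_mult_in_inder[OF us(1)] phi_bij by (metis bij_betw_imp_surj_on imageE)
    have "A $$ (k, l) = 0"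
      using left_mult_root[OF us(1) ws A assms(1-3)] no us ws by blast
    then show ?thesis using A by force
  qed
  have all: "left_mult br us \<in> ?W" if "length us = r - 1" for us
  proof (rule multilinear_extension[OF _ gen assms(4) that])
    fix as bs :: "'v list" assume l: "length as + length bs + 1 = r - 1"
    have a: "left_mult br (as @ (x + y) # bs) = left_mult br (as @ x # bs) + left_mult br (as @ y # bs)" for x y
      using br_add[of as "bs @ [_]"] l by (auto simp: left_mult_def fun_eq_iff)
    have s: "left_mult br (as @ scale c x # bs) = fun_scale scale c (left_mult br (as @ x # bs))" for c x
      using br_scale[of as "bs @ [_]"] l by (auto simp: left_mult_def fun_eq_iff fun_scale_def)
    have z: "left_mult br (as @ 0 # bs) = 0"
      using br_zero[of as "bs @ [_]"] l by (auto simp: left_mult_def fun_eq_iff)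
    show "subspace {x. left_mult br (as @ x # bs) \<in> ?W}"
      unfolding subspace_def using W unfolding fun_space.subspace_def
      by (simp only: mem_Collect_eq a s z) blast
  qed auto
  have "inder_space scale r br \<subseteq> ?W"
    unfolding inder_space_def by (rule fun_space.span_minimal[OF _ W]) (use all in blast)
  then obtain A where "A \<in> elems (A0 n)" "A $$ (k, l) = 0" "E k l = \<phi> A"
    using E_inder[OF assms(1-3)] by blast
  then have "e0 n k l $$ (k, l) = (0::'k)"
    using phi_inj[OF part_elems[OF e0_part[OF assms(1-3)]]] unfolding E_def by metis
  then show False using kl by simp
qed

end

section \<open>The degrees of a highest weight representation\<close>

lemma sum_list_list_update:
  fixes xs :: "'a::ab_group_add list"
  shows "i < length xs \<Longrightarrow> sum_list (xs[i := x]) = sum_list xs - xs ! i + x"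
proof (induction xs arbitrary: i)
  case (Cons a xs)
  then show ?case by (cases i) (auto simp: algebra_simps)
qed simp

lemma sum_ge_card_minus_1:
  fixes f :: "'a \<Rightarrow> int"
  assumes "finite A" "\<And>t. t \<in> A \<Longrightarrow> f t \<ge> 0"
    and "\<And>t t'. t \<in> A \<Longrightarrow> t' \<in> A \<Longrightarrow> t \<noteq> t' \<Longrightarrow> f t = 0 \<Longrightarrow> f t' \<noteq> 0"
  shows "(\<Sum>t\<in>A. f t) \<ge> int (card A) - 1"
proof (cases "\<exists>t\<in>A. f t = 0")
  case True
  then obtain t where t: "t \<in> A" "f t = 0" by blast
  have "(\<Sum>s\<in>A - {t}. 1) \<le> (\<Sum>s\<in>A - {t}. f s)"
    using assms t by (intro sum_mono) force
  moreover have "(\<Sum>s\<in>A. f s) = f t + (\<Sum>s\<in>A - {t}. f s)"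
    using assms(1) t by (simp add: sum.remove)
  moreover have "card A \<ge> 1" using t assms(1) by (metis One_nat_def Suc_leI card_gt_0_iff empty_iff)
  ultimately show ?thesis using t assms(1) by (simp add: of_nat_diff)
next
  case False
  then have "(\<Sum>s\<in>A. 1) \<le> (\<Sum>s\<in>A. f s)"
    using assms by (intro sum_mono) force
  then show ?thesis by simp
qed

locale A0_highest = A0_filippov scale V r br n \<phi>
  for scale :: "'k::field_char_0 \<Rightarrow> 'v::ab_group_add \<Rightarrow> 'v" and V r br n \<phi> +
  fixes p :: bit and b :: "nat \<Rightarrow> 'k" and v :: 'v and d :: nat
  assumes v_good: "good p b 0 v" and v_ne_0: "v \<noteq> 0"
    and v_highest: "k < l \<Longrightarrow> l \<le> n + 1 \<Longrightarrow> E k l v = 0"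
    and degree_bounds: "good p b w x \<Longrightarrow> x \<noteq> 0 \<Longrightarrow> - int d \<le> w 0 \<and> w 0 \<le> 0"
    and lowest_degree: "\<exists>w x. good p b w x \<and> x \<noteq> 0 \<and> w 0 = - int d"
begin

lemma span_good: "span {x. \<exists>w. good p b w x} = UNIV"
proof (rule good_subset_span_UNIV[OF v_good v_ne_0])
  fix k l x assume "k \<noteq> l" "k \<le> n + 1" "l \<le> n + 1" "x \<in> {x. \<exists>w. good p b w x}"
  then show "E k l x \<in> span {x. \<exists>w. good p b w x}"
    using good_E by (blast intro: span_base)
qed (use v_good in auto)

definition tuple :: "(nat \<Rightarrow> int) list \<Rightarrow> 'v list \<Rightarrow> bool" where
  "tuple ws us \<longleftrightarrow> length us = r - 1 \<and> list_all2 (good p b) ws us \<and> left_mult br us \<noteq> 0"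

lemma tuple_length: "tuple ws us \<Longrightarrow> length us = r - 1 \<and> length ws = r - 1"
  by (auto simp: tuple_def list_all2_lengthD)

lemma tuple_good: "tuple ws us \<Longrightarrow> t < r - 1 \<Longrightarrow> good p b (ws ! t) (us ! t)"
  by (auto simp: tuple_def list_all2_conv_all_nth)

lemma tuple_offset: "tuple ws us \<Longrightarrow> is_offset n (sum_list ws)"
  by (rule is_offset_sum_list) (metis tuple_good tuple_length good_offset in_set_conv_nth)

lemma tuple_homogeneous: "tuple ws us \<Longrightarrow> set us \<subseteq> V 0 \<union> V 1"
  by (metis tuple_good tuple_length good_homogeneous in_set_conv_nth subsetI)

lemma root_tuple:
  assumes "k \<noteq> l" "k \<le> n + 1" "l \<le> n + 1" "span S = UNIV" "\<And>x. x \<in> S \<Longrightarrow> \<exists>w. good p b w x"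
  shows "\<exists>ws us c. tuple ws us \<and> set us \<subseteq> S \<and> c \<noteq> 0 \<and> left_mult br us = fun_scale scale c (E k l) \<and>
    (\<forall>j\<in>{1..n + 1}. of_nat (r - 1) * b j + of_int (sum_list ws 0 + sum_list ws j) = of_int (rt k l 0 + rt k l j))"
proof -
  obtain us ws c where t: "length us = r - 1" "set us \<subseteq> S" "list_all2 (good p b) ws us" "c \<noteq> 0"
    "left_mult br us = fun_scale scale c (E k l)"
    "\<And>j. j \<in> {1..n + 1} \<Longrightarrow>
      of_nat (r - 1) * b j + of_int (sum_list ws 0 + sum_list ws j) = of_int (rt k l 0 + rt k l j)"
    using exists_tuple[OF assms] by metis
  have "left_mult br us \<noteq> 0"
    using t(4,5) E_ne_0[OF assms(1-3)] by (auto simp: fun_eq_iff fun_scale_def)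
  then show ?thesis using t unfolding tuple_def by blast
qed

text \<open>The weight of a tuple producing \<open>E 1 0\<close> is r-1 times \<open>b\<close> plus
  an integral offset, and it is also a root; so r-1 times \<open>b\<close> is integral.\<close>

lemma kappa_exists:
  "\<exists>\<kappa>. is_offset n \<kappa> \<and> (\<forall>j\<in>{1..n + 1}. of_nat (r - 1) * b j = of_int (\<kappa> 0 + \<kappa> j))"
proof -
  obtain ws us where t: "tuple ws us"
    "\<And>j. j \<in> {1..n + 1} \<Longrightarrow> of_nat (r - 1) * b j + of_int (sum_list ws 0 + sum_list ws j) = of_int (rt 1 0 0 + rt 1 0 j)"
    using root_tuple[of 1 0, OF _ _ _ span_good] by auto
  have "of_nat (r - 1) * b j = of_int ((rt 1 0 - sum_list ws) 0 + (rt 1 0 - sum_list ws) j)"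
    if "j \<in> {1..n + 1}" for j
    using t(2)[OF that] by (simp add: algebra_simps)
  moreover have "is_offset n (rt 1 0 - sum_list ws)"
    using tuple_offset[OF t(1)] by (intro is_offset_diff is_offset_rt) auto
  ultimately show ?thesis by blast
qed

definition kappa :: "nat \<Rightarrow> int" where
  "kappa = (SOME \<kappa>. is_offset n \<kappa> \<and> (\<forall>j\<in>{1..n + 1}. of_nat (r - 1) * b j = of_int (\<kappa> 0 + \<kappa> j)))"

lemma kappa_offset: "is_offset n kappa"
  and kappa_b: "j \<in> {1..n + 1} \<Longrightarrow> of_nat (r - 1) * b j = of_int (kappa 0 + kappa j)"
proof -
  have "is_offset n kappa \<and> (\<forall>j\<in>{1..n + 1}. of_nat (r - 1) * b j = of_int (kappa 0 + kappa j))"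
    unfolding kappa_def by (rule someI_ex[OF kappa_exists])
  then show "is_offset n kappa" "j \<in> {1..n + 1} \<Longrightarrow> of_nat (r - 1) * b j = of_int (kappa 0 + kappa j)"
    by blast+
qed

lemma offset_of_tuple:
  assumes "tuple ws us" "k \<le> n + 1" "l \<le> n + 1"
    "\<And>j. j \<in> {1..n + 1} \<Longrightarrow> of_nat (r - 1) * b j + of_int (sum_list ws 0 + sum_list ws j) = of_int (rt k l 0 + rt k l j)"
  shows "sum_list ws + kappa = rt k l"
proof (rule offset_eqI[OF n_ge_1])
  fix j assume j: "j \<in> {1..n + 1}"
  have "of_int (kappa 0 + kappa j + (sum_list ws 0 + sum_list ws j)) = (of_int (rt k l 0 + rt k l j) :: 'k)"
    using assms(4)[OF j] unfolding kappa_b[OF j] by (simp only: of_int_add)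
  then show "(sum_list ws + kappa) 0 + (sum_list ws + kappa) j = rt k l 0 + rt k l j"
    by (simp only: of_int_eq_iff plus_fun_apply)
qed (use assms kappa_offset tuple_offset in \<open>auto intro: is_offset_add is_offset_rt\<close>)

lemma exists_root_tuple:
  assumes "k \<noteq> l" "k \<le> n + 1" "l \<le> n + 1" "span S = UNIV" "\<And>x. x \<in> S \<Longrightarrow> \<exists>w. good p b w x"
  shows "\<exists>ws us c. tuple ws us \<and> set us \<subseteq> S \<and> c \<noteq> 0 \<and> left_mult br us = fun_scale scale c (E k l) \<and>
    sum_list ws + kappa = rt k l"
proof -
  obtain ws us c where t: "tuple ws us" "set us \<subseteq> S" "c \<noteq> 0" "left_mult br us = fun_scale scale c (E k l)"
    "\<forall>j\<in>{1..n + 1}. of_nat (r - 1) * b j + of_int (sum_list ws 0 + sum_list ws j) = of_int (rt k l 0 + rt k l j)"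
    using root_tuple[OF assms] by blast
  have "sum_list ws + kappa = rt k l"
    by (rule offset_of_tuple[OF t(1) assms(2,3)]) (use t(5) in blast)
  then show ?thesis using t by blast
qed

lemma tuple_cases:
  assumes "tuple ws us"
  obtains k l c cs where "k \<le> n + 1" "l \<le> n + 1" "sum_list ws + kappa = rt k l"
    "k \<noteq> l \<Longrightarrow> c \<noteq> 0 \<and> left_mult br us = fun_scale scale c (E k l)"
    "k = l \<Longrightarrow> left_mult br us = (\<lambda>x. \<Sum>j\<in>{1..n + 1}. scale (cs j) (H j x))"
proof -
  have a: "length us = r - 1" "list_all2 (good p b) ws us" "left_mult br us \<noteq> 0"
    using assms by (simp_all add: tuple_def)
  show ?thesis
  proof (rule left_mult_cases[OF a])
    fix k l c cs
    assume kl: "k \<le> n + 1" "l \<le> n + 1"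
      "\<And>j. j \<in> {1..n + 1} \<Longrightarrow>
        of_nat (r - 1) * b j + of_int (sum_list ws 0 + sum_list ws j) = of_int (rt k l 0 + rt k l j)"
      and E: "k \<noteq> l \<Longrightarrow> c \<noteq> 0 \<and> left_mult br us = fun_scale scale c (E k l)"
      "k = l \<Longrightarrow> left_mult br us = (\<lambda>x. \<Sum>j\<in>{1..n + 1}. scale (cs j) (H j x))"
    show ?thesis
      by (rule that[OF kl(1,2) offset_of_tuple[OF assms kl] E])
  qed
qed

lemma tuple_root:
  assumes "tuple ws us"
  shows "\<exists>k\<le>n + 1. \<exists>l\<le>n + 1. sum_list ws + kappa = rt k l"
  by (rule tuple_cases[OF assms]) blast

lemma tuple_cartan:
  assumes "tuple ws us" "sum_list ws + kappa = 0"
  obtains cs where "left_mult br us = (\<lambda>x. \<Sum>j\<in>{1..n + 1}. scale (cs j) (H j x))"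
proof -
  obtain k l c cs where kl: "sum_list ws + kappa = rt k l"
    "k = l \<Longrightarrow> left_mult br us = (\<lambda>x. \<Sum>j\<in>{1..n + 1}. scale (cs j) (H j x))"
    using tuple_cases[OF assms(1)] by metis
  have "rt k l k = 0" using kl(1) assms(2) by simp
  then have "k = l" by (auto simp: rt_def split: if_splits)
  then show ?thesis using kl that by blast
qed

lemma tuple_entry_ne_0:
  assumes "tuple ws us" "t < r - 1"
  shows "us ! t \<noteq> 0"
proof
  assume 0: "us ! t = 0"
  have len: "length us = r - 1" using assms tuple_length by blast
  have "left_mult br us x = 0" for x
  proof -
    have "us = take t us @ 0 # drop (Suc t) us"
      using id_take_nth_drop[of t us] assms(2) len 0 by simp
    then have "us @ [x] = take t us @ 0 # (drop (Suc t) us @ [x])"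
      by (metis append_Cons append_assoc)
    moreover have "length (take t us) + length (drop (Suc t) us @ [x]) + 1 = r"
      using len assms(2) by auto
    ultimately show ?thesis
      using br_zero unfolding left_mult_def by metis
  qed
  then show False using assms(1) by (auto simp: tuple_def fun_eq_iff)
qed

lemma tuple_entry_bounds:
  "tuple ws us \<Longrightarrow> t < r - 1 \<Longrightarrow> - int d \<le> (ws ! t) 0 \<and> (ws ! t) 0 \<le> 0"
  using tuple_entry_ne_0 tuple_good degree_bounds by blast

text \<open>The exchange itself: \<open>us @ [y]\<close> and the new tuple followed by the removed
  entry are permutations of each other. In particular the new operator does not kill the removed
  entry.\<close>

lemma tuple_swap:
  assumes "tuple ws us" "t < r - 1" "good p b w y" "left_mult br us y \<noteq> 0"
  shows "tuple (ws[t := w]) (us[t := y])" "left_mult br (us[t := y]) (us ! t) \<noteq> 0"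
    "sum_list (ws[t := w]) = sum_list ws - ws ! t + w"
proof -
  have len: "length us = r - 1" "length ws = r - 1" using assms tuple_length by auto
  have m: "mset (us[t := y] @ [us ! t]) = mset (us @ [y])"
    using len assms(2) by (simp add: mset_update)
  have "set (us @ [y]) \<subseteq> V 0 \<union> V 1"
    using tuple_homogeneous[OF assms(1)] good_homogeneous[OF assms(3)] by simp
  then have "set (us[t := y] @ [us ! t]) \<subseteq> V 0 \<union> V 1"
    using mset_eq_setD[OF m] by simp
  moreover have "length (us[t := y] @ [us ! t]) = r"
    using len arity by simp
  ultimately have "br (us[t := y] @ [us ! t]) \<noteq> 0"
    using br_permute_eq_0[OF m] assms(4) unfolding left_mult_def by blast
  then show nz: "left_mult br (us[t := y]) (us ! t) \<noteq> 0" by (simp add: left_mult_def)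
  then have "left_mult br (us[t := y]) \<noteq> 0" by (auto simp: fun_eq_iff)
  then show "tuple (ws[t := w]) (us[t := y])"
    using assms(1,3) len list_all2_update_cong[of "good p b" ws us w y t] by (simp add: tuple_def)
  show "sum_list (ws[t := w]) = sum_list ws - ws ! t + w"
    using len assms(2) by (simp add: sum_list_list_update)
qed

text \<open>If \<open>E 0 l\<close> vanished on degree \<open>- j\<close>, so would every
  \<open>E 0 k\<close>, the bracket of \<open>E 0 l\<close> with the degree-preserving
  \<open>E l k\<close>. Nothing would lead out of the degrees up to \<open>- j\<close>, and
  \<open>v\<close> could not be reached from the lowest degree.\<close>

lemma raise_nonzero:
  assumes "l \<in> {1..n + 1}" "1 \<le> j" "j \<le> int d"
  shows "\<exists>w y. good p b w y \<and> w 0 = - j \<and> E 0 l y \<noteq> 0"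
proof (rule ccontr)
  assume "\<not> ?thesis"
  then have no: "E 0 l y = 0" if "good p b w y" "w 0 = - j" for w y using that by blast
  have all: "E 0 k y = 0" if "good p b w y" "w 0 = - j" "k \<in> {1..n + 1}" for w y k
  proof (cases "k = l")
    case False
    have g: "good p b (w + rt l k) (E l k y)" using that assms False by (intro good_E) auto
    have "E 0 l (E l k y) = 0"
      using no[OF g] that assms by (simp add: rt_def)
    then show ?thesis
      using EE_bracket[of 0 l l k y] no[OF that(1,2)] that(3) assms(1) False by (simp add: lin_0[OF E_lin])
  qed (use no that in blast)
  obtain wl xl where xl: "good p b wl xl" "xl \<noteq> 0" "wl 0 = - int d" using lowest_degree by blast
  have "(0 :: nat \<Rightarrow> int) 0 \<in> {..- j}"
  proof (rule degrees_reach[OF xl(1,2) _ _ v_good v_ne_0])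
    fix k m w x assume *: "k \<noteq> m" "k \<le> n + 1" "m \<le> n + 1" "good p b w x" "w 0 \<in> {..- j}"
    show "E k m x = 0 \<or> w 0 + rt k m 0 \<in> {..- j}"
    proof (cases "k = 0 \<and> w 0 = - j")
      case True
      then show ?thesis using all[OF *(4), of m] * by simp
    next
      case False
      then show ?thesis using * by (auto simp: rt_def)
    qed
  qed (use xl assms in auto)
  then show False using assms(2) by simp
qed

text \<open>Mirror image of \<open>raise_nonzero\<close>: otherwise nothing generated by
  \<open>v\<close> would descend below degree \<open>- j\<close>.\<close>

lemma lower_nonzero:
  assumes "l \<in> {1..n + 1}" "0 \<le> j" "j < int d"
  shows "\<exists>w y. good p b w y \<and> w 0 = - j \<and> E l 0 y \<noteq> 0"
proof (rule ccontr)
  assume "\<not> ?thesis"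
  then have no: "E l 0 y = 0" if "good p b w y" "w 0 = - j" for w y using that by blast
  have all: "E k 0 y = 0" if "good p b w y" "w 0 = - j" "k \<in> {1..n + 1}" for w y k
  proof (cases "k = l")
    case False
    have g: "good p b (w + rt k l) (E k l y)" using that assms False by (intro good_E) auto
    have "E l 0 (E k l y) = 0"
      using no[OF g] that assms by (simp add: rt_def)
    then show ?thesis
      using EE_bracket[of k l l 0 y] no[OF that(1,2)] that(3) assms(1) False by (simp add: lin_0[OF E_lin])
  qed (use no that in blast)
  obtain wl xl where xl: "good p b wl xl" "xl \<noteq> 0" "wl 0 = - int d" using lowest_degree by blast
  have "wl 0 \<in> {- j..}"
  proof (rule degrees_reach[OF v_good v_ne_0 _ _ xl(1,2)])
    fix k m w x assume *: "k \<noteq> m" "k \<le> n + 1" "m \<le> n + 1" "good p b w x" "w 0 \<in> {- j..}"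
    show "E k m x = 0 \<or> w 0 + rt k m 0 \<in> {- j..}"
    proof (cases "m = 0 \<and> w 0 = - j")
      case True
      then show ?thesis using all[OF *(4), of k] * by simp
    next
      case False
      then show ?thesis using * by (auto simp: rt_def)
    qed
  qed (use xl assms in auto)
  then show False using assms(3) xl(3) by simp
qed

lemma raising_swap:
  assumes "tuple ws us" "(sum_list ws + kappa) 0 = 1" "t < r - 1" "1 \<le> j" "j \<le> int d"
  shows "\<exists>w y. w 0 = - j \<and> tuple (ws[t := w]) (us[t := y]) \<and>
    (sum_list (ws[t := w]) + kappa) 0 = 1 - (ws ! t) 0 - j"
proof -
  obtain k l c where kl: "k \<le> n + 1" "l \<le> n + 1" "sum_list ws + kappa = rt k l"
    "k \<noteq> l \<Longrightarrow> c \<noteq> 0 \<and> left_mult br us = fun_scale scale c (E k l)"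
    using tuple_cases[OF assms(1)] by metis
  have "rt k l 0 = 1" using assms(2) kl(3) by simp
  then have k: "k = 0" "l \<in> {1..n + 1}" using kl(2) by (cases "k = 0"; cases "l = 0"; auto simp: rt_def)+
  obtain w y where wy: "good p b w y" "w 0 = - j" "E 0 l y \<noteq> 0"
    using raise_nonzero[OF k(2) assms(4,5)] by blast
  then have "left_mult br us y \<noteq> 0" using kl(4) k by (auto simp: fun_scale_def)
  note sw = tuple_swap[OF assms(1,3) wy(1) this]
  show ?thesis
    by (intro exI[of _ w] exI[of _ y]) (use sw(1,3) wy(2) assms(2) in simp)
qed

lemma lowering_swap:
  assumes "tuple ws us" "(sum_list ws + kappa) 0 = - 1" "t < r - 1" "0 \<le> j" "j < int d"
  shows "\<exists>w y. w 0 = - j \<and> tuple (ws[t := w]) (us[t := y]) \<and>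
    (sum_list (ws[t := w]) + kappa) 0 = - 1 - (ws ! t) 0 - j"
proof -
  obtain k l c where kl: "k \<le> n + 1" "l \<le> n + 1" "sum_list ws + kappa = rt k l"
    "k \<noteq> l \<Longrightarrow> c \<noteq> 0 \<and> left_mult br us = fun_scale scale c (E k l)"
    using tuple_cases[OF assms(1)] by metis
  have "rt k l 0 = - 1" using assms(2) kl(3) by simp
  then have k: "l = 0" "k \<in> {1..n + 1}" using kl(1) by (cases "k = 0"; cases "l = 0"; auto simp: rt_def)+
  obtain w y where wy: "good p b w y" "w 0 = - j" "E k 0 y \<noteq> 0"
    using lower_nonzero[OF k(2) assms(4,5)] by blast
  then have "left_mult br us y \<noteq> 0" using kl(4) k by (auto simp: fun_scale_def)
  note sw = tuple_swap[OF assms(1,3) wy(1) this]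
  show ?thesis
    by (intro exI[of _ w] exI[of _ y]) (use sw(1,3) wy(2) assms(2) in simp)
qed

lemma tuple_degree_bounds: "tuple ws us \<Longrightarrow> - 1 \<le> (sum_list ws + kappa) 0 \<and> (sum_list ws + kappa) 0 \<le> 1"
  using tuple_root by (fastforce simp: rt_def simp del: plus_fun_apply)

lemma d_ge_1: "d \<ge> 1"
proof (rule ccontr)
  assume d: "\<not> d \<ge> 1"
  have "E 0 1 = 0"
  proof (rule lin_eqI[OF E_lin _ span_good])
    show "lin 0" by (simp add: lin_def)
    fix x assume "x \<in> {x. \<exists>w. good p b w x}"
    then obtain w where w: "good p b w x" by blast
    then have g: "good p b (w + rt 0 1) (E 0 1 x)" by (intro good_E) auto
    have "E 0 1 x = 0"
    proof (rule ccontr)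
      assume "E 0 1 x \<noteq> 0"
      then have "w 0 + rt 0 1 0 \<le> 0" "x \<noteq> 0" using degree_bounds[OF g] lin_0[OF E_lin[of 0 1]] by auto
      then show False using degree_bounds[OF w] d by (simp add: rt_def)
    qed
    then show "E 0 1 x = 0 x" by simp
  qed auto
  then show False using E_ne_0[of 0 1] by simp
qed

text \<open>An exchange with a vector of degree \<open>- j\<close> must again give degree at least
  -1 and at most 1; the extreme choices j = d and j = 1 give the two bounds.\<close>

lemma raising_bounds:
  assumes "tuple ws us" "(sum_list ws + kappa) 0 = 1" "t < r - 1"
  shows "int d - 2 \<le> - (ws ! t) 0 \<and> - (ws ! t) 0 \<le> 1"
proof
  have d: "1 \<le> int d" using d_ge_1 by simp
  show "int d - 2 \<le> - (ws ! t) 0"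
    using raising_swap[OF assms d order_refl] tuple_degree_bounds by (smt (verit))
  show "- (ws ! t) 0 \<le> 1"
    using raising_swap[OF assms order_refl d] tuple_degree_bounds by (smt (verit))
qed

text \<open>As in \<open>raising_bounds\<close>, now with j = d - 1 and j = 0, because a lowering
  operator acts nontrivially only above the lowest degree.\<close>

lemma lowering_bounds:
  assumes "tuple ws us" "(sum_list ws + kappa) 0 = - 1" "t < r - 1"
  shows "int d - 1 \<le> - (ws ! t) 0 \<and> - (ws ! t) 0 \<le> 2"
proof
  have d: "0 < int d" "0 \<le> int d - 1" "int d - 1 < int d" using d_ge_1 by simp_all
  show "int d - 1 \<le> - (ws ! t) 0"
    using lowering_swap[OF assms d(2,3)] tuple_degree_bounds by (smt (verit))
  show "- (ws ! t) 0 \<le> 2"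
    using lowering_swap[OF assms order_refl d(1)] tuple_degree_bounds by (smt (verit))
qed

lemma tuple_degree_sum:
  assumes "tuple ws us"
  shows "(sum_list ws + kappa) 0 = kappa 0 + (\<Sum>t<r - 1. (ws ! t) 0)"
  unfolding plus_fun_apply sum_list_fun_apply using tuple_length[OF assms]
  by (simp add: sum_list_sum_nth atLeast0LessThan)

lemma exists_raising: obtains ws us where "tuple ws us" "(sum_list ws + kappa) 0 = 1"
proof -
  obtain ws us where "tuple ws us" "sum_list ws + kappa = rt 0 1"
    using exists_root_tuple[of 0 1, OF _ _ _ span_good] by auto
  then show ?thesis using that[of ws us] by (simp add: rt_def del: plus_fun_apply)
qed

lemma exists_lowering: obtains ws us where "tuple ws us" "(sum_list ws + kappa) 0 = - 1"
proof -
  obtain ws us where "tuple ws us" "sum_list ws + kappa = rt 1 0"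
    using exists_root_tuple[of 1 0, OF _ _ _ span_good] by auto
  then show ?thesis using that[of ws us] by (simp add: rt_def del: plus_fun_apply)
qed

text \<open>For d \<ge> 3 the bounds force d = 3 and put every entry of a tuple of degree 1 in
  degree -1. Exchanging one for a vector of degree -3 gives a tuple of degree -1, whose remaining
  entries would need degree at most -2; r \<ge> 3 provides such an entry.\<close>

lemma d_le_2: "d \<le> 2"
proof (rule ccontr)
  assume d: "\<not> d \<le> 2"
  obtain ws us where t: "tuple ws us" "(sum_list ws + kappa) 0 = 1" by (rule exists_raising)
  have i: "(ws ! t) 0 = - 1" "d = 3" if "t < r - 1" for t
    using raising_bounds[OF t that] d by linarith+
  have r: "0 < r - 1" "1 < r - 1" using r_ge_3 by auto
  have d3: "d = 3" using i(2)[OF r(1)] .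
  obtain w y where w: "tuple (ws[0 := w]) (us[0 := y])" "(sum_list (ws[0 := w]) + kappa) 0 = 1 - (ws ! 0) 0 - 3"
    using raising_swap[OF t r(1), of 3] d3 by (auto simp del: plus_fun_apply)
  then have "int d - 1 \<le> - (ws[0 := w] ! 1) 0"
    using lowering_bounds[OF w(1) _ r(2)] i(1)[OF r(1)] by simp
  then show False using i(1)[OF r(2)] d3 by simp
qed

text \<open>All entries have degree 0 or -1. The degree of a tuple is \<open>kappa 0\<close> plus
  the sum of its entries, and both degrees 1 and -1 occur.\<close>

lemma degree_1:
  assumes "d = 1"
  shows "1 \<le> kappa 0 \<and> kappa 0 \<le> int r - 2"
proof
  obtain ws us where t: "tuple ws us" "(sum_list ws + kappa) 0 = 1" by (rule exists_raising)
  have "(\<Sum>t<r - 1. (ws ! t) 0) \<le> 0"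
    using tuple_entry_bounds[OF t(1)] by (intro sum_nonpos) auto
  then show "1 \<le> kappa 0" using t(2) tuple_degree_sum[OF t(1)] by linarith
  obtain ws us where t: "tuple ws us" "(sum_list ws + kappa) 0 = - 1" by (rule exists_lowering)
  have "(\<Sum>t<r - 1. - 1) \<le> (\<Sum>t<r - 1. (ws ! t) 0)"
    using tuple_entry_bounds[OF t(1)] assms by (intro sum_mono) auto
  then show "kappa 0 \<le> int r - 2" using t(2) tuple_degree_sum[OF t(1)] r_ge_3 by (simp add: of_nat_diff)
qed

text \<open>Exchanging one entry of degree 0 for a vector of degree -2 gives a tuple of degree -1,
  in which \<open>lowering_bounds\<close> forbids another entry of degree 0.\<close>

lemma raising_unique_0:
  assumes "d = 2" "tuple ws us" "(sum_list ws + kappa) 0 = 1" "t < r - 1" "t' < r - 1" "t \<noteq> t'" "(ws ! t) 0 = 0"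
  shows "(ws ! t') 0 \<noteq> 0"
proof
  assume 0: "(ws ! t') 0 = 0"
  obtain w y where w: "tuple (ws[t := w]) (us[t := y])" "(sum_list (ws[t := w]) + kappa) 0 = 1 - (ws ! t) 0 - 2"
    using raising_swap[OF assms(2-4), of 2] assms(1) by (auto simp del: plus_fun_apply)
  have "int d - 1 \<le> - (ws[t := w] ! t') 0"
    using lowering_bounds[OF w(1) _ assms(5)] w(2) assms(7) by simp
  then show False using 0 assms by simp
qed

text \<open>Exchanging one entry of degree -2 for a vector of degree 0 gives a tuple of degree 1, in
  which \<open>raising_bounds\<close> forbids another entry of degree -2.\<close>

lemma lowering_unique_2:
  assumes "d = 2" "tuple ws us" "(sum_list ws + kappa) 0 = - 1" "t < r - 1" "t' < r - 1" "t \<noteq> t'" "(ws ! t) 0 = - 2"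
  shows "(ws ! t') 0 \<noteq> - 2"
proof
  assume 2: "(ws ! t') 0 = - 2"
  obtain w y where w: "tuple (ws[t := w]) (us[t := y])" "(sum_list (ws[t := w]) + kappa) 0 = - 1 - (ws ! t) 0 - 0"
    using lowering_swap[OF assms(2-4), of 0] assms(1) by (auto simp del: plus_fun_apply)
  have "- (ws[t := w] ! t') 0 \<le> 1"
    using raising_bounds[OF w(1) _ assms(5)] w(2) assms(7) by simp
  then show False using 2 assms by simp
qed

text \<open>A tuple of degree 1 has entries in degree -1 except for at most one in degree 0, a tuple
  of degree -1 except for at most one in degree -2. The two sums bound \<open>kappa 0\<close> from
  below and from above.\<close>

lemma degree_2:
  assumes "d = 2"
  shows "kappa 0 = int r - 1"
proof -
  obtain ws us where t: "tuple ws us" "(sum_list ws + kappa) 0 = 1" by (rule exists_raising)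
  have "int (card {..<r - 1}) - 1 \<le> (\<Sum>t<r - 1. - (ws ! t) 0)"
    by (rule sum_ge_card_minus_1)
      (use tuple_entry_bounds[OF t(1)] raising_unique_0[OF assms t] in auto)
  then have 1: "kappa 0 \<ge> int r - 1"
    using t(2) tuple_degree_sum[OF t(1)] r_ge_3 by (simp add: of_nat_diff sum_negf)
  obtain ws us where t: "tuple ws us" "(sum_list ws + kappa) 0 = - 1" by (rule exists_lowering)
  have "int (card {..<r - 1}) - 1 \<le> (\<Sum>t<r - 1. 2 + (ws ! t) 0)"
  proof (rule sum_ge_card_minus_1)
    show "0 \<le> 2 + (ws ! s) 0" if "s \<in> {..<r - 1}" for s
      using tuple_entry_bounds[OF t(1), of s] assms that by simp
    show "2 + (ws ! s') 0 \<noteq> 0" if "s \<in> {..<r - 1}" "s' \<in> {..<r - 1}" "s \<noteq> s'" "2 + (ws ! s) 0 = 0" for s s'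
      using lowering_unique_2[OF assms t, of s s'] that by force
  qed simp
  then have "kappa 0 \<le> int r - 1"
    using t(2) tuple_degree_sum[OF t(1)] r_ge_3 by (simp add: of_nat_diff sum.distrib)
  with 1 show ?thesis by simp
qed

lemma lowering_shape:
  assumes "d = 2" "tuple ws us" "(sum_list ws + kappa) 0 = - 1"
  obtains t where "t < r - 1" "(ws ! t) 0 = - 2" "\<And>t'. t' < r - 1 \<Longrightarrow> t' \<noteq> t \<Longrightarrow> (ws ! t') 0 = - 1"
proof -
  have vals: "(ws ! t) 0 = - 1 \<or> (ws ! t) 0 = - 2" if "t < r - 1" for t
    using lowering_bounds[OF assms(2,3) that] assms(1) by auto
  have "\<exists>t<r - 1. (ws ! t) 0 = - 2"
  proof (rule ccontr)
    assume "\<not> ?thesis"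
    then have "(\<Sum>t<r - 1. (ws ! t) 0) = (\<Sum>t<r - 1. - 1)"
      using vals by (intro sum.cong) auto
    then show False
      using degree_2[OF assms(1)] assms(3) tuple_degree_sum[OF assms(2)] r_ge_3 by (simp add: of_nat_diff)
  qed
  then show ?thesis
    using that vals lowering_unique_2[OF assms] by metis
qed

lemma sum_b: "of_nat (r - 1) * (\<Sum>j\<in>{1..n + 1}. b j) = of_int (int n * kappa 0)"
proof -
  have "of_nat (r - 1) * (\<Sum>j\<in>{1..n + 1}. b j) = (\<Sum>j\<in>{1..n + 1}. of_int (kappa 0 + kappa j))"
    unfolding sum_distrib_left by (intro sum.cong refl kappa_b)
  then show ?thesis by (simp only: of_int_sum[symmetric] is_offset_sum[OF kappa_offset])
qed

end

section \<open>Excluding all highest weights\<close>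

context A0_highest begin

lemma H_v: "j \<in> {1..n + 1} \<Longrightarrow> H j v = scale (b j) v"
  using good_H[OF v_good] by simp

lemma good_unique:
  assumes "good p b w x" "good p b w' x" "x \<noteq> 0"
  shows "w = w'"
proof (rule offset_eqI[OF n_ge_1 good_offset[OF assms(1)] good_offset[OF assms(2)]])
  fix j assume j: "j \<in> {1..n + 1}"
  have "scale (b j + of_int (w 0 + w j)) x = scale (b j + of_int (w' 0 + w' j)) x"
    using good_H[OF assms(1) j] good_H[OF assms(2) j] by metis
  then have "b j + of_int (w 0 + w j) = b j + of_int (w' 0 + w' j)"
    using assms(3) scale_right_imp_eq by blast
  then show "w 0 + w j = w' 0 + w' j" by (simp only: add_left_cancel of_int_eq_iff)
qed

lemma good_below_eq_0: "good p b w x \<Longrightarrow> w 0 < - int d \<Longrightarrow> x = 0"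
  using degree_bounds by fastforce

section \<open>Strings of even lowering operators and dominance\<close>

lemma good_power:
  assumes "j \<in> {1..n + 1}" "k \<in> {1..n + 1}" "j \<noteq> k"
  shows "good p b (\<lambda>i. int m * rt k j i) ((E k j ^^ m) v)"
proof (induction m)
  case 0
  then show ?case using v_good by (simp add: zero_fun_def)
next
  case (Suc m)
  have "(\<lambda>i. int m * rt k j i) + rt k j = (\<lambda>i. int (Suc m) * rt k j i)"
    by (simp add: fun_eq_iff algebra_simps)
  then show ?case using good_E[OF Suc, of k j] assms by simp
qed

text \<open>The usual sl2 formula for \<open>E j k\<close>, \<open>E k j\<close> and
  \<open>H j - H k\<close>, the last acting on the m-th vector of the string by
  \<open>b j - b k - 2m\<close>.\<close>

lemma raise_power:
  assumes "j \<in> {1..n + 1}" "k \<in> {1..n + 1}" "j < k"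
  shows "E j k ((E k j ^^ Suc m) v) = scale (of_nat (Suc m) * (b j - b k - of_nat m)) ((E k j ^^ m) v)"
proof (induction m)
  case 0
  have "E j k (E k j v) = E k j (E j k v) + H j v - H k v"
    using assms by (intro EE_even_opposite) auto
  moreover have "E k j (E j k v) = 0"
    using v_highest[of j k] assms lin_0[OF E_lin[of k j]] by simp
  ultimately show ?case
    using assms by (simp add: H_v scale_left_diff_distrib)
next
  case (Suc m)
  let ?x = "(E k j ^^ Suc m) v"
  have g: "good p b (\<lambda>i. int (Suc m) * rt k j i) ?x"
    using assms by (intro good_power) auto
  have Hj: "H j ?x = scale (b j - of_nat (Suc m)) ?x" "H k ?x = scale (b k + of_nat (Suc m)) ?x"
    using good_H[OF g assms(1)] good_H[OF g assms(2)] assms by (auto simp: rt_def)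
  have "E j k (E k j ?x) = E k j (E j k ?x) + H j ?x - H k ?x"
    using assms by (intro EE_even_opposite) auto
  also have "E k j (E j k ?x) = scale (of_nat (Suc m) * (b j - b k - of_nat m)) ?x"
    unfolding Suc using assms by (simp add: lin_scale[OF E_lin])
  also have "\<dots> + H j ?x - H k ?x
      = scale (of_nat (Suc m) * (b j - b k - of_nat m) + (b j - of_nat (Suc m)) - (b k + of_nat (Suc m))) ?x"
    unfolding Hj by (simp only: scale_left_distrib scale_left_diff_distrib)
  also have "of_nat (Suc m) * (b j - b k - of_nat m) + (b j - of_nat (Suc m)) - (b k + of_nat (Suc m))
      = of_nat (Suc (Suc m)) * (b j - b k - of_nat (Suc m))"
    by (simp add: algebra_simps)
  finally show ?case by simp
qed

text \<open>The string through \<open>v\<close> must end, and at its first vanishing power the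
  coefficient in \<open>raise_power\<close> has to be 0.\<close>

lemma dominant:
  assumes "j \<in> {1..n + 1}" "k \<in> {1..n + 1}" "j < k"
  shows "\<exists>M. b j - b k = of_nat M \<and> (E k j ^^ M) v \<noteq> 0 \<and> (E k j ^^ Suc M) v = 0"
proof -
  have "\<exists>m. (E k j ^^ m) v = 0"
  proof (rule ccontr)
    assume "\<not> ?thesis"
    then have nz: "(E k j ^^ m) v \<noteq> 0" for m by blast
    \<comment> \<open>This combination picks out \<open>h0 n j\<close>, whose value on the offset of
      the m-th vector is -m; an endless string would give infinitely many values.\<close>
    let ?A = "{\<Sum>i\<in>{1..n + 1}. (if i = j then 1 else 0) * (w 0 + w i) | w. \<exists>x. good p b w x \<and> x \<noteq> 0}"
    have "- int m \<in> ?A" for m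
    proof -
      let ?w = "\<lambda>i. int m * rt k j i"
      have "(\<Sum>i\<in>{1..n + 1}. (if i = j then 1 else 0) * (?w 0 + ?w i)) = (\<Sum>i\<in>{1..n + 1}. if i = j then ?w 0 + ?w j else 0)"
        by (intro sum.cong) auto
      also have "\<dots> = - int m" using assms by (simp add: rt_def)
      finally show ?thesis
        using good_power[of j k m] nz[of m] assms by (intro CollectI exI[of _ ?w]) auto
    qed
    then have "range (\<lambda>m. - int m) \<subseteq> ?A" by blast
    then have "finite (range (\<lambda>m. - int m))" by (rule finite_subset[OF _ finite_weights])
    then show False by (auto dest!: finite_imageD simp: inj_on_def)
  qed
  then obtain m where m: "(E k j ^^ m) v = 0" "\<And>i. i < m \<Longrightarrow> (E k j ^^ i) v \<noteq> 0"
    using exists_least_iff[of "\<lambda>m. (E k j ^^ m) v = 0"] by blast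
  then obtain M where M: "m = Suc M" using v_ne_0 by (cases m) auto
  have "scale (of_nat (Suc M) * (b j - b k - of_nat M)) ((E k j ^^ M) v) = 0"
    using raise_power[OF assms, of M] m(1) M lin_0[OF E_lin[of j k]] assms by simp
  then have "b j - b k = of_nat M"
    using m(2)[of M] M by (simp del: of_nat_Suc)
  then show ?thesis using m M by blast
qed

lemma dominant_add:
  assumes "j \<in> {1..n + 1}" "k \<in> {1..n + 1}" "j < k"
  shows "\<exists>M. b j = b k + of_nat M"
proof -
  obtain M where "b j - b k = of_nat M" using dominant[OF assms] by blast
  then have "b j = b k + of_nat M" by (simp add: diff_eq_eq add.commute)
  then show ?thesis ..
qed

section \<open>Products of odd lowering operators on the highest weight vector\<close>

lemma E_0j_Ej0_v: "j \<in> {1..n + 1} \<Longrightarrow> E 0 j (E j 0 v) = scale (b j) v"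
  using EE_odd_opposite[of j v] v_highest[of 0 j] by (simp add: H_v lin_0[OF E_lin])

lemma E_0j_Ei0:
  assumes "i \<in> {1..n + 1}" "j \<in> {1..n + 1}" "i \<noteq> j"
  shows "E 0 j (E i 0 x) = E i j x - E i 0 (E 0 j x)"
  using EE_bracket[of 0 j i 0 x] assms by (simp add: rpar_def koszul_sign_def)

lemma E_ij_Ek0:
  assumes "i \<in> {1..n + 1}" "j \<in> {1..n + 1}" "k \<in> {1..n + 1}" "i \<noteq> j"
  shows "E i j (E k 0 x) = (if j = k then E i 0 x else 0) + E k 0 (E i j x)"
  using EE_bracket[of i j k 0 x] assms by (simp add: rpar_def koszul_sign_def)

lemma E_i0_Ej0:
  assumes "i \<in> {1..n + 1}" "j \<in> {1..n + 1}"
  shows "E i 0 (E j 0 x) = - E j 0 (E i 0 x)"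
  using EE_bracket[of i 0 j 0 x] assms by (simp add: rpar_def koszul_sign_def)

lemma E_i0_Ei0:
  assumes "i \<in> {1..n + 1}"
  shows "E i 0 (E i 0 x) = 0"
proof -
  have "E i 0 (E i 0 x) + E i 0 (E i 0 x) = 0"
    using E_i0_Ej0[OF assms assms, of x] by (simp add: eq_neg_iff_add_eq_0)
  then have "scale 2 (E i 0 (E i 0 x)) = 0"
    using scale_left_distrib[of 1 1 "E i 0 (E i 0 x)"] by simp
  then show ?thesis by simp
qed

text \<open>\<open>E 0 j\<close> passes \<open>E i 0\<close> at the cost of \<open>E i j\<close>,
  and \<open>E i j (E j 0 v) = E i 0 v\<close> because \<open>E i j\<close> kills \<open>v\<close>.
  Where the product of lowering operators vanishes, this yields \<open>b j = 1\<close> or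
  \<open>E i 0 v = 0\<close>.\<close>

lemma raise_lower_lower:
  assumes "i \<in> {1..n + 1}" "j \<in> {1..n + 1}" "i < j"
  shows "E 0 j (E i 0 (E j 0 v)) = scale (1 - b j) (E i 0 v)"
  using assms v_highest[of i j]
  by (simp add: E_0j_Ei0 E_ij_Ek0 E_0j_Ej0_v lin_scale[OF E_lin] lin_0[OF E_lin] scale_left_diff_distrib)

text \<open>The same mechanism with two operators to pass, each contributing 1 to the constant 2. If
  the triple product vanishes, then \<open>b j = 2\<close> or the double product vanishes.\<close>

lemma raise_lower_lower_lower:
  assumes "j \<in> {3..n + 1}"
  shows "E 0 j (E 1 0 (E 2 0 (E j 0 v))) = scale (b j - 2) (E 1 0 (E 2 0 v))"
proof -
  have "E 0 j (E 1 0 (E 2 0 (E j 0 v))) = E 1 j (E 2 0 (E j 0 v)) - E 1 0 (E 0 j (E 2 0 (E j 0 v)))"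
    using assms by (intro E_0j_Ei0) auto
  also have "E 1 j (E 2 0 (E j 0 v)) = - E 1 0 (E 2 0 v)"
    using assms v_highest[of 1 j] E_i0_Ej0[of 2 1 v] by (simp add: E_ij_Ek0 lin_0[OF E_lin])
  also have "E 0 j (E 2 0 (E j 0 v)) = scale (1 - b j) (E 2 0 v)"
    using assms by (intro raise_lower_lower) auto
  also have "E 1 0 (scale (1 - b j) (E 2 0 v)) = scale (1 - b j) (E 1 0 (E 2 0 v))"
    using n_ge_1 by (intro lin_scale[OF E_lin]) auto
  also have "- E 1 0 (E 2 0 v) - scale (1 - b j) (E 1 0 (E 2 0 v)) = scale (- 1 - (1 - b j)) (E 1 0 (E 2 0 v))"
    by (simp only: scale_left_diff_distrib scale_minus_left scale_one)
  finally show ?thesis by simp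
qed

lemma good_lower_v: "j \<in> {1..n + 1} \<Longrightarrow> good p b (rt j 0) (E j 0 v)"
  using good_E[OF v_good, of j 0] by simp

lemma sum_split_first: "(\<Sum>j\<in>{1..n + 1}. f j) = f 1 + (\<Sum>j\<in>{2..n + 1}. f j)" for f :: "nat \<Rightarrow> 'c::comm_monoid_add"
proof -
  have "{1..n + 1} = insert 1 {2..n + 1}" by auto
  then show ?thesis by simp
qed

lemma sum_b_eq:
  obtains M where "\<And>j. j \<in> {2..n + 1} \<Longrightarrow> b 1 = b j + of_nat (M j)"
    "(\<Sum>j\<in>{1..n + 1}. b j) = of_nat (n + 1) * b 1 - of_nat (\<Sum>j\<in>{2..n + 1}. M j)"
proof -
  have "\<exists>M. b 1 = b j + of_nat M" if "j \<in> {2..n + 1}" for j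
    by (rule dominant_add) (use that in auto)
  then obtain M where M: "\<And>j. j \<in> {2..n + 1} \<Longrightarrow> b 1 = b j + of_nat (M j)" by metis
  have "(\<Sum>j\<in>{2..n + 1}. b j) = (\<Sum>j\<in>{2..n + 1}. b 1 - of_nat (M j))"
    using M by (intro sum.cong) (auto simp: algebra_simps)
  also have "\<dots> = of_nat n * b 1 - of_nat (\<Sum>j\<in>{2..n + 1}. M j)"
    by (simp add: sum_subtractf)
  finally have "(\<Sum>j\<in>{1..n + 1}. b j) = of_nat (n + 1) * b 1 - of_nat (\<Sum>j\<in>{2..n + 1}. M j)"
    unfolding sum_split_first by (simp add: algebra_simps)
  then show ?thesis using that M by blast
qed

lemma kappa_0_pos: "kappa 0 \<ge> 1"
  using degree_1 degree_2 d_ge_1 d_le_2 r_ge_3 by (cases "d = 1") (auto simp: le_less_Suc_eq numeral_2_eq_2)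

text \<open>Raising again gives \<open>b 1\<close> times \<open>v\<close>, so otherwise
  \<open>b 1 = 0\<close>. By dominance the sum of the \<open>b j\<close> would then not be positive,
  against \<open>sum_b\<close> and \<open>kappa 0 > 0\<close>.\<close>

lemma E_10_v_ne_0: "E 1 0 v \<noteq> 0"
proof
  assume "E 1 0 v = 0"
  then have "scale (b 1) v = 0" using E_0j_Ej0_v[of 1] by (simp add: lin_0[OF E_lin])
  then have b1: "b 1 = 0" using v_ne_0 by simp
  obtain M where "(\<Sum>j\<in>{1..n + 1}. b j) = of_nat (n + 1) * b 1 - of_nat (\<Sum>j\<in>{2..n + 1}. M j)"
    by (rule sum_b_eq)
  then have "of_int (int (r - 1) * - int (\<Sum>j\<in>{2..n + 1}. M j)) = (of_int (int n * kappa 0) :: 'k)"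
    using sum_b b1 by simp
  then have "int (r - 1) * - int (\<Sum>j\<in>{2..n + 1}. M j) = int n * kappa 0"
    by (simp only: of_int_eq_iff)
  moreover have "int n * kappa 0 > 0" using kappa_0_pos n_ge_1 by simp
  moreover have "int (r - 1) * - int (\<Sum>j\<in>{2..n + 1}. M j) \<le> 0"
    by (simp add: mult_nonneg_nonneg del: of_nat_sum)
  ultimately show False by linarith
qed

text \<open>For d = 1 all products of two lowering operators vanish on \<open>v\<close>, hence
  \<open>b j = 1\<close> for j \<ge> 2, and by dominance the sum of the \<open>b j\<close> is at
  least n + 1. But \<open>sum_b\<close> and \<open>degree_1\<close> make it less than n.\<close>

lemma d_eq_2: "d = 2"
proof (rule ccontr)
  assume "d \<noteq> 2"
  then have d: "d = 1" using d_ge_1 d_le_2 by simp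
  have b1: "b j = 1" if j: "j \<in> {2..n + 1}" for j
  proof -
    have "good p b (rt j 0 + rt 1 0) (E 1 0 (E j 0 v))"
      using j good_lower_v by (intro good_E) auto
    then have "E 1 0 (E j 0 v) = 0"
      using d j by (intro good_below_eq_0) (auto simp: rt_def)
    then have "scale (1 - b j) (E 1 0 v) = 0"
      using raise_lower_lower[of 1 j] j by (simp add: lin_0[OF E_lin])
    then show ?thesis using E_10_v_ne_0 by simp
  qed
  have "n + 1 \<in> {2..n + 1}" using n_ge_1 by simp
  obtain M where M: "b 1 = b (n + 1) + of_nat M"
    using dominant_add[of 1 "n + 1"] n_ge_1 by auto
  have "(\<Sum>j\<in>{1..n + 1}. b j) = of_nat (n + 1 + M)"
    unfolding sum_split_first using M b1 \<open>n + 1 \<in> _\<close> by (simp add: algebra_simps)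
  then have "of_int (int (r - 1) * int (n + 1 + M)) = (of_int (int n * kappa 0) :: 'k)"
    using sum_b by simp
  then have "int (r - 1) * int (n + 1 + M) = int n * kappa 0"
    by (simp only: of_int_eq_iff)
  also have "\<dots> \<le> int n * (int r - 2)"
    using degree_1[OF d] by (intro mult_left_mono) auto
  also have "\<dots> < int (n + 1 + M) * (int r - 1)"
    using r_ge_3 by (intro mult_strict_mono) auto
  finally show False using r_ge_3 by (simp add: of_nat_diff mult.commute)
qed

lemma kappa_0: "kappa 0 = int r - 1"
  by (rule degree_2[OF d_eq_2])

lemma sum_b_n: "(\<Sum>j\<in>{1..n + 1}. b j) = of_nat n"
proof -
  have "of_nat (r - 1) * (\<Sum>j\<in>{1..n + 1}. b j) = of_nat (r - 1) * (of_nat n :: 'k)"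
    unfolding sum_b kappa_0 using r_ge_3 by (simp add: of_nat_diff mult.commute)
  moreover have "of_nat (r - 1) \<noteq> (0::'k)"
    using r_ge_3 unfolding of_nat_eq_0_iff by simp
  ultimately show ?thesis by (metis mult_cancel_left)
qed

text \<open>If \<open>E 1 0\<close> kills the bottom of the string, then so does its bracket
  \<open>E (n + 1) 0\<close> with \<open>E (n + 1) 1\<close>. The common kernel of both is stable
  under \<open>E 1 (n + 1)\<close>, which leads back up to \<open>v\<close>.\<close>

lemma E_10_lowest_ne_0:
  assumes "(E (n + 1) 1 ^^ M) v \<noteq> 0" "(E (n + 1) 1 ^^ Suc M) v = 0" "b 1 - b (n + 1) = of_nat M"
  shows "E 1 0 ((E (n + 1) 1 ^^ M) v) \<noteq> 0"
proof
  let ?N = "n + 1"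
  have N: "?N \<noteq> 1" "?N \<in> {1..n + 1}" "1 \<in> {1..n + 1}" using n_ge_1 by auto
  assume 0: "E 1 0 ((E ?N 1 ^^ M) v) = 0"
  \<comment> \<open>Here \<open>m\<close> counts the steps upwards from the bottom of the
    string.\<close>
  have "E 1 0 ((E ?N 1 ^^ (M - m)) v) = 0 \<and> E ?N 0 ((E ?N 1 ^^ (M - m)) v) = 0" if "m \<le> M" for m
    using that
  proof (induction m)
    case 0
    have "E ?N 1 (E 1 0 ((E ?N 1 ^^ M) v)) = E ?N 0 ((E ?N 1 ^^ M) v) + E 1 0 (E ?N 1 ((E ?N 1 ^^ M) v))"
      using E_ij_Ek0[of ?N 1 1] N by simp
    then show ?case using \<open>E 1 0 _ = 0\<close> assms(2) N by (simp add: lin_0[OF E_lin])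
  next
    case (Suc m)
    define x where "x = (E ?N 1 ^^ (M - m)) v"
    have x: "E 1 0 x = 0" "E ?N 0 x = 0" using Suc by (simp_all add: x_def)
    define i where "i = M - Suc m"
    have i: "M - m = Suc i" "M - Suc m = i" "i < M" using Suc.prems by (auto simp: i_def)
    have "E 1 0 (E 1 ?N x) = 0" "E ?N 0 (E 1 ?N x) = 0"
      using E_ij_Ek0[of 1 ?N 1 x] E_ij_Ek0[of 1 ?N ?N x] x N by (auto simp: lin_0[OF E_lin])
    moreover have "E 1 ?N x = scale (of_nat (Suc i) * (of_nat M - of_nat i)) ((E ?N 1 ^^ i) v)"
      unfolding x_def i(1) using raise_power[of 1 ?N i] N n_ge_1 assms(3) by simp
    moreover have "of_nat (Suc i) * (of_nat M - of_nat i) \<noteq> (0::'k)"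
      using i(3) by (simp del: of_nat_Suc)
    ultimately show ?case
      unfolding i(2) using N by (simp add: lin_scale[OF E_lin] del: of_nat_Suc)
  qed
  from this[of M] show False using E_10_v_ne_0 by simp
qed

lemma lowering_tuple:
  assumes "span S = UNIV" "\<And>x. x \<in> S \<Longrightarrow> \<exists>w. good p b w x"
  shows "\<exists>ws us c t. tuple ws us \<and> set us \<subseteq> S \<and> c \<noteq> 0 \<and> left_mult br us = fun_scale scale c (E 1 0) \<and>
    sum_list ws + kappa = rt 1 0 \<and> t < r - 1 \<and> (ws ! t) 0 = - 2 \<and>
    (\<forall>t'<r - 1. t' \<noteq> t \<longrightarrow> (ws ! t') 0 = - 1)"
proof -
  obtain ws us c where t: "tuple ws us" "set us \<subseteq> S" "c \<noteq> 0" "left_mult br us = fun_scale scale c (E 1 0)"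
    "sum_list ws + kappa = rt 1 0"
    using exists_root_tuple[of 1 0 S] assms by auto
  have "(sum_list ws + kappa) 0 = - 1" unfolding t(5) by (simp add: rt_def)
  from lowering_shape[OF d_eq_2 t(1) this] show ?thesis using t by metis
qed

lemma tuple_swap_root:
  assumes "tuple ws us" "sum_list ws + kappa = \<rho>" "t < r - 1" "good p b w y" "left_mult br us y \<noteq> 0"
  shows "\<exists>k\<le>n + 1. \<exists>l\<le>n + 1. \<rho> - ws ! t + w = rt k l"
proof -
  have "sum_list (ws[t := w]) + kappa = \<rho> - ws ! t + w"
    unfolding tuple_swap(3)[OF assms(1,3-5)] assms(2)[symmetric] by (simp add: algebra_simps)
  then show ?thesis using tuple_root[OF tuple_swap(1)[OF assms(1,3-5)]] by metis
qed

lemma root_degree_1: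
  assumes "l \<le> n + 1" "rt k l 0 = 1"
  shows "k = 0" "l \<in> {1..n + 1}"
  using assms by (cases "k = 0"; cases "l = 0"; auto simp: rt_def)+

text \<open>Exchanging the entry of degree -2 for the top and for the bottom of the string gives two
  roots \<open>rt 0 l\<close> and \<open>rt 0 l'\<close> that differ by M times
  \<open>rt (n + 1) 1\<close>. At coordinate n + 1 such roots differ by at most 1, and by 1 only if
  \<open>l = n + 1\<close>.\<close>

lemma highest_difference_le_1:
  assumes "(E (n + 1) 1 ^^ M) v \<noteq> 0" "(E (n + 1) 1 ^^ Suc M) v = 0" "b 1 - b (n + 1) = of_nat M"
    and "tuple ws us" "sum_list ws + kappa = rt 1 0" "left_mult br us = fun_scale scale c (E 1 0)" "c \<noteq> 0"
    and "t < r - 1" "(ws ! t) 0 = - 2"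
  shows "M \<le> 1" "M = 1 \<Longrightarrow> rt 1 0 - ws ! t = rt 0 (n + 1)"
proof -
  have "left_mult br us v \<noteq> 0" "left_mult br us ((E (n + 1) 1 ^^ M) v) \<noteq> 0"
    unfolding assms(6) fun_scale_def using assms(7) E_10_v_ne_0 E_10_lowest_ne_0[OF assms(1-3)] by auto
  note sw = tuple_swap_root[OF assms(4,5,8) v_good this(1)]
    tuple_swap_root[OF assms(4,5,8) good_power this(2)]
  have 0: "(rt 1 0 - ws ! t) 0 = 1" using assms(9) by (simp add: rt_def)
  obtain k l where kl: "l \<le> n + 1" "rt 1 0 - ws ! t = rt k l"
    using sw(1) by auto
  have "rt k l 0 = 1" using 0 unfolding kl(2) .
  then have k: "k = 0" "l \<in> {1..n + 1}" using root_degree_1[OF kl(1)] by auto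
  obtain k' l' where kl': "l' \<le> n + 1" "rt 1 0 - ws ! t + (\<lambda>i. int M * rt (n + 1) 1 i) = rt k' l'"
    using sw(2) n_ge_1 by auto
  have "rt k' l' 0 = 1"
    unfolding kl'(2)[symmetric] using 0 by (simp add: rt_def)
  then have k': "k' = 0" "l' \<in> {1..n + 1}" using root_degree_1[OF kl'(1)] by auto
  have "rt 0 l (n + 1) + int M * rt (n + 1) 1 (n + 1) = rt 0 l' (n + 1)"
    using fun_cong[OF kl'(2), of "n + 1"] unfolding kl(2) k k' by simp
  then have M: "int M = of_bool (l = n + 1) - of_bool (l' = n + 1)"
    using n_ge_1 by (auto simp: rt_def of_bool_def split: if_splits)
  then show "M \<le> 1" by (auto simp: of_bool_def split: if_splits)
  show "rt 1 0 - ws ! t = rt 0 (n + 1)" if "M = 1"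
    using M that kl(2) k by (auto simp: of_bool_def split: if_splits)
qed

text \<open>The values of the highest root \<open>rt 0 (n + 1)\<close> on the \<open>h0 n j\<close>.
  Relative to this reference weight the offset \<open>rt (n + 1) 0\<close> means weight 0.\<close>

definition adjoint_weight :: bool where
  "adjoint_weight \<longleftrightarrow> (\<forall>j\<in>{1..n + 1}. b j = (if j = n + 1 then 0 else 1))"

lemma kappa_adjoint:
  assumes adjoint_weight
  shows "kappa = (\<lambda>i. (int r - 1) * rt 0 (n + 1) i)"
proof (rule offset_eqI[OF n_ge_1 kappa_offset])
  show "is_offset n (\<lambda>i. (int r - 1) * rt 0 (n + 1) i)"
    using is_offset_rt[of 0 n "n + 1"] unfolding is_offset_def by (simp add: sum_distrib_left[symmetric])
  fix j assume j: "j \<in> {1..n + 1}"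
  have "of_int (kappa 0 + kappa j) = (of_nat (r - 1) * b j :: 'k)"
    by (rule kappa_b[OF j, symmetric])
  also have "\<dots> = of_int ((int r - 1) * (if j = n + 1 then 0 else 1))"
    using assms j r_ge_3 by (simp add: adjoint_weight_def of_nat_diff)
  finally show "kappa 0 + kappa j = (int r - 1) * rt 0 (n + 1) 0 + (int r - 1) * rt 0 (n + 1) j"
    using j unfolding of_int_eq_iff by (simp add: rt_def)
qed

text \<open>Counting with one functional shows that the tuple for \<open>E 1 0\<close> has an entry
  of weight 0. Exchanged for \<open>E (n + 1) 1 v\<close>, it leaves a Cartan element as left
  multiplication; this kills weight 0, although an exchange never kills the removed entry.\<close>

lemma not_adjoint: "\<not> adjoint_weight"
proof
  assume adj: adjoint_weight
  let ?N = "n + 1"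
  have N: "?N \<noteq> 1" "?N \<in> {1..n + 1}" "1 \<in> {1..n + 1}" "1 < ?N" using n_ge_1 by auto
  have b: "b 1 = 1" "b ?N = 0" using adj N unfolding adjoint_weight_def by auto
  obtain M where M: "b 1 - b ?N = of_nat M" "(E ?N 1 ^^ M) v \<noteq> 0" "(E ?N 1 ^^ Suc M) v = 0"
    using dominant[OF N(3,2,4)] by blast
  have M1: "M = 1" using M(1) b by simp
  obtain ws us c t0 where t: "tuple ws us" "c \<noteq> 0" "left_mult br us = fun_scale scale c (E 1 0)"
    "sum_list ws + kappa = rt 1 0" "t0 < r - 1" "(ws ! t0) 0 = - 2" "\<And>t. t < r - 1 \<Longrightarrow> t \<noteq> t0 \<Longrightarrow> (ws ! t) 0 = - 1"
    using lowering_tuple[OF span_good] by auto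
  \<comment> \<open>On roots and 0 this functional is at most 2, with equality only at
    \<open>rt 1 (n + 1)\<close>.\<close>
  define h where "h = (\<lambda>w::nat \<Rightarrow> int. w 1 - w ?N)"
  \<comment> \<open>The weight of the tuple after its entry \<open>t\<close> is exchanged for
    \<open>v\<close>, whose offset is 0.\<close>
  define \<zeta> where "\<zeta> = (\<lambda>t. rt 1 0 - ws ! t)"
  have \<zeta>0: "\<zeta> t0 = rt 0 ?N"
    unfolding \<zeta>_def by (rule highest_difference_le_1(2)[OF M(2,3,1) t(1,4,3,2,5,6) M1])
  have Lv: "left_mult br us v \<noteq> 0" "left_mult br us (E ?N 1 v) \<noteq> 0"
    unfolding t(3) fun_scale_def using t(2) E_10_v_ne_0 E_10_lowest_ne_0[OF M(2,3,1)] M1 by auto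
  have root: "\<exists>k l. \<zeta> t = rt k l" if "t < r - 1" for t
    using tuple_swap_root[OF t(1,4) that v_good Lv(1)] by (auto simp: \<zeta>_def)
  have h_le: "h (\<zeta> t) \<le> 2" if t: "t < r - 1" for t
    using root[OF t] by (auto simp: h_def rt_def of_bool_def)
  \<comment> \<open>Each slot falls short of 2 by \<open>1 + h (ws ! t)\<close>, and the values of
    \<open>h\<close> on the offsets sum to \<open>1 - (r - 1)\<close>.\<close>
  have "(\<Sum>t<r - 1. 2 - h (\<zeta> t)) = 1"
  proof -
    have "sum_list ws i = (\<Sum>t<r - 1. (ws ! t) i)" for i
      unfolding sum_list_fun_apply using tuple_length[OF t(1)] by (simp add: sum_list_sum_nth atLeast0LessThan)
    then have "(\<Sum>t<r - 1. h (ws ! t)) = h (sum_list ws)"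
      by (simp add: h_def sum_subtractf)
    also have "\<dots> = h (rt 1 0) - h kappa"
      using t(4)[symmetric] by (simp add: h_def)
    also have "h kappa = int r - 1" using n_ge_1 by (simp add: kappa_adjoint[OF adj] h_def rt_def)
    also have "h (rt 1 0) = 1" using n_ge_1 by (simp add: h_def rt_def)
    finally have "(\<Sum>t<r - 1. h (ws ! t)) = 2 - int r" by simp
    moreover have "(\<Sum>t<r - 1. 2 - h (\<zeta> t)) = (\<Sum>t<r - 1. 1 + h (ws ! t))"
      using n_ge_1 by (intro sum.cong refl) (simp add: h_def \<zeta>_def rt_def)
    ultimately show ?thesis using r_ge_3 by (simp add: sum.distrib of_nat_diff)
  qed
  obtain t1 where t1: "t1 < r - 1" "t1 \<noteq> t0"
  proof (cases "t0 = 0")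
    case True
    then show ?thesis using that[of 1] r_ge_3 by simp
  next
    case False
    then show ?thesis using that[of 0] r_ge_3 by simp
  qed
  \<comment> \<open>Slot \<open>t0\<close> alone uses up the total shortfall, since
    \<open>h (rt 0 (n + 1)) = 1\<close>; so \<open>h\<close> attains its maximum 2 at
    \<open>t1\<close>.\<close>
  have "(\<Sum>t\<in>{t0, t1}. 2 - h (\<zeta> t)) \<le> (\<Sum>t<r - 1. 2 - h (\<zeta> t))"
    using t(5) t1 h_le by (intro sum_mono2) auto
  then have "h (\<zeta> t1) \<ge> 2"
    using t1(2) n_ge_1 unfolding \<open>(\<Sum>t<r - 1. 2 - h (\<zeta> t)) = 1\<close> by (simp add: \<zeta>0) (simp add: h_def rt_def)
  moreover obtain k l where kl: "\<zeta> t1 = rt k l" using root[OF t1(1)] by blast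
  ultimately have "k = 1" "l = ?N"
    using N(1) by (auto simp: h_def rt_def of_bool_def split: if_splits)
  then have z1: "\<zeta> t1 = rt 1 ?N" using kl by simp
  then have w1: "ws ! t1 = rt ?N 0"
    by (auto simp: \<zeta>_def fun_eq_iff rt_def algebra_simps)
  have gE: "good p b (rt ?N 1) (E ?N 1 v)"
    using good_E[OF v_good, of ?N 1] n_ge_1 by simp
  note sw = tuple_swap[OF t(1) t1(1) gE Lv(2)]
  have "sum_list (ws[t1 := rt ?N 1]) + kappa = \<zeta> t1 + rt ?N 1"
    unfolding sw(3) \<zeta>_def t(4)[symmetric] by (simp add: algebra_simps)
  also have "\<dots> = 0" unfolding z1 by (simp add: fun_eq_iff rt_def)
  finally obtain cs where cs: "left_mult br (us[t1 := E ?N 1 v]) = (\<lambda>x. \<Sum>j\<in>{1..n + 1}. scale (cs j) (H j x))"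
    using tuple_cartan[OF sw(1)] by blast
  have "H j (us ! t1) = 0" if j: "j \<in> {1..n + 1}" for j
    using good_H[OF tuple_good[OF t(1) t1(1)] j] adj j unfolding w1 adjoint_weight_def
    by (auto simp: rt_def)
  then have "left_mult br (us[t1 := E ?N 1 v]) (us ! t1) = 0"
    unfolding cs by (intro sum.neutral) simp
  then show False using sw(2) by simp
qed

text \<open>For n \<ge> 2, \<open>E 1 0 (E 2 0 v) = 0\<close> gives \<open>b 2 = 1\<close>; the
  \<open>b j\<close> are then non-increasing integers with sum n and spread at most 1, which is the
  adjoint weight. For n = 1 the sum is 1, and spread 1 is again adjoint, so the spread is 0.\<close>

lemma highest_weight_cases:
  "n = 1" "b 1 = b 2" "(E 2 1) v = 0"
proof -
  let ?N = "n + 1"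
  have N: "?N \<noteq> 1" "?N \<in> {1..n + 1}" "1 \<in> {1..n + 1}" "1 < ?N" using n_ge_1 by auto
  obtain M where M: "b 1 - b ?N = of_nat M" "(E ?N 1 ^^ M) v \<noteq> 0" "(E ?N 1 ^^ Suc M) v = 0"
    using dominant[OF N(3,2,4)] by blast
  obtain ws us c t0 where t: "tuple ws us" "c \<noteq> 0" "left_mult br us = fun_scale scale c (E 1 0)"
    "sum_list ws + kappa = rt 1 0" "t0 < r - 1" "(ws ! t0) 0 = - 2"
    using lowering_tuple[OF span_good] by auto
  have M1: "M \<le> 1" by (rule highest_difference_le_1(1)[OF M(2,3,1) t(1,4,3,2,5,6)])
  show n1: "n = 1"
  proof (rule ccontr)
    assume "n \<noteq> 1"
    then have n: "n \<ge> 2" using n_ge_1 by simp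
    \<comment> \<open>Otherwise the vanishing products of three lowering operators give
      \<open>b j = 2\<close> for j \<ge> 3; dominance makes \<open>b 1\<close> and
      \<open>b 2\<close> at least 2 as well, and the sum exceeds n.\<close>
    have F: "E 1 0 (E 2 0 v) = 0"
    proof (rule ccontr)
      assume nz: "E 1 0 (E 2 0 v) \<noteq> 0"
      have b2: "b j = 2" if j: "j \<in> {3..n + 1}" for j
      proof -
        have "good p b ((rt j 0 + rt 2 0) + rt 1 0) (E 1 0 (E 2 0 (E j 0 v)))"
          using j by (intro good_E good_lower_v) auto
        then have "E 1 0 (E 2 0 (E j 0 v)) = 0"
          using d_eq_2 j by (intro good_below_eq_0) (auto simp: rt_def)
        then have "scale (b j - 2) (E 1 0 (E 2 0 v)) = 0"
          using raise_lower_lower_lower[OF j] j by (simp add: lin_0[OF E_lin])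
        then show ?thesis using nz by simp
      qed
      obtain M1 M2 where M: "b 1 = b ?N + of_nat M1" "b 2 = b ?N + of_nat M2"
        using dominant_add[of 1 ?N] dominant_add[of 2 ?N] n by auto
      have "{1..n + 1} = {1, 2} \<union> {3..n + 1}" using n by auto
      then have "(\<Sum>j\<in>{1..n + 1}. b j) = b 1 + b 2 + (\<Sum>j\<in>{3..n + 1}. b j)"
        by (simp add: sum.union_disjoint add.assoc)
      also have "(\<Sum>j\<in>{3..n + 1}. b j) = (\<Sum>j\<in>{3..n + 1}. 2)"
        using b2 by (intro sum.cong) auto
      also have "b 1 + b 2 + \<dots> = of_nat (2 * (n + 1) + M1 + M2)"
        using M b2[of ?N] n by (simp add: of_nat_diff algebra_simps)
      finally have "of_nat n = (of_nat (2 * (n + 1) + M1 + M2) :: 'k)" using sum_b_n by simp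
      then have "n = 2 * (n + 1) + M1 + M2" by (simp only: of_nat_eq_iff)
      then show False by simp
    qed
    then have "scale (1 - b 2) (E 1 0 v) = 0"
      using raise_lower_lower[of 1 2] n by (simp add: lin_0[OF E_lin])
    then have b2: "b 2 = 1" using E_10_v_ne_0 by simp
    have "\<exists>B. b j = of_int B" if j: "j \<in> {1..n + 1}" for j
    proof -
      have "j = 1 \<or> j = 2 \<or> j > 2" using j by simp linarith
      then consider "j = 1" | "j = 2" | "j > 2" by blast
      then show ?thesis
      proof cases
        case 1
        then obtain P where "b j = b 2 + of_nat P" using dominant_add[of 1 2] n by auto
        then have "b j = of_int (1 + int P)" using b2 by simp
        then show ?thesis by blast
      next
        case 2
        then show ?thesis using b2 by (intro exI[of _ 1]) simp
      next
        case 3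
        then obtain P where "b 2 = b j + of_nat P" using dominant_add[of 2 j] j n by auto
        then have "b j = of_int (1 - int P)" using b2 by (simp add: algebra_simps)
        then show ?thesis by blast
      qed
    qed
    then obtain B where B: "\<And>j. j \<in> {1..n + 1} \<Longrightarrow> b j = of_int (B j)" by metis
    have ge: "B j \<ge> B k" if jk: "j \<in> {1..n + 1}" "k \<in> {1..n + 1}" "j < k" for j k
    proof -
      obtain P where "b j = b k + of_nat P" using dominant_add[OF jk] by blast
      then have "of_int (B j) = (of_int (B k + int P) :: 'k)" using B jk by simp
      then show ?thesis unfolding of_int_eq_iff by simp
    qed
    have bounds: "B ?N \<le> B j" "B j \<le> B 1" if "j \<in> {1..n + 1}" for j
      using ge[OF that N(2)] ge[OF N(3) that] that by (cases "j = ?N"; cases "j = 1"; auto)+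
    have "of_int (B 1 - B ?N) = (of_int (int M) :: 'k)" using M(1) B[OF N(2)] B[OF N(3)] by simp
    then have BM: "B 1 - B ?N = int M" by (simp only: of_int_eq_iff)
    have B2: "B 2 = 1" using B[of 2] b2 n by (simp add: of_int_eq_1_iff[symmetric] del: of_int_eq_1_iff)
    have "(of_int (\<Sum>j\<in>{1..n + 1}. B j) :: 'k) = (\<Sum>j\<in>{1..n + 1}. b j)"
      unfolding of_int_sum by (intro sum.cong) (auto simp: B)
    then have "of_int (\<Sum>j\<in>{1..n + 1}. B j) = (of_int (int n) :: 'k)" using sum_b_n by simp
    then have sumB: "(\<Sum>j\<in>{1..n + 1}. B j) = int n" by (simp only: of_int_eq_iff)
    \<comment> \<open>n + 1 integers with sum n cannot all be positive.\<close>
    have BN: "B ?N \<le> 0"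
    proof (rule ccontr)
      assume "\<not> B ?N \<le> 0"
      then have "(\<Sum>j\<in>{1..n + 1}. 1) \<le> (\<Sum>j\<in>{1..n + 1}. B j)"
        using bounds(1) by (intro sum_mono) force
      then show False using sumB by simp
    qed
    have B1: "B 1 \<le> 1" "B ?N = 0"
      using BN BM M1 bounds(2)[of 2] B2 n by auto
    have "B j = 1" if j: "j \<in> {1..n}" for j
    proof (rule ccontr)
      assume "B j \<noteq> 1"
      then have j0: "B j \<le> 0" using bounds(2)[of j] B1 j by force
      have "{1..n + 1} = insert ?N {1..n}" by auto
      then have "(\<Sum>j\<in>{1..n + 1}. B j) = B ?N + (B j + (\<Sum>j\<in>{1..n} - {j}. B j))"
        using sum.remove[of "{1..n}" j B] j by simp
      moreover have "(\<Sum>j\<in>{1..n} - {j}. B j) \<le> (\<Sum>j\<in>{1..n} - {j}. 1)"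
        using bounds(2) B1 by (intro sum_mono) force
      moreover have "int (card ({1..n} - {j})) = int n - 1" using j by (simp add: of_nat_diff)
      ultimately show False using sumB B1 j0 by simp
    qed
    then have adjoint_weight
      unfolding adjoint_weight_def using B B1(2) by auto
    then show False using not_adjoint by simp
  qed
  have "{1..n + 1} = {1, 2}" using n1 by auto
  then have s: "b 1 + b 2 = 1" using sum_b_n n1 by simp
  have "M = 0"
  proof (rule ccontr)
    assume "M \<noteq> 0"
    then have "M = 1" using M1 by simp
    then have "b 1 - b 2 = 1" using M(1) n1 by (simp add: numeral_2_eq_2)
    then have b12: "b 1 = b 2 + 1" by (simp add: diff_eq_eq add.commute)
    then have "2 * b 2 = 0" using s by simp
    then have b2: "b 2 = 0" by simp
    then have "adjoint_weight"
      unfolding adjoint_weight_def using b12 n1 by (auto simp: le_Suc_eq numeral_2_eq_2)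
    then show False using not_adjoint by simp
  qed
  then show "b 1 = b 2" "(E 2 1) v = 0" using M n1 by (simp_all add: numeral_2_eq_2)
qed

text \<open>The remaining highest weight belongs to the natural representation of \<open>osp(2,2)\<close>, which
  is isomorphic to \<open>sl(1,2)\<close>. Writing \<open>v\<close>, \<open>y1\<close>, \<open>y2\<close>, \<open>u\<close> for its weight basis, the left
  multiplication by \<open>u\<close>, \<open>v\<close> and equally many copies of \<open>y1\<close> and \<open>y2\<close> acts on \<open>y1\<close>, \<open>y2\<close> by
  opposite scalars, whereas the derivation that maps \<open>y1\<close> to \<open>y2\<close> forces these scalars to have the same sign.\<close>

lemma no_highest_weight: False
proof -
  note n1 = highest_weight_cases(1) and b12 = highest_weight_cases(2) and E21v = highest_weight_cases(3)
  have I: "{1..n + 1} = {1, 2}" using n1 by auto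
  have I1: "1 \<in> {1..n + 1}" and I2: "2 \<in> {1..n + 1}" using n1 by auto
  have "b 1 + b 2 = 1" using sum_b_n unfolding I using n1 by simp
  then have b: "b 1 = 1 / 2" "b 2 = 1 / 2" using b12 by (auto simp: field_simps)
  have E12v: "E 1 2 v = 0" using v_highest n1 by simp
  define y1 where "y1 = E 1 0 v"
  define y2 where "y2 = E 2 0 v"
  define u where "u = E 1 0 y2"
  have Elin: "E k l 0 = 0" if "k \<noteq> l" "k \<le> 2" "l \<le> 2" for k l
    using that n1 by (intro lin_0[OF E_lin]) auto
  have Esc: "E k l (scale a x) = scale a (E k l x)" if "k \<noteq> l" "k \<le> 2" "l \<le> 2" for k l a x
    using that n1 by (intro lin_scale[OF E_lin]) auto
  have gy1: "good p b (rt 1 0) y1" and gy2: "good p b (rt 2 0) y2"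
    unfolding y1_def y2_def using good_lower_v I1 I2 by blast+
  have gu: "good p b (rt 2 0 + rt 1 0) u"
    unfolding u_def using good_E[OF gy2, of 1 0] by simp
  have up: "E 0 1 v = 0" "E 0 2 v = 0" using v_highest n1 by auto
  have E12y2: "E 1 2 y2 = y1"
    unfolding y2_def y1_def using E_ij_Ek0[OF I1 I2 I2] E12v by (simp add: Elin)
  have E21y1: "E 2 1 y1 = y2"
    unfolding y2_def y1_def using E_ij_Ek0[OF I2 I1 I1] E21v by (simp add: Elin)
  have E12y1: "E 1 2 y1 = 0"
    unfolding y1_def using E_ij_Ek0[OF I1 I2 I1] E12v by (simp add: Elin)
  have E21y2: "E 2 1 y2 = 0"
    unfolding y2_def using E_ij_Ek0[OF I2 I1 I2] E21v by (simp add: Elin)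
  have y1_ne: "y1 \<noteq> 0" using E_10_v_ne_0 by (simp add: y1_def)
  then have y2_ne: "y2 \<noteq> 0" using E12y2 by (auto simp: Elin)
  have low: "E 1 0 y1 = 0" "E 2 0 y2 = 0" "E 2 0 y1 = - u"
    unfolding y1_def y2_def u_def using E_i0_Ei0[OF I1] E_i0_Ei0[OF I2] E_i0_Ej0[OF I2 I1] by auto
  have high: "E 0 1 y1 = scale (b 1) v" "E 0 2 y2 = scale (b 2) v" "E 0 2 y1 = 0" "E 0 1 y2 = 0"
    unfolding y1_def y2_def using E_0j_Ej0_v I1 I2 E_0j_Ei0[OF I1 I2] E_0j_Ei0[OF I2 I1] up E12v E21v
    by (auto simp: Elin)
  have E12u: "E 1 2 u = 0" "E 2 1 u = 0"
    unfolding u_def using E_ij_Ek0[OF I1 I2 I1] E_ij_Ek0[OF I2 I1 I1] E12y2 E21y2 low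
    by (auto simp: Elin)
  have lowu: "E 1 0 u = 0" "E 2 0 u = 0"
    unfolding u_def using E_i0_Ei0[OF I1] E_i0_Ej0[OF I2 I1] low by (auto simp: Elin)
  have E01u: "E 0 1 u = scale (b 1 + of_int (rt 2 0 0 + rt 2 0 1)) y2"
    unfolding u_def using EE_odd_opposite[OF I1, of y2] good_H[OF gy2 I1] high by (simp add: Elin)
  have E02u: "E 0 2 u = y1 - scale (b 2) y1"
    unfolding u_def using E_0j_Ei0[OF I1 I2] E12y2 high by (simp add: Esc y1_def)
  let ?S = "{v, y1, y2, u}"
  have S_good: "\<exists>w. good p b w x" if "x \<in> ?S" for x
    using that v_good gy1 gy2 gu by blast
  \<comment> \<open>The relations above send the four vectors into their span under every root
    vector; tuple entries may therefore be taken among them.\<close>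
  have S_span: "span ?S = UNIV"
  proof (rule good_subset_span_UNIV[OF v_good v_ne_0 _ S_good])
    fix k l x assume kl: "k \<noteq> l" "k \<le> n + 1" "l \<le> n + 1" "x \<in> ?S"
    have base: "x \<in> span ?S" if "x \<in> ?S" for x using that by (rule span_base)
    have neg_u: "- u \<in> span ?S" and multiples: "scale a v \<in> span ?S" "scale a y1 \<in> span ?S" "scale a y2 \<in> span ?S" for a
      using base by (auto intro: span_neg span_scale)
    have kl': "k = 0 \<and> l = 1 \<or> k = 0 \<and> l = 2 \<or> k = 1 \<and> l = 2 \<or> k = 2 \<and> l = 1 \<or> k = 1 \<and> l = 0 \<or> k = 2 \<and> l = 0"
      using kl(1-3) n1 by (auto simp: le_Suc_eq numeral_2_eq_2)
    have "E k l v \<in> span ?S"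
      using kl' base span_zero by (elim disjE conjE) (simp_all only: up E12v E21v y1_def[symmetric] y2_def[symmetric], simp_all)
    moreover have "E k l y1 \<in> span ?S"
      using kl' base span_zero neg_u multiples by (elim disjE conjE) (simp_all only: high E12y1 E21y1 low, simp_all)
    moreover have "E k l y2 \<in> span ?S"
      using kl' base span_zero multiples by (elim disjE conjE) (simp_all only: high E12y2 E21y2 low u_def[symmetric], simp_all)
    moreover have "E k l u \<in> span ?S"
      using kl' base span_zero multiples span_diff by (elim disjE conjE) (simp_all only: E01u E02u E12u lowu, simp_all)
    ultimately show "E k l x \<in> span ?S" using kl(4) by blast
  qed auto
  obtain ws us c t where t: "tuple ws us" "set us \<subseteq> ?S" "c \<noteq> 0" "left_mult br us = fun_scale scale c (E 1 0)"
    "sum_list ws + kappa = rt 1 0" "t < r - 1" "(ws ! t) 0 = - 2" "\<And>t'. t' < r - 1 \<Longrightarrow> t' \<noteq> t \<Longrightarrow> (ws ! t') 0 = - 1"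
    using lowering_tuple[OF S_span S_good] by blast
  have len: "length us = r - 1" "length ws = r - 1" using tuple_length[OF t(1)] by auto
  have entry: "us ! s \<in> ?S" "us ! s \<noteq> 0" "good p b (ws ! s) (us ! s)" if s: "s < r - 1" for s
  proof -
    have "us ! s \<in> set us" using len s by simp
    then show "us ! s \<in> ?S" by (rule subsetD[OF t(2)])
  qed (use tuple_entry_ne_0[OF t(1) s] tuple_good[OF t(1) s] in auto)
  have classify: "x = v \<and> w = 0 \<or> x = y1 \<and> w = rt 1 0 \<or> x = y2 \<and> w = rt 2 0 \<or> x = u \<and> w = rt 2 0 + rt 1 0"
    if "x \<in> ?S" "x \<noteq> 0" "good p b w x" for x w
    using that good_unique v_good gy1 gy2 gu by blast
  \<comment> \<open>Of the four vectors only \<open>u\<close> has degree -2; the entries of degree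
    -1 are \<open>y1\<close> or \<open>y2\<close>.\<close>
  have ut: "us ! t = u" "u \<noteq> 0" "ws ! t = rt 2 0 + rt 1 0"
    using classify[OF entry[OF t(6)]] t(7) entry[OF t(6)] by (auto simp: rt_def)
  have us: "us ! s = y1 \<and> ws ! s = rt 1 0 \<or> us ! s = y2 \<and> ws ! s = rt 2 0" if "s < r - 1" "s \<noteq> t" for s
    using classify[OF entry[OF that(1)]] t(8)[OF that] by (auto simp: rt_def)
  have rt_ne: "rt 1 0 \<noteq> rt 2 0" "rt 1 0 \<noteq> 0" "rt 2 0 \<noteq> 0" "rt 1 0 \<noteq> rt 2 0 + rt 1 0" "rt 2 0 \<noteq> rt 2 0 + rt 1 0"
    "rt 2 0 + rt 1 0 \<noteq> 0"
  proof -
    have "rt 1 0 1 = 1" "rt 2 0 1 = 0" "rt 1 0 2 = 0" "rt 2 0 2 = 1" by (simp_all add: rt_def)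
    then show "rt 1 0 \<noteq> rt 2 0" "rt 1 0 \<noteq> 0" "rt 2 0 \<noteq> 0" "rt 1 0 \<noteq> rt 2 0 + rt 1 0" "rt 2 0 \<noteq> rt 2 0 + rt 1 0"
      "rt 2 0 + rt 1 0 \<noteq> 0"
      by (metis zero_fun_apply plus_fun_apply add_0_left add_0_right zero_neq_one one_add_one zero_neq_numeral)+
  qed
  have ne: "y1 \<noteq> y2" "v \<noteq> y1" "u \<noteq> y1" "v \<noteq> y2" "u \<noteq> y2"
    using good_unique[OF gy1 _ y1_ne] good_unique[OF gy2 _ y2_ne] v_good gy2 gu rt_ne by metis+
  define off where "off = (\<lambda>x. if x = y1 then rt 1 0 else if x = y2 then rt 2 0 else if x = u then rt 2 0 + rt 1 0 else 0)"
  have vu: "v \<noteq> u" using good_unique[OF gu _ ut(2)] v_good rt_ne(6) by metis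
  have off: "off v = 0" "off y1 = rt 1 0" "off y2 = rt 2 0" "off u = rt 2 0 + rt 1 0"
    using ne vu by (auto simp: off_def)
  have ws: "ws = map off us"
    using len ut us off by (intro nth_equalityI) (auto, metis)
  define zs where "zs = take t us @ drop (Suc t) us"
  have us_eq: "us = take t us @ u # drop (Suc t) us"
    using id_take_nth_drop[of t us] t(6) len ut(1) by simp
  have mus: "mset us = add_mset u (mset zs)"
    unfolding zs_def by (subst us_eq) simp
  have "set zs \<subseteq> {y1, y2}"
  proof
    fix x assume "x \<in> set zs"
    then have "x \<in> set (take t us) \<or> x \<in> set (drop (Suc t) us)" by (simp add: zs_def)
    then have "\<exists>s<r - 1. s \<noteq> t \<and> x = us ! s"
    proof
      assume "x \<in> set (take t us)"
      then obtain i where "i < t" "x = us ! i" by (auto simp: in_set_conv_nth)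
      then show ?thesis using t(6) by (intro exI[of _ i]) auto
    next
      assume "x \<in> set (drop (Suc t) us)"
      then obtain i where "i < r - 1 - Suc t" "x = us ! (Suc t + i)"
        using len t(6) by (auto simp: in_set_conv_nth)
      then show ?thesis by (intro exI[of _ "Suc t + i"]) auto
    qed
    then show "x \<in> {y1, y2}" using us by blast
  qed
  then have mzs: "mset zs = replicate_mset (count (mset zs) y1) y1 + replicate_mset (count (mset zs) y2) y2"
    using ne by (intro multiset_eqI) (auto simp: count_eq_zero_iff)
  define A where "A = count (mset zs) y1"
  define B where "B = count (mset zs) y2"
  have mus: "mset us = add_mset u (replicate_mset A y1 + replicate_mset B y2)"
    unfolding mus mzs[folded A_def B_def] ..
  have sum_mset_rep: "(\<Sum>x\<in>#replicate_mset m x. f x) = int m * f x" for m x and f :: "'v \<Rightarrow> int"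
    by (induction m) (auto simp: algebra_simps)
  have sums: "sum_list ws i = off u i + int A * rt 1 0 i + int B * rt 2 0 i" for i
  proof -
    have "sum_list ws i = (\<Sum>x\<leftarrow>us. off x i)"
      unfolding sum_list_fun_apply ws by (simp add: comp_def)
    also have "\<dots> = (\<Sum>x\<in>#mset us. off x i)"
      by (simp only: mset_map[symmetric] sum_mset_sum_list)
    finally show ?thesis unfolding mus by (simp add: sum_mset_rep off)
  qed
  have k12: "kappa 1 = kappa 2"
  proof -
    have "of_int (kappa 0 + kappa 1) = (of_int (kappa 0 + kappa 2) :: 'k)"
      using kappa_b[OF I1] kappa_b[OF I2] b12 by metis
    then show ?thesis unfolding of_int_eq_iff by simp
  qed
  \<comment> \<open>Coordinates 1 and 2 of the tuple equation, whose first summand 1 comes from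
    \<open>u\<close>; \<open>kappa 1 = kappa 2\<close> then gives one more \<open>y1\<close> than
    \<open>y2\<close>.\<close>
  have k1: "1 + int A + kappa 1 = 1" "1 + int B + kappa 2 = 0"
    using fun_cong[OF t(5), of 1] fun_cong[OF t(5), of 2] by (simp_all add: sums off rt_def)
  then have AB: "A = B + 1" using k12 by linarith
  \<comment> \<open>One \<open>y1\<close> is moved out and \<open>v\<close> in:
    \<open>gs @ [y1]\<close> is a permutation of \<open>us @ [v]\<close>, whose bracket is a nonzero
    multiple of \<open>y1\<close>.\<close>
  define gs where "gs = [u, v] @ replicate B y1 @ replicate B y2"
  have len_gs: "length gs = r - 1"
  proof -
    have "size (mset us) = 1 + A + B" unfolding mus by simp
    then show ?thesis using len AB by (simp add: gs_def)
  qed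
  have r: "r = 2 * B + 3" using len_gs r_ge_3 by (simp add: gs_def)
  have hom: "set us \<subseteq> V 0 \<union> V 1" "v \<in> V 0 \<union> V 1" "u \<in> V 0 \<union> V 1" "y1 \<in> V 0 \<union> V 1" "y2 \<in> V 0 \<union> V 1"
    using tuple_homogeneous[OF t(1)] good_homogeneous v_good gu gy1 gy2 by blast+
  have m: "mset (gs @ [y1]) = mset (us @ [v])"
    by (simp add: gs_def mus AB)
  have nz: "br (gs @ [y1]) \<noteq> 0"
  proof
    assume "br (gs @ [y1]) = 0"
    then have "br (us @ [v]) = 0"
      using len_gs hom arity by (intro br_permute_eq_0[OF m]) (auto simp: gs_def)
    moreover have "br (us @ [v]) = scale c y1"
      using fun_cong[OF t(4), of v] by (simp add: left_mult_def fun_scale_def y1_def)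
    ultimately show False using t(3) y1_ne by simp
  qed
  have tg: "tuple (map off gs) gs"
    unfolding tuple_def
  proof (intro conjI len_gs)
    show "list_all2 (good p b) (map off gs) gs"
      using v_good gy1 gy2 gu by (auto simp: gs_def off list_all2_conv_all_nth nth_append nth_Cons' less_Suc_eq_0_disj)
    show "left_mult br gs \<noteq> 0"
      using nz by (auto simp: left_mult_def fun_eq_iff)
  qed
  have "sum_list (map off gs) + kappa = 0"
  proof (rule offset_eqI[OF n_ge_1 _ is_offset_0])
    have sl: "sum_list (replicate m w) i = int m * w i" for m i and w :: "nat \<Rightarrow> int"
      by (induction m) (auto simp: algebra_simps)
    have 1: "sum_list (map off gs) i = off u i + int B * rt 1 0 i + int B * rt 2 0 i" for i
      by (simp add: gs_def off sl)
    have off_g: "is_offset n (sum_list (map off gs) + kappa)"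
      using tuple_offset[OF tg] kappa_offset by (rule is_offset_add)
    then show "is_offset n (sum_list (map off gs) + kappa)" .
    fix j assume "j \<in> {1..n + 1}"
    then have j: "j = 1 \<or> j = 2" using I by blast
    have "{..n + 1} = {0, 1, 2}" using n1 by auto
    then have "(sum_list (map off gs) + kappa) 0 + (sum_list (map off gs) + kappa) 1 + (sum_list (map off gs) + kappa) 2 = 0"
      using off_g unfolding is_offset_def by (simp del: plus_fun_apply)
    moreover have "(sum_list (map off gs) + kappa) 1 = 0" "(sum_list (map off gs) + kappa) 2 = 0"
      using k1 AB k12 by (auto simp: 1 off rt_def)
    ultimately show "(sum_list (map off gs) + kappa) 0 + (sum_list (map off gs) + kappa) j = 0 0 + 0 j"
      using j by auto
  qed
  then obtain cs where cs: "left_mult br gs = (\<lambda>x. \<Sum>j\<in>{1..n + 1}. scale (cs j) (H j x))"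
    using tuple_cartan[OF tg] by blast
  define s where "s = (cs 1 - cs 2) / 2"
  have Hy: "H 1 y1 = scale (1 / 2) y1" "H 2 y1 = scale (- 1 / 2) y1" "H 1 y2 = scale (- 1 / 2) y2" "H 2 y2 = scale (1 / 2) y2"
    using good_H[OF gy1 I1] good_H[OF gy1 I2] good_H[OF gy2 I1] good_H[OF gy2 I2] by (simp_all add: b b[unfolded One_nat_def] rt_def)
  have act: "br (gs @ [x]) = scale (cs 1) (H 1 x) + scale (cs 2) (H 2 x)" for x
    using fun_cong[OF cs, of x] unfolding I by (simp add: left_mult_def)
  have "cs 1 * (1 / 2) + cs 2 * (- 1 / 2) = s" "cs 1 * (- 1 / 2) + cs 2 * (1 / 2) = - s"
    by (simp_all add: s_def field_simps)
  then have X1: "br (gs @ [y1]) = scale s y1" and X2: "br (gs @ [y2]) = scale (- s) y2"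
    unfolding act Hy by (simp_all only: scale_scale scale_left_distrib[symmetric])
  let ?xs = "gs @ [y1]"
  have lxs: "length ?xs = r" using len_gs arity by simp
  \<comment> \<open>Which copy of \<open>y1\<close> is replaced does not matter, and no sign
    appears: if \<open>y1\<close> and \<open>y2\<close> are odd, entries commute freely; if
    \<open>y1\<close> is even, a repeated \<open>y1\<close> would make the bracket 0, so B = 0 and
    there is a single copy.\<close>
  have block: "br (?xs[i := y2]) = br (gs @ [y2])" if i: "i < r" "?xs ! i = y1" for i
  proof -
    define ys where "ys = replicate B y1 @ replicate B y2 @ [y1]"
    have xs: "?xs = [u, v] @ ys" by (simp add: gs_def ys_def)
    have i2: "i \<ge> 2"
    proof (rule ccontr)
      assume "\<not> i \<ge> 2"
      then have "i = 0 \<or> i = 1" by linarith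
      then show False using i(2) ne vu by (auto simp: xs)
    qed
    then have i': "i - 2 < length ys" "ys ! (i - 2) = y1"
      using i lxs unfolding xs by (auto simp: nth_append nth_Cons' numeral_2_eq_2 split: if_splits)
    have upd: "?xs[i := y2] = [u, v] @ ys[i - 2 := y2]"
      unfolding xs using i2 by (auto simp: numeral_2_eq_2 split: nat.split)
    have m: "mset (ys[i - 2 := y2]) = mset (replicate B y1 @ replicate B y2 @ [y2])"
      using i' by (simp add: mset_update) (simp add: ys_def)
    show ?thesis
    proof (cases "y1 \<in> V 1")
      case True
      have q: "y2 \<in> V 1"
        using True good_parity[OF gy1] good_parity[OF gy2] homogeneous_both_eq_0 y1_ne bit_eq_0_or_1[of "p + of_int (rt 1 0 0)"]
        using parts_disjoint by (auto simp: rt_def)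
      have "set (ys[i - 2 := y2]) \<subseteq> V 1"
        using mset_eq_setD[OF m] True q by auto
      then have "br ([u, v] @ ys[i - 2 := y2]) = br ([u, v] @ replicate B y1 @ replicate B y2 @ [y2])"
        using hom lxs xs by (intro br_permute_odd[OF m]) auto
      then show ?thesis unfolding upd by (simp add: gs_def)
    next
      case False
      then have e: "y1 \<in> V 0" using hom by blast
      have "B = 0"
      proof (rule ccontr)
        assume "B \<noteq> 0"
        then obtain B' where B': "B = Suc B'" by (cases B) auto
        have "br ?xs = 0"
          by (rule br_repeated_even[OF e _ lxs, of "{#u, v#} + replicate_mset B' y1 + replicate_mset B y2"])
            (use hom B' in \<open>auto simp: gs_def\<close>)
        then show False using nz by simp
      qed
      then have "ys = [y1]" by (simp add: ys_def)
      then have "i = 2" using i'(1) i2 by simp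
      then show ?thesis using \<open>B = 0\<close> by (simp add: gs_def)
    qed
  qed
  have "E 2 1 (br ?xs) = (\<Sum>i<r. br (?xs[i := E 2 1 (?xs ! i)]))"
  proof -
    have "set ?xs \<subseteq> V 0 \<union> V 1" using hom by (auto simp: gs_def)
    moreover have "even_der (E 2 1)" by (rule E_even_der[OF I2 I1]) simp
    ultimately show ?thesis using lxs unfolding even_der_def by blast
  qed
  also have "\<dots> = (\<Sum>i<r. if ?xs ! i = y1 then br (gs @ [y2]) else 0)"
  proof (intro sum.cong refl)
    fix i assume i: "i \<in> {..<r}"
    show "br (?xs[i := E 2 1 (?xs ! i)]) = (if ?xs ! i = y1 then br (gs @ [y2]) else 0)"
    proof (cases "?xs ! i = y1")
      case True
      then show ?thesis using block[of i] i E21y1 by simp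
    next
      case False
      have "?xs ! i \<in> set ?xs" using i lxs by (intro nth_mem) simp
      then have "E 2 1 (?xs ! i) = 0"
        using False E21v E12u(2) E21y2 by (auto simp: gs_def)
      then show ?thesis
        using br_update_scale[of i ?xs 0 0] i lxs False by simp
    qed
  qed
  also have "\<dots> = scale (of_nat (card {i. i < r \<and> ?xs ! i = y1})) (br (gs @ [y2]))"
    by (simp add: sum.If_cases sum_constant_scale lessThan_def Int_def)
  also have "card {i. i < r \<and> ?xs ! i = y1} = B + 1"
  proof -
    have "card {i. i < r \<and> ?xs ! i = y1} = length (filter (\<lambda>x. x = y1) ?xs)"
      unfolding length_filter_conv_card lxs ..
    also have "\<dots> = B + 1" using ne by (simp add: gs_def)
    finally show ?thesis .
  qed
  \<comment> \<open>\<open>E 2 1\<close> maps \<open>s y1\<close> to \<open>s y2\<close>, whereas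
    the derivation rule gives B + 1 terms, each equal to \<open>- s y2\<close>.\<close>
  finally have "scale s y2 = scale (- (of_nat (B + 1) * s)) y2"
    unfolding X1 X2 using E21y1 by (simp add: Esc)
  then have "s = - (of_nat (B + 1) * s)" using y2_ne scale_right_imp_eq by blast
  then have "of_nat (B + 2) * s = 0" by (simp add: algebra_simps)
  then have "s = 0" using of_nat_eq_0_iff[of "B + 2", where 'a = 'k] by (simp del: of_nat_add)
  then show False using X1 nz by simp
qed

end

context A0_filippov begin

lemma no_weight_vector:
  assumes "v0 \<noteq> 0" "v0 \<in> V q" "\<And>j. j \<in> {1..n + 1} \<Longrightarrow> H j v0 = scale (b0 j) v0"
  shows False
proof -
  have "good q b0 0 v0" 
  proof -
    have "q + of_int ((0 :: nat \<Rightarrow> int) 0) = q" by (simp only: zero_fun_apply of_int_0 add_0_right)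
    then show ?thesis unfolding good_def using assms is_offset_0 by (simp only: ball_simps) simp
  qed
  from exists_highest[OF this assms(1)] obtain p b v d where
    "good p b 0 v" "v \<noteq> 0" "\<And>k l. k < l \<Longrightarrow> l \<le> n + 1 \<Longrightarrow> E k l v = 0"
    "\<And>w x. good p b w x \<Longrightarrow> x \<noteq> 0 \<Longrightarrow> - int d \<le> w 0 \<and> w 0 \<le> 0"
    "\<exists>w x. good p b w x \<and> x \<noteq> 0 \<and> w 0 = - int d"
    by blast
  then interpret A0_highest scale V r br n \<phi> p b v d by unfold_locales
  show False by (rule no_highest_weight)
qed

text \<open>Since \<open>h_elt n 1 = h0 n 1\<close> and the later \<open>h_elt\<close> are
  differences of neighbouring \<open>h0\<close>, the eigenvalues of the \<open>H j\<close> on the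
  given vector are obtained one after another.\<close>

lemma not_highest_weight_module: "\<not> highest_weight_module scale V n \<phi>"
proof
  assume "highest_weight_module scale V n \<phi>"
  then obtain v q a where v: "v \<noteq> 0" "v \<in> V q" "\<And>i. i \<in> {1..n + 1} \<Longrightarrow> \<phi> (h_elt n i) v = scale (a i) v"
    unfolding highest_weight_module_def by blast
  have "\<exists>c. H j v = scale c v" if "j \<in> {1..n + 1}" for j
    using that
  proof (induction j)
    case (Suc j)
    show ?case
    proof (cases "j = 0")
      case True
      have "h_elt n 1 = (h0 n 1 :: 'k mat)"
        unfolding h_elt_def h0_def e_unit_eq_e0[symmetric] by (simp add: numeral_2_eq_2)
      then show ?thesis using v(3)[of 1] True by (auto simp: H_def)
    next
      case False
      then have j: "j \<in> {1..n + 1}" "Suc j \<in> {1..n + 1}" using Suc.prems by auto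
      obtain c where c: "H j v = scale c v" using Suc.IH j by blast
      have "h_elt n (Suc j) = e0 n j j - (e0 n (Suc j) (Suc j) :: 'k mat)"
        using False by (simp add: h_elt_def e_unit_eq_e0[symmetric])
      also have "\<dots> = h0 n j + (- 1) \<cdot>\<^sub>m h0 n (Suc j)"
        by (rule eq_matI) (auto simp: h0_def)
      finally have "\<phi> (h_elt n (Suc j)) v = H j v + scale (- 1) (H (Suc j) v)"
        using phi_add[OF part_elems[OF h0_part[OF j(1)]] elems_smult[OF part_elems[OF h0_part[OF j(2)]]], of "- 1"]
          phi_smult[OF part_elems[OF h0_part[OF j(2)]], of "- 1"]
        by (simp add: H_def fun_scale_def)
      then have "H (Suc j) v = scale c v - scale (a (Suc j)) v"
        using v(3)[OF j(2)] c by (simp add: algebra_simps)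
      then show ?thesis by (metis scale_left_diff_distrib)
    qed
  qed simp
  then obtain b where "\<And>j. j \<in> {1..n + 1} \<Longrightarrow> H j v = scale (b j) v" by metis
  then show False using no_weight_vector v(1,2) by blast
qed

end

theorem corollary5p1:
  fixes n r :: nat
  assumes "n \<ge> 1" and "r \<ge> 3"
  shows "\<not> (\<exists>(scale :: 'k::{alg_closed_field, field_char_0} \<Rightarrow> 'v::ab_group_add \<Rightarrow> 'v) V br \<phi>.
    filippov_superalgebra scale V r br \<and>
    finite_dim scale \<and>
    simple_filippov scale V r br \<and>
    lie_super_iso (A0 n) (Inder scale V r br) \<phi> \<and>
    highest_weight_module scale V n \<phi>)"
proof (intro notI, elim exE conjE)
  fix scale :: "'k \<Rightarrow> 'v \<Rightarrow> 'v" and V br \<phi>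
  assume "filippov_superalgebra scale V r br" "finite_dim scale" "simple_filippov scale V r br"
    "lie_super_iso (A0 n) (Inder scale V r br) \<phi>" "highest_weight_module scale V n \<phi>"
  then interpret A0_filippov scale V r br n \<phi>
    using assms by (intro A0_filippov.intro A0_filippov_axioms.intro)
  show False
    using not_highest_weight_module \<open>highest_weight_module scale V n \<phi>\<close> by blast
qed

end
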